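(* Let $a,b,c$ be real polynomials in one variable and $\alpha>0$ with $a(x)\ge\alpha$ for $x\in[0,1]$. Suppose there exist scalars $0<\epsilon_1<\epsilon_2<\infty$, $\delta,\beta>0$, $d_1,d_2\in\mathbb N$ and polynomials $\{M,K_1,K_2\}\in\Xi_{d_1,d_2,\epsilon_1,\epsilon_2}$ and $\{N,P_1,P_2\}\in\Xi_{d_1,d_2,\epsilon_1,\epsilon_2}$ such that, with $\{T_0,\dots,T_6\}=\mathcal M_{\epsilon_1}(M,K_1,K_2)$ and $\{Q_0,\dots,Q_8\}=\mathcal N_{\epsilon_1}(N,P_1,P_2)$, $$\{-T_0-2\delta M,\,-T_1-2\delta K_1,\,-T_2-2\delta K_2\}\in\Xi_{d_1,d_2,0,\beta},$$ $$\{-Q_0-2\delta N,\,-Q_1-2\delta P_1,\,-Q_2-2\delta P_2\}\in\Xi_{d_1,d_2,0,\beta},$$ $$T_3\le 0,\quad T_4(x)=0,\quad Q_3\le 0,\quad Q_4(x)=0.$$ Let $\mathcal P$ be the operator on $L_2(0,1)$ with multiplier $M$ and semi-separable kernel given by $K_1,K_2$, and let $\mathcal S$ be the operator with multiplier $N$ and semi-separable kernel given by $P_1,P_2$. Let $\mathcal F=\mathcal Z\mathcal P^{-1}$, where $\mathcal Z g=Z_1g_x(1)+\int_0^1K_1(1,x)g(x)\,dx$ and $Z_1$ is any scalar such that $T_5Z_1>-T_6M(1)$. Let $O_2<0$ be a scalar such that $Q_5+\frac1{O_2}Q_7<0$, and let $O_1=\mathcal S^{-1}R_1$ with $R_1(x)=-\frac12\left(O_2Q_6(x)+Q_8(x)\right)$.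 Then for any solution $(w,\hat w)$ of the coupled system $$w_t(x,t)=a(x)w_{xx}(x,t)+b(x)w_x(x,t)+c(x)w(x,t)+f(x,t),$$ $$\hat w_t(x,t)=a(x)\hat w_{xx}(x,t)+b(x)\hat w_x(x,t)+c(x)\hat w(x,t)+O_1(x)\left(\hat w_x(1,t)-w_x(1,t)\right),$$ $$w_x(0,t)=0,\quad w(1,t)=\mathcal F\hat w(\cdot,t),$$ $$\hat w_x(0,t)=0,\quad \hat w(1,t)=\mathcal F\hat w(\cdot,t)+O_2\left(\hat w_x(1,t)-w_x(1,t)\right),$$ there exists a scalar $\gamma>0$ such that $$\|w\|_{L_2(0,\infty;L_2(0,1))}\le\gamma\,\|f\|_{L_2(0,\infty;L_2(0,1))},$$ for any $f\in L_2(0,\infty;L_2(0,1))$.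
   Context: $L_2(0,1)$ is the real Hilbert space of square integrable functions on $[0,1]$; $\|f\|_{L_2(0,\infty;L_2(0,1))}=\left(\int_0^\infty\|f(\cdot,t)\|_{L_2(0,1)}^2dt\right)^{1/2}$. Here $x\in[0,1]$, $t\ge0$. Solutions are classical: they are assumed to exist and be once continuously differentiable in $t\in(0,\infty)$ and twice in $x\in[0,1]$. **Operators.** Given polynomials $M(x)$, $K_1(x,\xi)$, $K_2(x,\xi)$, the operator with multiplier $M$ and semi-separable kernel given by $K_1,K_2$ is $(\mathcal Pz)(x)=M(x)z(x)+\int_0^1K(x,\xi)z(\xi)\,d\xi$, where $K(x,\xi)=K_1(x,\xi)$ for $\xi\le x$ and $K(x,\xi)=K_2(x,\xi)$ for $\xi>x$. **The set $\Xi$.** $Z_d(\cdot)$ is the column vector of all monomials of degree $\le d$ in its variables. Write $Z_1(x)=Z_{d_1}(x)$ (a vector, unrelated to the scalar gain $Z_1$) and $Z_2(x,y)=Z_{d_2}(x,y)$. For $\epsilon_1\ge0$, $\{M,K_1,K_2\}\in\Xi_{d_1,d_2,\epsilon_1,\epsilon_2}$ means that there is a symmetric matrix $U=(U_{ij})_{i,j=1}^3$ (blocks of compatible size) with $U\ge\mathrm{diag}(\epsilon_1I,0,0)$ in the positive semidefinite order, such that $M(x)=Z_1(x)^TU_{11}Z_1(x)$, $$K_1(x,\xi)=Z_1(x)^TU_{12}Z_2(x,\xi)+Z_2(\xi,x)^TU_{31}Z_1(\xi)+\int_0^\xi Z_2(\eta,x)^TU_{33}Z_2(\eta,\xi)d\eta+\int_\xi^xZ_2(\eta,x)^TU_{32}Z_2(\eta,\xi)d\eta+\int_x^1Z_2(\eta,x)^TU_{22}Z_2(\eta,\xi)d\eta,$$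 $K_2(x,\xi)=K_1(\xi,x)$, and $\epsilon_2=(\theta_1+\theta_2)\lambda_{\max}(U)$, where $\theta_1=\sup_{x\in[0,1]}Z_1(x)^TZ_1(x)$ and $\theta_2=\sup_{(x,\xi)\in[0,1]^2}\left|\int_0^\xi g\,d\eta+\int_x^1g\,d\eta\right|$ with $g(x,\xi,\eta)=Z_2(\eta,x)^TZ_2(\eta,\xi)$. For $\epsilon_1>0$ the associated operator is bounded, self-adjoint and coercive on $L_2(0,1)$, hence boundedly invertible. **Notation.** $K_{i,x}$, $K_{i,\xi}$ denote partial derivatives with respect to the first and second argument; $K_{2,x}(0,x)$ means the derivative in the first argument evaluated at first argument $0$ and second argument $x$; similarly $P_{2,x}(0,x)$, $P_{1,x}(1,x)$. Subscript $x$ on one-variable functions is the derivative. **The map $\mathcal M_{\epsilon_1}$.** $\{T_0,\dots,T_6\}=\mathcal M_{\epsilon_1}(M,K_1,K_2)$ means - $T_0(x)=(a_{xx}(x)-b_x(x))M(x)+b(x)M_x(x)+a(x)M_{xx}(x)+2c(x)M(x)-\frac{\pi^2}2\alpha\epsilon_1+2a(x)\left[\frac{\partial}{\partial x}(K_1(x,\xi)-K_2(x,\xi))\right]_{\xi=x}$, - $T_1(x,\xi)=a(x)K_{1,xx}(x,\xi)+b(x)K_{1,x}(x,\xi)+a(\xi)K_{1,\xi\xi}(x,\xi)+b(\xi)K_{1,\xi}(x,\xi)+(c(x)+c(\xi))K_1(x,\xi)$, - $T_2(x,\xi)=T_1(\xi,x)$, - $T_3=(a_x(0)-b(0))M(0)+a(0)M_x(0)-\frac{\pi^2}2\alpha\epsilon_1$,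 - $T_4(x)=2a(0)K_{2,x}(0,x)+\pi^2\alpha\epsilon_1$, - $T_5=(b(1)-a_x(1))M(1)+a(1)M_x(1)$, - $T_6=2a(1)M(1)$. **The map $\mathcal N_{\epsilon_1}$.** $\{Q_0,\dots,Q_8\}=\mathcal N_{\epsilon_1}(N,P_1,P_2)$ means - $Q_0(x)=\frac{\partial}{\partial x}\left[\frac{\partial}{\partial x}(a(x)N(x))-b(x)N(x)\right]+2\left[\frac{\partial}{\partial x}\left[a(x)(P_1(x,\xi)-P_2(x,\xi))\right]\right]_{\xi=x}+2N(x)c(x)-\frac{\pi^2}2\alpha\epsilon_1$, - $Q_1(x,\xi)=\frac{\partial}{\partial x}\left[\frac{\partial}{\partial x}(a(x)P_1(x,\xi))-b(x)P_1(x,\xi)\right]+\frac{\partial}{\partial\xi}\left[\frac{\partial}{\partial\xi}(a(\xi)P_1(x,\xi))-b(\xi)P_1(x,\xi)\right]+(c(x)+c(\xi))P_1(x,\xi)$, - $Q_2(x,\xi)=Q_1(\xi,x)$, - $Q_3=(a_x(0)-b(0))N(0)+a(0)N_x(0)-\frac{\pi^2}2\alpha\epsilon_1$, - $Q_4(x)=2(a_x(0)-b(0))P_2(0,x)+2a(0)P_{2,x}(0,x)+\pi^2\alpha\epsilon_1$, - $Q_5=(b(1)-a_x(1))N(1)-a(1)N_x(1)$, - $Q_6(x)=2(b(1)-a_x(1))P_1(1,x)-2a(1)P_{1,x}(1,x)$, - $Q_7=2a(1)N(1)$, - $Q_8(x)=2a(1)P_1(1,x)$.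
   Formalization: The claim is proved for Z_1 ≤ 0 and for solutions whose w and ŵ start from zero initial state; as printed it fails for f = 0 with nonzero initial data, and for some Z_1 > 0 the closed loop is unstable. *)

theory Defs
  imports "HOL-Analysis.Analysis" "Jordan_Normal_Form.Char_Poly"
begin

no_notation inner (infix "\<bullet>" 70)
no_notation vec_nth (infixl "$" 90)
hide_type (open) Finite_Cartesian_Product.vec
hide_const (open) Finite_Cartesian_Product.vec

section \<open>Polynomial data\<close>

text \<open>Polynomials in one or two variables are represented by the functions they induce on the
  whole real line resp. plane. Hence identities between them are required for all real arguments,
  not only on the unit interval, and \<^term>\<open>deriv\<close> computes their (partial) derivatives.\<close>

definition poly_fun2 :: "(real \<Rightarrow> real \<Rightarrow> real) \<Rightarrow> bool" where
  "poly_fun2 p \<longleftrightarrow> real_polynomial_function (\<lambda>(x, y). p x y)"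

definition Zvec1 :: "nat \<Rightarrow> real \<Rightarrow> real vec" where
  "Zvec1 d x = vec (Suc d) (\<lambda>i. x ^ i)"

text \<open>Exponents \<open>(i, j)\<close> with \<open>i + j \<le> d\<close>, each listed once.\<close>

definition monos2 :: "nat \<Rightarrow> (nat \<times> nat) list" where
  "monos2 d = concat (map (\<lambda>k. map (\<lambda>i. (i, k - i)) [0..<Suc k]) [0..<Suc d])"

definition Zvec2 :: "nat \<Rightarrow> real \<Rightarrow> real \<Rightarrow> real vec" where
  "Zvec2 d x y = vec_of_list (map (\<lambda>(i, j). x ^ i * y ^ j) (monos2 d))"

section \<open>The set \<open>\<Xi>\<close>\<close>

definition blk_dim :: "nat \<Rightarrow> nat \<Rightarrow> nat \<Rightarrow> nat" where
  "blk_dim d1 d2 i = (if i = 1 then Suc d1 else length (monos2 d2))"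

text \<open>Row/column at which block \<open>i \<in> {1, 2, 3}\<close> of a 3 by 3 block matrix starts;
  \<open>i = 4\<close> gives the total size.\<close>

definition blk_off :: "nat \<Rightarrow> nat \<Rightarrow> nat \<Rightarrow> nat" where
  "blk_off d1 d2 i = (\<Sum>k = 1..<i. blk_dim d1 d2 k)"

definition blk :: "nat \<Rightarrow> nat \<Rightarrow> real mat \<Rightarrow> nat \<Rightarrow> nat \<Rightarrow> real mat" where
  "blk d1 d2 U i j = mat (blk_dim d1 d2 i) (blk_dim d1 d2 j)
     (\<lambda>(r, s). U $$ (blk_off d1 d2 i + r, blk_off d1 d2 j + s))"

definition psd_mat :: "real mat \<Rightarrow> bool" where
  "psd_mat A \<longleftrightarrow> transpose_mat A = A \<and> (\<forall>v \<in> carrier_vec (dim_row A). 0 \<le> v \<bullet> (A *\<^sub>v v))"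

definition lambda_max :: "real mat \<Rightarrow> real" where
  "lambda_max A = Max {k. eigenvalue A k}"

definition theta1 :: "nat \<Rightarrow> real" where
  "theta1 d1 = (SUP x\<in>{0..1}. Zvec1 d1 x \<bullet> Zvec1 d1 x)"

definition theta2 :: "nat \<Rightarrow> real" where
  "theta2 d2 = (SUP (x, \<xi>)\<in>{0..1} \<times> {0..1}.
     \<bar>(LBINT \<eta>=0..\<xi>. Zvec2 d2 \<eta> x \<bullet> Zvec2 d2 \<eta> \<xi>) + (LBINT \<eta>=x..1. Zvec2 d2 \<eta> x \<bullet> Zvec2 d2 \<eta> \<xi>)\<bar>)"

text \<open>The interval integrals are oriented, so the formula for \<open>K1\<close> is the polynomial identity
  for all real \<open>x\<close> and \<open>\<xi>\<close>, not only for \<open>0 \<le> \<xi> \<le> x \<le> 1\<close>.\<close>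

definition Xi :: "nat \<Rightarrow> nat \<Rightarrow> real \<Rightarrow> real \<Rightarrow>
    ((real \<Rightarrow> real) \<times> (real \<Rightarrow> real \<Rightarrow> real) \<times> (real \<Rightarrow> real \<Rightarrow> real)) set" where
  "Xi d1 d2 \<epsilon>1 \<epsilon>2 = {(M, K1, K2).
     real_polynomial_function M \<and> poly_fun2 K1 \<and> poly_fun2 K2 \<and>
     (\<exists>U \<in> carrier_mat (blk_off d1 d2 4) (blk_off d1 d2 4).
        transpose_mat U = U \<and>
        psd_mat (U - mat (blk_off d1 d2 4) (blk_off d1 d2 4)
                       (\<lambda>(i, j). if i = j \<and> i < blk_dim d1 d2 1 then \<epsilon>1 else 0)) \<and>
        (\<forall>x. M x = Zvec1 d1 x \<bullet> (blk d1 d2 U 1 1 *\<^sub>v Zvec1 d1 x)) \<and>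
        (\<forall>x \<xi>. K1 x \<xi> =
             Zvec1 d1 x \<bullet> (blk d1 d2 U 1 2 *\<^sub>v Zvec2 d2 x \<xi>)
           + Zvec2 d2 \<xi> x \<bullet> (blk d1 d2 U 3 1 *\<^sub>v Zvec1 d1 \<xi>)
           + (LBINT \<eta>=0..\<xi>. Zvec2 d2 \<eta> x \<bullet> (blk d1 d2 U 3 3 *\<^sub>v Zvec2 d2 \<eta> \<xi>))
           + (LBINT \<eta>=\<xi>..x. Zvec2 d2 \<eta> x \<bullet> (blk d1 d2 U 3 2 *\<^sub>v Zvec2 d2 \<eta> \<xi>))
           + (LBINT \<eta>=x..1. Zvec2 d2 \<eta> x \<bullet> (blk d1 d2 U 2 2 *\<^sub>v Zvec2 d2 \<eta> \<xi>))) \<and>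
        (\<forall>x \<xi>. K2 x \<xi> = K1 \<xi> x) \<and>
        \<epsilon>2 = (theta1 d1 + theta2 d2) * lambda_max U)}"

section \<open>The maps \<open>\<M>\<close> and \<open>\<N>\<close>\<close>

definition map_M where
  "map_M (a :: real \<Rightarrow> real) (b :: real \<Rightarrow> real) (c :: real \<Rightarrow> real) (\<alpha> :: real) (\<epsilon>1 :: real)
         (M :: real \<Rightarrow> real) (K1 :: real \<Rightarrow> real \<Rightarrow> real) (K2 :: real \<Rightarrow> real \<Rightarrow> real) =
   (let T1 = (\<lambda>x \<xi>. a x * (deriv ^^ 2) (\<lambda>s. K1 s \<xi>) x + b x * deriv (\<lambda>s. K1 s \<xi>) x
                   + a \<xi> * (deriv ^^ 2) (\<lambda>s. K1 x s) \<xi> + b \<xi> * deriv (\<lambda>s. K1 x s) \<xi>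
                   + (c x + c \<xi>) * K1 x \<xi>)
    in ((\<lambda>x. ((deriv ^^ 2) a x - deriv b x) * M x + b x * deriv M x + a x * (deriv ^^ 2) M x
             + 2 * c x * M x - pi\<^sup>2 / 2 * \<alpha> * \<epsilon>1
             + 2 * a x * deriv (\<lambda>s. K1 s x - K2 s x) x),
        T1,
        (\<lambda>x \<xi>. T1 \<xi> x),
        (deriv a 0 - b 0) * M 0 + a 0 * deriv M 0 - pi\<^sup>2 / 2 * \<alpha> * \<epsilon>1,
        (\<lambda>x. 2 * a 0 * deriv (\<lambda>s. K2 s x) 0 + pi\<^sup>2 * \<alpha> * \<epsilon>1),
        (b 1 - deriv a 1) * M 1 + a 1 * deriv M 1,
        2 * a 1 * M 1))"

definition map_N where
  "map_N (a :: real \<Rightarrow> real) (b :: real \<Rightarrow> real) (c :: real \<Rightarrow> real) (\<alpha> :: real) (\<epsilon>1 :: real)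
         (N :: real \<Rightarrow> real) (P1 :: real \<Rightarrow> real \<Rightarrow> real) (P2 :: real \<Rightarrow> real \<Rightarrow> real) =
   (let Q1 = (\<lambda>x \<xi>. deriv (\<lambda>r. deriv (\<lambda>s. a s * P1 s \<xi>) r - b r * P1 r \<xi>) x
                   + deriv (\<lambda>r. deriv (\<lambda>s. a s * P1 x s) r - b r * P1 x r) \<xi>
                   + (c x + c \<xi>) * P1 x \<xi>)
    in ((\<lambda>x. deriv (\<lambda>r. deriv (\<lambda>s. a s * N s) r - b r * N r) x
             + 2 * deriv (\<lambda>s. a s * (P1 s x - P2 s x)) x
             + 2 * N x * c x - pi\<^sup>2 / 2 * \<alpha> * \<epsilon>1),
        Q1,
        (\<lambda>x \<xi>. Q1 \<xi> x),
        (deriv a 0 - b 0) * N 0 + a 0 * deriv N 0 - pi\<^sup>2 / 2 * \<alpha> * \<epsilon>1,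
        (\<lambda>x. 2 * (deriv a 0 - b 0) * P2 0 x + 2 * a 0 * deriv (\<lambda>s. P2 s x) 0
             + pi\<^sup>2 * \<alpha> * \<epsilon>1),
        (b 1 - deriv a 1) * N 1 - a 1 * deriv N 1,
        (\<lambda>x. 2 * (b 1 - deriv a 1) * P1 1 x - 2 * a 1 * deriv (\<lambda>s. P1 s x) 1),
        2 * a 1 * N 1,
        (\<lambda>x. 2 * a 1 * P1 1 x)))"

section \<open>\<open>L\<^sub>2\<close> spaces and operators\<close>

definition L2_01 :: "(real \<Rightarrow> real) \<Rightarrow> bool" where
  "L2_01 g \<longleftrightarrow> set_borel_measurable lborel {0..1} g \<and> set_integrable lborel {0..1} (\<lambda>x. (g x)\<^sup>2)"

definition norm_L2_01 :: "(real \<Rightarrow> real) \<Rightarrow> real" where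
  "norm_L2_01 g = sqrt (LBINT x:{0..1}. (g x)\<^sup>2)"

text \<open>Functions of space and time are written \<open>w x t\<close>.\<close>

definition L2_time :: "(real \<Rightarrow> real \<Rightarrow> real) \<Rightarrow> bool" where
  "L2_time w \<longleftrightarrow>
     set_borel_measurable (lborel \<Otimes>\<^sub>M lborel) ({0..1} \<times> {0<..}) (\<lambda>(x, t). w x t) \<and>
     (AE t in lborel. 0 < t \<longrightarrow> L2_01 (\<lambda>x. w x t)) \<and>
     set_integrable lborel {0<..} (\<lambda>t. (norm_L2_01 (\<lambda>x. w x t))\<^sup>2)"

definition norm_L2_time :: "(real \<Rightarrow> real \<Rightarrow> real) \<Rightarrow> real" where
  "norm_L2_time w = sqrt (LBINT t:{0<..}. (norm_L2_01 (\<lambda>x. w x t))\<^sup>2)"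

definition semisep_op where
  "semisep_op (M :: real \<Rightarrow> real) (K1 :: real \<Rightarrow> real \<Rightarrow> real) (K2 :: real \<Rightarrow> real \<Rightarrow> real)
     (z :: real \<Rightarrow> real) =
   (\<lambda>x. M x * z x + (LBINT \<xi>:{0..1}. (if \<xi> \<le> x then K1 x \<xi> else K2 x \<xi>) * z \<xi>))"

text \<open>The inverse of the operator on \<open>L\<^sub>2(0,1)\<close>, as a function on \<open>[0,1]\<close> (extended by \<open>0\<close>):
  it is used only for continuous \<open>g\<close>, where the \<open>L\<^sub>2\<close> class \<open>z\<close> with image \<open>g\<close> has exactly one
  continuous representative, because \<open>M z\<close> is \<open>g\<close> minus a continuous function and \<open>M\<close> is positive.
  This representative is as smooth as \<open>g\<close>, which gives a meaning to its boundary derivative.\<close>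

definition semisep_inv where
  "semisep_inv (M :: real \<Rightarrow> real) (K1 :: real \<Rightarrow> real \<Rightarrow> real) (K2 :: real \<Rightarrow> real \<Rightarrow> real)
     (g :: real \<Rightarrow> real) =
   (THE z. L2_01 z \<and> (AE x in lborel. x \<in> {0..1} \<longrightarrow> semisep_op M K1 K2 z x = g x) \<and>
           continuous_on {0..1} z \<and> (\<forall>x. x \<notin> {0..1} \<longrightarrow> z x = 0))"

section \<open>Derivatives and classical solutions\<close>

text \<open>Space derivatives on \<open>[0,1]\<close> are one-sided at the end points.\<close>

definition D01 :: "(real \<Rightarrow> real) \<Rightarrow> real \<Rightarrow> real" where
  "D01 g x = vector_derivative g (at x within {0..1})"

definition dx :: "(real \<Rightarrow> real \<Rightarrow> real) \<Rightarrow> real \<Rightarrow> real \<Rightarrow> real" where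
  "dx w x t = D01 (\<lambda>s. w s t) x"

definition dt :: "(real \<Rightarrow> real \<Rightarrow> real) \<Rightarrow> real \<Rightarrow> real \<Rightarrow> real" where
  "dt w x t = vector_derivative (w x) (at t)"

text \<open>Once continuously differentiable in \<open>t > 0\<close> and twice in \<open>x \<in> [0,1]\<close>, with derivatives
  that are jointly continuous in \<open>(x, t)\<close>.\<close>

definition classical :: "(real \<Rightarrow> real \<Rightarrow> real) \<Rightarrow> bool" where
  "classical w \<longleftrightarrow>
     (\<forall>x\<in>{0..1}. \<forall>t>0. w x differentiable at t) \<and>
     (\<forall>x\<in>{0..1}. \<forall>t>0. (\<lambda>s. w s t) differentiable at x within {0..1}) \<and>
     (\<forall>x\<in>{0..1}. \<forall>t>0. (\<lambda>s. dx w s t) differentiable at x within {0..1}) \<and>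
     continuous_on ({0..1} \<times> {0<..}) (\<lambda>(x, t). w x t) \<and>
     continuous_on ({0..1} \<times> {0<..}) (\<lambda>(x, t). dt w x t) \<and>
     continuous_on ({0..1} \<times> {0<..}) (\<lambda>(x, t). dx w x t) \<and>
     continuous_on ({0..1} \<times> {0<..}) (\<lambda>(x, t). dx (dx w) x t)"

text \<open>Zero initial state, attained in \<open>L\<^sub>2(0,1)\<close>. An \<open>L\<^sub>2\<close>-gain bound that is to hold for every
  \<open>f\<close>, in particular for \<open>f = 0\<close>, only makes sense for solutions that start at rest.\<close>

definition starts_at_rest :: "(real \<Rightarrow> real \<Rightarrow> real) \<Rightarrow> bool" where
  "starts_at_rest w \<longleftrightarrow> ((\<lambda>t. norm_L2_01 (\<lambda>x. w x t)) \<longlongrightarrow> 0) (at_right 0)"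

definition Z_op :: "real \<Rightarrow> (real \<Rightarrow> real \<Rightarrow> real) \<Rightarrow> (real \<Rightarrow> real) \<Rightarrow> real" where
  "Z_op Z1 K1 g = Z1 * D01 g 1 + (LBINT x:{0..1}. K1 1 x * g x)"

definition coupled_solution where
  "coupled_solution (a :: real \<Rightarrow> real) (b :: real \<Rightarrow> real) (c :: real \<Rightarrow> real)
     (F :: (real \<Rightarrow> real) \<Rightarrow> real) (O1 :: real \<Rightarrow> real) (O2 :: real)
     (f :: real \<Rightarrow> real \<Rightarrow> real) (w :: real \<Rightarrow> real \<Rightarrow> real) (wh :: real \<Rightarrow> real \<Rightarrow> real) \<longleftrightarrow>
   classical w \<and> classical wh \<and>
   (\<forall>t>0. \<forall>x\<in>{0<..<1}.
      dt w x t = a x * dx (dx w) x t + b x * dx w x t + c x * w x t + f x t \<and>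
      dt wh x t = a x * dx (dx wh) x t + b x * dx wh x t + c x * wh x t
                  + O1 x * (dx wh 1 t - dx w 1 t)) \<and>
   (\<forall>t>0. dx w 0 t = 0 \<and> w 1 t = F (\<lambda>x. wh x t) \<and>
          dx wh 0 t = 0 \<and> wh 1 t = F (\<lambda>x. wh x t) + O2 * (dx wh 1 t - dx w 1 t))"

end

theory Submission
  imports Defs
begin

text \<open>With the observation error \<open>e = wh - w\<close> the closed loop becomes a cascade. The error solves an
  autonomous problem driven by \<open>f\<close>, for which \<open>\<langle>e, S e\<rangle>\<close> is a Lyapunov functional: the derivative is
  integrated by parts onto the kernels, and the leftover \<open>- 2 \<integral> a N e\<^sub>x\<^sup>2\<close> is used up by Wirtinger's
  inequality, which produces the terms with \<open>\<pi>\<^sup>2\<close>. It dissipates both \<open>\<parallel>e\<parallel>\<^sup>2\<close> and \<open>e\<^sub>x(1)\<^sup>2\<close>, and adding a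
  multiple of \<open>\<parallel>e\<parallel>\<^sup>2\<close> yields \<open>\<parallel>e\<^sub>x\<parallel>\<^sup>2\<close> as well. The state \<open>w\<close> rather than the estimate \<open>wh\<close> is treated next,
  with \<open>\<langle>w, P\<^sup>-\<^sup>1 w\<rangle>\<close>. Its boundary condition at \<open>1\<close> contains a bounded functional \<open>\<kappa>(t)\<close> of \<open>e\<close> that the
  boundary damping does not control when \<open>Z1 = 0\<close>; but \<open>\<kappa>\<close> has a time derivative in \<open>L\<^sub>2\<close>, so it can be
  removed by subtracting \<open>\<kappa>(t) \<psi>(x)\<close> for a suitable fixed \<open>\<psi>\<close>.\<close>

section \<open>Calculus on the unit interval\<close>

text \<open>Why the state is treated and not the estimate: the boundary value of \<open>wh\<close>
  contains \<open>O2\<close> times \<open>e\<^sub>x(1)\<close>, which carries no factor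
  \<open>Z1\<close> and has no controlled time derivative, so it could be neither absorbed at the
  boundary nor lifted. In the boundary value of \<open>w\<close> the error enters through
  \<open>Z1\<close> times the derivative of \<open>P\<^sup>-\<^sup>1 e\<close> at 1, which the
  boundary form, itself carrying the factor \<open>Z1\<close>, absorbs by completing a square, and
  through an integral of \<open>P\<^sup>-\<^sup>1 e\<close>, which is the liftable functional. The
  feedback evaluates a derivative of \<open>P\<^sup>-\<^sup>1 wh\<close> at an end point, so an
  inverse on \<open>L\<^sub>2\<close> classes is not enough. Every polynomial kernel is a finite sum
  of products, hence the integral part of the operator is a sum of polynomials times primitives. It
  maps continuous functions to twice differentiable ones, which passes the regularity of the
  right-hand side on to the solution, and every exchange of integrals becomes an integration by
  parts. All functions of \<open>x\<close> are therefore kept continuous, and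
  \<open>L\<^sub>2\<close> enters only through \<open>ip\<close>.\<close>

definition ip :: "(real \<Rightarrow> real) \<Rightarrow> (real \<Rightarrow> real) \<Rightarrow> real" where
  "ip u v = integral {0..1} (\<lambda>x. u x * v x)"

lemma ip_commute: "ip u v = ip v u"
  by (simp add: ip_def mult.commute)

lemma ip_cong:
  assumes "\<And>x. x \<in> {0..1} \<Longrightarrow> u x = u' x" "\<And>x. x \<in> {0..1} \<Longrightarrow> v x = v' x"
  shows "ip u v = ip u' v'"
  unfolding ip_def by (rule integral_cong) (simp add: assms)

lemma integrable_mult01:
  fixes u v :: "real \<Rightarrow> real"
  assumes "continuous_on {0..1} u" "continuous_on {0..1} v"
  shows "(\<lambda>x. u x * v x) integrable_on {0..1}"
  by (intro integrable_continuous_real continuous_intros assms)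

lemma ip_add_left:
  assumes "continuous_on {0..1} u" "continuous_on {0..1} v" "continuous_on {0..1} w"
  shows "ip (\<lambda>x. u x + v x) w = ip u w + ip v w"
  unfolding ip_def distrib_right
  by (rule integral_add) (intro integrable_mult01 assms)+

lemma ip_diff_left:
  assumes "continuous_on {0..1} u" "continuous_on {0..1} v" "continuous_on {0..1} w"
  shows "ip (\<lambda>x. u x - v x) w = ip u w - ip v w"
  unfolding ip_def left_diff_distrib
  by (rule integral_diff) (intro integrable_mult01 assms)+

lemma ip_scale_left: "ip (\<lambda>x. s * u x) w = s * ip u w"
  unfolding ip_def mult.assoc by simp

lemma ip_add_right:
  assumes "continuous_on {0..1} u" "continuous_on {0..1} v" "continuous_on {0..1} w"
  shows "ip w (\<lambda>x. u x + v x) = ip w u + ip w v"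
  using ip_add_left[OF assms] by (simp add: ip_commute)

lemma ip_diff_right:
  assumes "continuous_on {0..1} u" "continuous_on {0..1} v" "continuous_on {0..1} w"
  shows "ip w (\<lambda>x. u x - v x) = ip w u - ip w v"
  using ip_diff_left[OF assms] by (simp add: ip_commute)

lemma ip_scale_right: "ip w (\<lambda>x. s * u x) = s * ip w u"
  using ip_scale_left by (simp add: ip_commute)

text \<open>A square that is not integrable has the default integral 0, so nonnegativity can be used
  without side conditions.\<close>

lemma ip_nonneg: "0 \<le> ip u u"
  unfolding ip_def by (cases "(\<lambda>x. u x * u x) integrable_on {0..1}")
    (auto intro: integral_nonneg simp: not_integrable_integral)

lemma ip_mono:
  assumes "continuous_on {0..1} u" "continuous_on {0..1} v" "continuous_on {0..1} u'" "continuous_on {0..1} v'"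
    "\<And>x. x \<in> {0..1} \<Longrightarrow> u x * v x \<le> u' x * v' x"
  shows "ip u v \<le> ip u' v'"
  unfolding ip_def by (rule integral_le) (use assms in \<open>auto intro: integrable_mult01\<close>)

lemma ip_square_lincomb:
  assumes "continuous_on {0..1} u" "continuous_on {0..1} v"
  shows "ip (\<lambda>x. s * u x + r * v x) (\<lambda>x. s * u x + r * v x)
    = s\<^sup>2 * ip u u + 2 * s * r * ip u v + r\<^sup>2 * ip v v"
proof -
  have c: "continuous_on {0..1} (\<lambda>x. s * u x)" "continuous_on {0..1} (\<lambda>x. r * v x)"
    "continuous_on {0..1} (\<lambda>x. s * u x + r * v x)"
    by (intro continuous_intros assms)+
  show ?thesis
    unfolding ip_add_left[OF c] ip_add_right[OF c(1,2,1)] ip_add_right[OF c(1,2,2)]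
      ip_scale_left ip_scale_right
    by (simp add: ip_commute[of v u] power2_eq_square algebra_simps)
qed

text \<open>Expands the squares of \<open>s * u + v\<close> and \<open>s * u - v\<close>. The free
  weight \<open>s\<close> decides later how much of a dissipation term is spent.\<close>

lemma ip_young:
  assumes "continuous_on {0..1} u" "continuous_on {0..1} v" "0 < s"
  shows "2 * \<bar>ip u v\<bar> \<le> s * ip u u + ip v v / s"
proof -
  have "0 \<le> (s\<^sup>2 * ip u u + 2 * s * ip u v + ip v v) / s" "0 \<le> (s\<^sup>2 * ip u u - 2 * s * ip u v + ip v v) / s"
    using ip_nonneg[of "\<lambda>x. s * u x + 1 * v x"] ip_nonneg[of "\<lambda>x. s * u x + (-1) * v x"]
      ip_square_lincomb[OF assms(1,2), of s 1] ip_square_lincomb[OF assms(1,2), of s "-1"] assms(3)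
    by (intro divide_nonneg_pos; simp)+
  then have "0 \<le> s * ip u u + 2 * ip u v + ip v v / s" "0 \<le> s * ip u u - 2 * ip u v + ip v v / s"
    using \<open>0 < s\<close> by (simp_all add: add_divide_distrib diff_divide_distrib power2_eq_square)
  then show ?thesis by linarith
qed

lemma ip_cauchy_schwarz:
  assumes "continuous_on {0..1} u" "continuous_on {0..1} v"
  shows "(ip u v)\<^sup>2 \<le> ip u u * ip v v"
proof -
  have q: "0 \<le> s\<^sup>2 * ip u u + 2 * s * ip u v + ip v v" for s
    using ip_nonneg[of "\<lambda>x. s * u x + 1 * v x"] ip_square_lincomb[OF assms, of s 1] by simp
  show ?thesis
  proof (cases "ip u u = 0")
    case True
    have "ip u v = 0"
    proof (rule ccontr)
      assume "ip u v \<noteq> 0"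
      \<comment> \<open>With \<open>ip u u = 0\<close> the quadratic in \<open>s\<close> is affine,
        and at this \<open>s\<close> its value is -1.\<close>
      then show False using q[of "- (ip v v + 1) / (2 * ip u v)"] True by (simp add: field_simps)
    qed
    then show ?thesis using True by simp
  next
    case False
    then have p: "ip u u > 0" using ip_nonneg[of u] by simp
    have "0 \<le> ip u u * ((- ip u v / ip u u)\<^sup>2 * ip u u + 2 * (- ip u v / ip u u) * ip u v + ip v v)"
      using q[of "- ip u v / ip u u"] p by (intro mult_nonneg_nonneg) auto
    also have "\<dots> = ip u u * ip v v - (ip u v)\<^sup>2"
      using p by (simp add: field_simps power2_eq_square)
    finally show ?thesis by simp
  qed
qed

lemma ip_sum_sq:
  assumes "continuous_on {0..1} u" "continuous_on {0..1} v"
  shows "ip (\<lambda>x. u x + v x) (\<lambda>x. u x + v x) \<le> 2 * ip u u + 2 * ip v v"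
  using ip_square_lincomb[OF assms, of 1 1] ip_young[OF assms, of 1] by simp

lemma ip_diff_sq:
  assumes "continuous_on {0..1} u" "continuous_on {0..1} v"
  shows "ip (\<lambda>x. u x - v x) (\<lambda>x. u x - v x) \<le> 2 * ip u u + 2 * ip v v"
  using ip_square_lincomb[OF assms, of 1 "-1"] ip_young[OF assms, of 1] by simp

lemma ip_eq_0_imp:
  assumes "continuous_on {0..1} u" "ip u u \<le> 0" "x \<in> {0..1}"
  shows "u x = 0"
proof -
  have "ip u u = 0" using assms ip_nonneg[of u] by simp
  then have "((\<lambda>x. u x * u x) has_integral 0) {0..1}"
    using integrable_integral[OF integrable_mult01[OF assms(1,1)]] by (simp add: ip_def)
  then have "u x * u x = 0"
    using assms by (intro has_integral_0_cbox_imp_0[of 0 1 "\<lambda>x. u x * u x"])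
      (auto intro!: continuous_intros)
  then show ?thesis by simp
qed

section \<open>Primitives and integration by parts\<close>

lemma bounded_on01:
  fixes h :: "real \<Rightarrow> real"
  assumes "continuous_on {0..1} h"
  obtains B where "0 < B" "\<And>x. x \<in> {0..1} \<Longrightarrow> \<bar>h x\<bar> \<le> B"
proof -
  have "bounded (h ` {0..1})" by (intro compact_imp_bounded compact_continuous_image assms) simp
  then show ?thesis using that unfolding bounded_pos by auto
qed

lemma integral_derivative01:
  fixes U u :: "real \<Rightarrow> real"
  assumes "\<And>x. x \<in> {0..1} \<Longrightarrow> (U has_real_derivative u x) (at x within {0..1})"
  shows "integral {0..1} u = U 1 - U 0"
  using assms by (intro integral_unique fundamental_theorem_of_calculus)
    (auto simp: has_real_derivative_iff_has_vector_derivative)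

lemma has_real_derivative_integral_upto:
  fixes h :: "real \<Rightarrow> real"
  assumes "continuous_on {0..1} h" "x \<in> {0..1}"
  shows "((\<lambda>x. integral {0..x} h) has_real_derivative h x) (at x within {0..1})"
  using integral_has_real_derivative[OF assms] .

lemma integral_from_eq:
  fixes h :: "real \<Rightarrow> real"
  assumes "continuous_on {0..1} h" "x \<in> {0..1}"
  shows "integral {x..1} h = integral {0..1} h - integral {0..x} h"
  using Henstock_Kurzweil_Integration.integral_combine[of 0 x 1 h] integrable_continuous_real[OF assms(1)] assms(2) by auto

lemma has_real_derivative_integral_from:
  fixes h :: "real \<Rightarrow> real"
  assumes "continuous_on {0..1} h" "x \<in> {0..1}"
  shows "((\<lambda>x. integral {x..1} h) has_real_derivative - h x) (at x within {0..1})"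
proof -
  have "((\<lambda>x. integral {0..1} h - integral {0..x} h) has_real_derivative - h x) (at x within {0..1})"
    by (auto intro!: derivative_eq_intros has_real_derivative_integral_upto[OF assms])
  then show ?thesis
    by (rule has_field_derivative_transform_within[where d = 1]) (use assms in \<open>auto intro: integral_from_eq[symmetric]\<close>)
qed

lemma continuous_on_if_deriv01:
  fixes U u :: "real \<Rightarrow> real"
  assumes "\<And>x. x \<in> {0..1} \<Longrightarrow> (U has_real_derivative u x) (at x within {0..1})"
  shows "continuous_on {0..1} U"
  using assms by (metis DERIV_continuous_on)

lemma continuous_on_integral_upto:
  fixes h :: "real \<Rightarrow> real"
  assumes "continuous_on {0..1} h" shows "continuous_on {0..1} (\<lambda>x. integral {0..x} h)"
  using has_real_derivative_integral_upto[OF assms] by (rule continuous_on_if_deriv01)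

lemma continuous_on_integral_from:
  fixes h :: "real \<Rightarrow> real"
  assumes "continuous_on {0..1} h" shows "continuous_on {0..1} (\<lambda>x. integral {x..1} h)"
  using has_real_derivative_integral_from[OF assms] by (rule continuous_on_if_deriv01)

text \<open>Exchange of the order of integration over a triangle, without Fubini: the product of the
  two primitives vanishes at both end points, so its derivative has integral 0.\<close>

lemma integral_triangle_swap:
  fixes u v :: "real \<Rightarrow> real"
  assumes u: "continuous_on {0..1} u" and v: "continuous_on {0..1} v"
  shows "ip u (\<lambda>x. integral {x..1} v) = ip v (\<lambda>x. integral {0..x} u)"
proof -
  let ?U = "\<lambda>x. integral {0..x} u" and ?V = "\<lambda>x. integral {x..1} v"
  have "((\<lambda>x. ?U x * ?V x) has_real_derivative u x * ?V x - v x * ?U x) (at x within {0..1})"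
    if "x \<in> {0..1}" for x
    using that by (auto intro!: derivative_eq_intros has_real_derivative_integral_upto
        has_real_derivative_integral_from u v)
  from integral_derivative01[OF this]
  have "integral {0..1} (\<lambda>x. u x * ?V x - v x * ?U x) = 0" by simp
  moreover have "integral {0..1} (\<lambda>x. u x * ?V x - v x * ?U x) = ip u ?V - ip v ?U"
    unfolding ip_def
    by (intro integral_diff integrable_mult01 u v continuous_on_integral_upto continuous_on_integral_from)
  ultimately show ?thesis by simp
qed

section \<open>Polynomial functions of one and two variables\<close>

lemma poly_fun_deriv:
  assumes "real_polynomial_function p"
  shows "real_polynomial_function (deriv p)" "(p has_real_derivative deriv p x) (at x within S)"
proof -
  from has_real_derivative_polynomial_function[OF assms] obtain p' where
    p': "real_polynomial_function p'" "\<And>x. (p has_real_derivative p' x) (at x)" by blast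
  then have "deriv p = p'" by (auto intro: DERIV_imp_deriv)
  then show "real_polynomial_function (deriv p)" "(p has_real_derivative deriv p x) (at x within S)"
    using p' by (auto intro: has_field_derivative_at_within)
qed

lemma poly_fun_continuous_on:
  fixes p :: "real \<Rightarrow> real"
  shows "real_polynomial_function p \<Longrightarrow> continuous_on S p"
  using poly_fun_deriv(2)[of p] by (rule DERIV_continuous_on[of S p "deriv p", rotated -1])

text \<open>Induction over polynomial functions: linear maps and constants are finite sums of
  products \<open>f x * g y\<close>, and such sums are closed under addition and
  multiplication.\<close>

lemma poly_fun2_separable:
  assumes "poly_fun2 p"
  obtains n :: nat and f g where "\<And>k. real_polynomial_function (f k)" "\<And>k. real_polynomial_function (g k)"
    "\<And>x y. p x y = (\<Sum>k<n. f k x * g k y)"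
proof -
  let ?S = "\<lambda>q :: real \<times> real \<Rightarrow> real. \<exists>(n::nat) f g. (\<forall>k. real_polynomial_function (f k :: real \<Rightarrow> real)) \<and>
     (\<forall>k. real_polynomial_function (g k :: real \<Rightarrow> real)) \<and> (\<forall>x y. q (x, y) = (\<Sum>k<n. f k x * g k y))"
  have add: "?S (\<lambda>z. q z + r z)" if q: "?S q" and r: "?S r" for q r
  proof -
    from q obtain n :: nat and f g where 1: "\<forall>k. real_polynomial_function (f k)" "\<forall>k. real_polynomial_function (g k)"
      "\<forall>x y. q (x, y) = (\<Sum>k<n. f k x * g k y)" by blast
    from r obtain m :: nat and h l where 2: "\<forall>k. real_polynomial_function (h k)" "\<forall>k. real_polynomial_function (l k)"
      "\<forall>x y. r (x, y) = (\<Sum>k<m. h k x * l k y)" by blast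
    let ?f = "\<lambda>k. if k < n then f k else h (k - n)" and ?g = "\<lambda>k. if k < n then g k else l (k - n)"
    have "(\<Sum>k<n+m. ?f k x * ?g k y) = q (x, y) + r (x, y)" for x y
    proof -
      have "(\<Sum>k<n+m. ?f k x * ?g k y) = (\<Sum>k<n. ?f k x * ?g k y) + (\<Sum>k<m. ?f (n+k) x * ?g (n+k) y)"
        by (induction m) (auto simp: algebra_simps)
      then show ?thesis using 1 2 by simp
    qed
    then show ?thesis using 1 2 by (intro exI[of _ "n+m"] exI[of _ ?f] exI[of _ ?g]) auto
  qed
  have mult: "?S (\<lambda>z. q z * r z)" if q: "?S q" and r: "?S r" for q r
  proof -
    from q obtain n :: nat and f g where 1: "\<forall>k. real_polynomial_function (f k)" "\<forall>k. real_polynomial_function (g k)"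
      "\<forall>x y. q (x, y) = (\<Sum>k<n. f k x * g k y)" by blast
    from r obtain m :: nat and h l where 2: "\<forall>k. real_polynomial_function (h k)" "\<forall>k. real_polynomial_function (l k)"
      "\<forall>x y. r (x, y) = (\<Sum>k<m. h k x * l k y)" by blast
    \<comment> \<open>A pair of indices is coded as \<open>i * m + j\<close>; the case
      \<open>m = 0\<close> is separate because decoding divides by \<open>m\<close>.\<close>
    let ?f = "\<lambda>k x. f (k div m) x * h (k mod m) x" and ?g = "\<lambda>k x. g (k div m) x * l (k mod m) x"
    have "(\<Sum>k<n*m. ?f k x * ?g k y) = q (x, y) * r (x, y)" for x y
    proof -
      have "(\<Sum>k<n*m. ?f k x * ?g k y) = (\<Sum>i<n. \<Sum>j<m. (f i x * h j x) * (g i y * l j y))"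
      proof (cases "m = 0")
        case False
        have "(\<Sum>k<n*m. ?f k x * ?g k y) = (\<Sum>i<n. \<Sum>k\<in>{i*m..<i*m+m}. ?f k x * ?g k y)"
          using sum.nat_group[of "\<lambda>k. ?f k x * ?g k y" m n] by simp
        also have "\<dots> = (\<Sum>i<n. \<Sum>j<m. (f i x * h j x) * (g i y * l j y))"
        proof (rule sum.cong[OF refl])
          fix i
          have "(\<Sum>k\<in>{i*m..<i*m+m}. ?f k x * ?g k y) = (\<Sum>j<m. ?f (j + i*m) x * ?g (j + i*m) y)"
            using sum.shift_bounds_nat_ivl[of "\<lambda>k. ?f k x * ?g k y" 0 "i*m" m]
            by (simp add: add.commute lessThan_atLeast0)
          also have "\<dots> = (\<Sum>j<m. (f i x * h j x) * (g i y * l j y))"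
            using False by (intro sum.cong) auto
          finally show "(\<Sum>k\<in>{i*m..<i*m+m}. ?f k x * ?g k y) = (\<Sum>j<m. (f i x * h j x) * (g i y * l j y))" .
        qed
        finally show ?thesis .
      qed simp
      also have "\<dots> = (\<Sum>i<n. f i x * g i y) * (\<Sum>j<m. h j x * l j y)"
        unfolding sum_product by (intro sum.cong) (auto simp: algebra_simps)
      finally show ?thesis using 1 2 by simp
    qed
    moreover have "\<forall>k. real_polynomial_function (?f k)" "\<forall>k. real_polynomial_function (?g k)"
      using 1 2 by (auto intro: real_polynomial_function.intros(4))
    ultimately show ?thesis
      by (intro exI[of _ "n*m"] exI[of _ ?f] exI[of _ ?g] conjI) auto
  qed
  have "real_polynomial_function q \<Longrightarrow> ?S q" for q
  proof (induction rule: real_polynomial_function.induct)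
    case (linear h)
    have "h (x, y) = x * h (1, 0) + y * h (0, 1)" for x y
      using linear_add[OF bounded_linear.linear[OF linear], of "(x, 0)" "(0, y)"]
        linear_scale[OF bounded_linear.linear[OF linear], of x "(1, 0)"]
        linear_scale[OF bounded_linear.linear[OF linear], of y "(0, 1)"] by simp
    moreover have "x * h (1, 0) + y * h (0, 1)
        = (\<Sum>k<(2::nat). (if k = 0 then x else h (0,1)) * (if k = 0 then h (1,0) else y))" for x y
      by (simp add: numeral_2_eq_2)
    ultimately have "h (x, y) = (\<Sum>k<(2::nat). (if k = 0 then x else h (0,1)) * (if k = 0 then h (1,0) else y))" for x y
      by (rule trans)
    moreover have id: "real_polynomial_function (\<lambda>x::real. x)"
      by (rule real_polynomial_function.intros(1)[OF bounded_linear_ident])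
    have "real_polynomial_function (\<lambda>x. if k = 0 then x else h (0,1))" for k :: nat
      by (cases "k = 0") (simp_all add: id real_polynomial_function.intros(2))
    moreover have "real_polynomial_function (\<lambda>y. if k = 0 then h (1,0) else y)" for k :: nat
      by (cases "k = 0") (simp_all add: id real_polynomial_function.intros(2))
    ultimately show ?case
      by (intro exI[of _ 2] exI[of _ "\<lambda>k x. if k = 0 then x else h (0,1)"]
          exI[of _ "\<lambda>k y. if k = 0 then h (1,0) else y"] conjI allI)
  next
    case (const c)
    show ?case by (intro exI[of _ 1] exI[of _ "\<lambda>k x. c"] exI[of _ "\<lambda>k x. 1"]) auto
  qed (use add mult in auto)
  from this[of "\<lambda>(x, y). p x y"] assms show ?thesis unfolding poly_fun2_def using that by auto
qed

section \<open>Coercivity of the operators in \<open>\<Xi>\<close>\<close>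

text \<open>In the formula for \<open>K1\<close> the variable \<open>\<eta>\<close> runs over
  \<open>[0,\<xi>]\<close>, \<open>[\<xi>,x]\<close> or \<open>[x,1]\<close>; these are the three
  shapes that a weighted pairing of two primitives takes after integration by parts. Each case
  differentiates a product that vanishes at both end points. The third uses \<open>H 1 - H x\<close>
  because the primitives \<open>A\<close> vanish at 0 and not at 1.\<close>

lemma integral_mult_antiderivative:
  fixes h H u v :: "real \<Rightarrow> real"
  assumes H: "\<And>x. x \<in> {0..1} \<Longrightarrow> (H has_real_derivative h x) (at x within {0..1})" and "H 0 = 0"
    and h: "continuous_on {0..1} h" and u: "continuous_on {0..1} u" and v: "continuous_on {0..1} v"
  defines "A \<equiv> \<lambda>u x. integral {0..x} u" and "B \<equiv> \<lambda>u x. integral {x..1} u"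
  shows "integral {0..1} (\<lambda>x. h x * (B u x * B v x)) = ip u (A (\<lambda>\<xi>. H \<xi> * v \<xi>)) + ip v (A (\<lambda>\<xi>. H \<xi> * u \<xi>))"
    and "integral {0..1} (\<lambda>x. h x * (B u x * A v x)) = ip u (\<lambda>x. H x * A v x) - ip u (A (\<lambda>\<xi>. H \<xi> * v \<xi>))"
    and "integral {0..1} (\<lambda>x. h x * (A u x * A v x)) = ip u (\<lambda>x. (H 1 - H x) * A v x) + ip v (\<lambda>x. (H 1 - H x) * A u x)"
proof -
  have cH: "continuous_on {0..1} H" using H by (rule continuous_on_if_deriv01)
  have cA: "continuous_on {0..1} (A w)" "continuous_on {0..1} (B w)" if "continuous_on {0..1} w" for w
    unfolding A_def B_def using that by (rule continuous_on_integral_upto continuous_on_integral_from)+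
  have dA: "(A w has_real_derivative w x) (at x within {0..1})" "(B w has_real_derivative - w x) (at x within {0..1})"
    if "continuous_on {0..1} w" "x \<in> {0..1}" for w x
    unfolding A_def B_def using that
    by (rule has_real_derivative_integral_upto has_real_derivative_integral_from)+
  have z: "A w 0 = 0" "B w 1 = 0" for w by (simp_all add: A_def B_def)
  note cs = cH cA u v h
  have swap: "ip (\<lambda>\<xi>. H \<xi> * w \<xi>) (B y) = ip y (A (\<lambda>\<xi>. H \<xi> * w \<xi>))"
    if "continuous_on {0..1} w" "continuous_on {0..1} y" for w y
    unfolding A_def B_def by (rule integral_triangle_swap) (intro continuous_intros cs that)+
  have "integral {0..1} (\<lambda>x. h x * (B u x * B v x) - (H x * u x) * B v x - (H x * v x) * B u x)
      = H 1 * (B u 1 * B v 1) - H 0 * (B u 0 * B v 0)"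
    by (rule integral_derivative01) (auto intro!: derivative_eq_intros H dA u v simp: algebra_simps)
  moreover have "integral {0..1} (\<lambda>x. h x * (B u x * B v x) - (H x * u x) * B v x - (H x * v x) * B u x)
      = integral {0..1} (\<lambda>x. h x * (B u x * B v x)) - ip (\<lambda>\<xi>. H \<xi> * u \<xi>) (B v) - ip (\<lambda>\<xi>. H \<xi> * v \<xi>) (B u)"
    unfolding ip_def
    by (subst integral_diff, (intro integrable_continuous_real continuous_intros cs)+)+ simp
  ultimately show "integral {0..1} (\<lambda>x. h x * (B u x * B v x)) = ip u (A (\<lambda>\<xi>. H \<xi> * v \<xi>)) + ip v (A (\<lambda>\<xi>. H \<xi> * u \<xi>))"
    by (simp add: z assms(2) swap u v)
  have "integral {0..1} (\<lambda>x. h x * (B u x * A v x) - u x * (H x * A v x) + (H x * v x) * B u x)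
      = H 1 * (B u 1 * A v 1) - H 0 * (B u 0 * A v 0)"
    by (rule integral_derivative01) (auto intro!: derivative_eq_intros H dA u v simp: algebra_simps)
  moreover have "integral {0..1} (\<lambda>x. h x * (B u x * A v x) - u x * (H x * A v x) + (H x * v x) * B u x)
      = integral {0..1} (\<lambda>x. h x * (B u x * A v x)) - ip u (\<lambda>x. H x * A v x) + ip (\<lambda>\<xi>. H \<xi> * v \<xi>) (B u)"
    unfolding ip_def
    by (subst integral_add integral_diff, (intro integrable_continuous_real continuous_intros cs)+)+ simp
  ultimately show "integral {0..1} (\<lambda>x. h x * (B u x * A v x)) = ip u (\<lambda>x. H x * A v x) - ip u (A (\<lambda>\<xi>. H \<xi> * v \<xi>))"
    by (simp add: z assms(2) swap u v)
  have "integral {0..1} (\<lambda>x. h x * (A u x * A v x) - u x * ((H 1 - H x) * A v x) - v x * ((H 1 - H x) * A u x))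
      = (H 1 - H 1) * (- A u 1 * A v 1) - (H 1 - H 0) * (- A u 0 * A v 0)"
    by (rule integral_derivative01) (auto intro!: derivative_eq_intros H dA u v simp: algebra_simps)
  moreover have "integral {0..1} (\<lambda>x. h x * (A u x * A v x) - u x * ((H 1 - H x) * A v x) - v x * ((H 1 - H x) * A u x))
      = integral {0..1} (\<lambda>x. h x * (A u x * A v x)) - ip u (\<lambda>x. (H 1 - H x) * A v x) - ip v (\<lambda>x. (H 1 - H x) * A u x)"
    unfolding ip_def
    by (subst integral_diff, (intro integrable_continuous_real continuous_intros cs)+)+ simp
  ultimately show "integral {0..1} (\<lambda>x. h x * (A u x * A v x)) = ip u (\<lambda>x. (H 1 - H x) * A v x) + ip v (\<lambda>x. (H 1 - H x) * A u x)"
    by (simp add: z)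
qed

section \<open>The block matrix in coordinates\<close>

lemma scalar_prod_mat_mult_vec:
  fixes v w :: "real vec"
  assumes "dim_vec v = m" "dim_vec w = k"
  shows "v \<bullet> (mat m k F *\<^sub>v w) = (\<Sum>i<m. \<Sum>j<k. F (i, j) * (v $ i * w $ j))"
  using assms by (simp add: scalar_prod_def lessThan_atLeast0 sum_distrib_left algebra_simps)

lemma sum_lessThan_split3:
  fixes F :: "nat \<Rightarrow> real"
  shows "(\<Sum>r<l+m+n. F r) = (\<Sum>r<l. F r) + (\<Sum>r<m. F (l+r)) + (\<Sum>r<n. F (l+m+r))"
proof -
  have s: "(\<Sum>r<l+m. F r) = (\<Sum>r<l. F r) + (\<Sum>r<m. F (l+r))" for l m
    by (induction m) auto
  show ?thesis by (simp add: s)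
qed

text \<open>The interval integral is oriented, so \<open>s\<close> and \<open>t\<close> may come in
  either order; the formula for \<open>K1\<close> is required on the whole plane, where both orders
  occur.\<close>

lemma interval_integral_monomials:
  fixes c :: "nat \<Rightarrow> nat \<Rightarrow> real"
  shows "(LBINT \<eta>=ereal s..ereal t. (\<Sum>i<n. \<Sum>j<m. c i j * \<eta> ^ e i j))
    = (\<Sum>i<n. \<Sum>j<m. c i j * (t ^ Suc (e i j) / Suc (e i j) - s ^ Suc (e i j) / Suc (e i j)))"
proof -
  let ?F = "\<lambda>\<eta>. \<Sum>i<n. \<Sum>j<m. c i j * (\<eta> ^ Suc (e i j) / Suc (e i j))"
  have d: "(?F has_real_derivative (\<Sum>i<n. \<Sum>j<m. c i j * \<eta> ^ e i j)) (at \<eta> within A)" for \<eta> A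
  proof (intro DERIV_sum DERIV_cmult)
    fix i j
    have "((\<lambda>\<eta>. \<eta> ^ Suc (e i j) / Suc (e i j)) has_real_derivative (Suc (e i j) * \<eta> ^ e i j) / Suc (e i j)) (at \<eta> within A)"
      using DERIV_pow[of "Suc (e i j)" \<eta> A] by (intro DERIV_cdivide) simp
    then show "((\<lambda>\<eta>. \<eta> ^ Suc (e i j) / Suc (e i j)) has_real_derivative \<eta> ^ e i j) (at \<eta> within A)"
      by (simp del: of_nat_Suc)
  qed
  have "(LBINT \<eta>=ereal s..ereal t. (\<Sum>i<n. \<Sum>j<m. c i j * \<eta> ^ e i j)) = ?F t - ?F s"
    by (rule interval_integral_FTC_finite)
      (intro continuous_intros d[unfolded has_real_derivative_iff_has_vector_derivative])+
  then show ?thesis by (simp add: sum_subtractf right_diff_distrib)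
qed

lemma Zvec1_simps [simp]: "dim_vec (Zvec1 d x) = Suc d" "i < Suc d \<Longrightarrow> Zvec1 d x $ i = x ^ i"
  by (auto simp: Zvec1_def)

lemma Zvec2_simps [simp]: "dim_vec (Zvec2 d x y) = length (monos2 d)"
  "j < length (monos2 d) \<Longrightarrow> Zvec2 d x y $ j = x ^ fst (monos2 d ! j) * y ^ snd (monos2 d ! j)"
  by (auto simp: Zvec2_def split_beta vec_of_list_index)

lemma blk_off_simps:
  "blk_off d1 d2 1 = 0" "blk_off d1 d2 2 = Suc d1" "blk_off d1 d2 3 = Suc d1 + length (monos2 d2)"
  "blk_off d1 d2 4 = Suc d1 + length (monos2 d2) + length (monos2 d2)"
  by (simp_all add: blk_off_def blk_dim_def numeral_2_eq_2 numeral_3_eq_3 eval_nat_numeral)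

text \<open>The form \<open>\<langle>z, P z\<rangle>\<close> of the operator whose kernel is
  \<open>K\<close> below the diagonal and its mirror image above: both halves of the double integral
  contribute equally, hence the factor 2.\<close>

definition qform :: "(real \<Rightarrow> real) \<Rightarrow> (real \<Rightarrow> real \<Rightarrow> real) \<Rightarrow> (real \<Rightarrow> real) \<Rightarrow> real" where
  "qform M K z = ip z (\<lambda>x. M x * z x) + 2 * ip z (\<lambda>x. integral {0..x} (\<lambda>\<xi>. K x \<xi> * z \<xi>))"

text \<open>\<open>p j\<close> and \<open>q j\<close> are the exponents of the \<open>j\<close>-th
  monomial in \<open>Z2\<close>, and \<open>H i j\<close> is the primitive, vanishing at 0, of the
  power of \<open>\<eta>\<close> in the product of the monomials \<open>i\<close> and
  \<open>j\<close>. With it the integrals over \<open>\<eta>\<close> become differences of values of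
  \<open>H i j\<close>.\<close>

lemma Xi_expand:
  assumes "(M, K1, K2) \<in> Xi d1 d2 \<epsilon> \<epsilon>'"
    and n1_def: "n1 = Suc d1" and n2_def: "n2 = length (monos2 d2)"
    and p_def: "p = (\<lambda>j. fst (monos2 d2 ! j))" and q_def: "q = (\<lambda>j. snd (monos2 d2 ! j))"
    and H_def: "H = (\<lambda>i j x. x ^ Suc (p i + p j) / Suc (p i + p j))"
  obtains U :: "nat \<Rightarrow> nat \<Rightarrow> real" where
    "\<And>r s. r < n1+n2+n2 \<Longrightarrow> s < n1+n2+n2 \<Longrightarrow> U r s = U s r"
    "\<And>\<phi>. (\<Sum>r<n1+n2+n2. \<Sum>s<n1+n2+n2. U r s * (\<phi> r * \<phi> s)) \<ge> \<epsilon> * (\<Sum>r<n1. (\<phi> r)\<^sup>2)"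
    "\<And>x. M x = (\<Sum>i<n1. \<Sum>j<n1. U i j * (x ^ i * x ^ j))"
    "\<And>x \<xi>. K1 x \<xi> =
       (\<Sum>i<n1. \<Sum>j<n2. U i (n1+j) * (x ^ i * (x ^ p j * \<xi> ^ q j)))
     + (\<Sum>i<n2. \<Sum>j<n1. U (n1+n2+i) j * (\<xi> ^ p i * x ^ q i * \<xi> ^ j))
     + (\<Sum>i<n2. \<Sum>j<n2. U (n1+n2+i) (n1+n2+j) * (x ^ q i * (H i j \<xi> * \<xi> ^ q j)))
     + (\<Sum>i<n2. \<Sum>j<n2. U (n1+n2+i) (n1+j) * (x ^ q i * ((H i j x - H i j \<xi>) * \<xi> ^ q j)))
     + (\<Sum>i<n2. \<Sum>j<n2. U (n1+i) (n1+j) * (x ^ q i * ((H i j 1 - H i j x) * \<xi> ^ q j)))"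
    "\<And>x \<xi>. K2 x \<xi> = K1 \<xi> x"
proof -
  let ?N = "n1 + n2 + n2"
  let ?D = "mat ?N ?N (\<lambda>(i, j). if i = j \<and> i < n1 then \<epsilon> else 0) :: real mat"
  have off: "blk_off d1 d2 4 = ?N" "blk_off d1 d2 1 = 0" "blk_off d1 d2 2 = n1" "blk_off d1 d2 3 = n1 + n2"
    "blk_dim d1 d2 1 = n1" "blk_dim d1 d2 2 = n2" "blk_dim d1 d2 3 = n2"
    unfolding n1_def n2_def by (simp_all only: blk_off_simps blk_dim_def) simp_all
  from assms(1) obtain U where U: "U \<in> carrier_mat ?N ?N" "transpose_mat U = U" "psd_mat (U - ?D)"
    "\<And>x. M x = Zvec1 d1 x \<bullet> (blk d1 d2 U 1 1 *\<^sub>v Zvec1 d1 x)"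
    "\<And>x \<xi>. K1 x \<xi> =
             Zvec1 d1 x \<bullet> (blk d1 d2 U 1 2 *\<^sub>v Zvec2 d2 x \<xi>)
           + Zvec2 d2 \<xi> x \<bullet> (blk d1 d2 U 3 1 *\<^sub>v Zvec1 d1 \<xi>)
           + (LBINT \<eta>=0..\<xi>. Zvec2 d2 \<eta> x \<bullet> (blk d1 d2 U 3 3 *\<^sub>v Zvec2 d2 \<eta> \<xi>))
           + (LBINT \<eta>=\<xi>..x. Zvec2 d2 \<eta> x \<bullet> (blk d1 d2 U 3 2 *\<^sub>v Zvec2 d2 \<eta> \<xi>))
           + (LBINT \<eta>=x..1. Zvec2 d2 \<eta> x \<bullet> (blk d1 d2 U 2 2 *\<^sub>v Zvec2 d2 \<eta> \<xi>))"
    "\<And>x \<xi>. K2 x \<xi> = K1 \<xi> x"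
    unfolding Xi_def off by auto
  have 1: "U $$ (r, s) = U $$ (s, r)" if "r < ?N" "s < ?N" for r s
    using U(1,2) that by (metis carrier_matD index_transpose_mat(1))
  have 2: "(\<Sum>r<?N. \<Sum>s<?N. U $$ (r, s) * (\<phi> r * \<phi> s)) \<ge> \<epsilon> * (\<Sum>r<n1. (\<phi> r)\<^sup>2)" for \<phi>
  proof -
    have UD: "U - ?D = mat ?N ?N (\<lambda>(r, s). U $$ (r, s) - (if r = s \<and> r < n1 then \<epsilon> else 0))"
      using U(1) by (intro eq_matI) auto
    have "0 \<le> vec ?N \<phi> \<bullet> ((U - ?D) *\<^sub>v vec ?N \<phi>)"
      using U(1,3) unfolding psd_mat_def by auto
    also have "\<dots> = (\<Sum>r<?N. \<Sum>s<?N. (U $$ (r, s) - (if r = s \<and> r < n1 then \<epsilon> else 0)) * (\<phi> r * \<phi> s))"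
      unfolding UD by (subst scalar_prod_mat_mult_vec) auto
    also have "\<dots> = (\<Sum>r<?N. \<Sum>s<?N. U $$ (r, s) * (\<phi> r * \<phi> s))
        - (\<Sum>r<?N. \<Sum>s<?N. (if r = s \<and> r < n1 then \<epsilon> else 0) * (\<phi> r * \<phi> s))"
      by (simp add: left_diff_distrib sum_subtractf)
    also have "(\<Sum>r<?N. \<Sum>s<?N. (if r = s \<and> r < n1 then \<epsilon> else 0) * (\<phi> r * \<phi> s))
        = (\<Sum>r<?N. if r < n1 then \<epsilon> * (\<phi> r)\<^sup>2 else 0)"
    proof (rule sum.cong[OF refl])
      fix r assume "r \<in> {..<?N}"
      have "(\<Sum>s<?N. (if r = s \<and> r < n1 then \<epsilon> else 0) * (\<phi> r * \<phi> s))
        = (\<Sum>s<?N. if r = s then (if r < n1 then \<epsilon> * (\<phi> r)\<^sup>2 else 0) else 0)"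
        by (intro sum.cong) (auto simp: power2_eq_square)
      then show "(\<Sum>s<?N. (if r = s \<and> r < n1 then \<epsilon> else 0) * (\<phi> r * \<phi> s))
        = (if r < n1 then \<epsilon> * (\<phi> r)\<^sup>2 else 0)" using \<open>r \<in> {..<?N}\<close> by simp
    qed
    also have "\<dots> = \<epsilon> * (\<Sum>r<n1. (\<phi> r)\<^sup>2)"
      by (simp add: sum_lessThan_split3 sum_distrib_left)
    finally show ?thesis by simp
  qed
  have blk: "blk d1 d2 U i j = mat (blk_dim d1 d2 i) (blk_dim d1 d2 j)
     (\<lambda>(r, s). U $$ (blk_off d1 d2 i + r, blk_off d1 d2 j + s))" for i j by (simp add: blk_def)
  have dim: "dim_vec (Zvec1 d1 x) = n1" "dim_vec (Zvec2 d2 x y) = n2" for x y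
    by (simp_all add: n1_def n2_def)
  have Z: "i < n1 \<Longrightarrow> Zvec1 d1 x $ i = x ^ i" "j < n2 \<Longrightarrow> Zvec2 d2 x y $ j = x ^ p j * y ^ q j" for i j x y
    by (simp_all add: n1_def n2_def p_def q_def)
  have 3: "M x = (\<Sum>i<n1. \<Sum>j<n1. U $$ (i, j) * (x ^ i * x ^ j))" for x
    unfolding U(4) blk off by (subst scalar_prod_mat_mult_vec) (auto simp: dim Z simp del: Zvec1_simps)
  have L: "(LBINT \<eta>=ereal s..ereal t. Zvec2 d2 \<eta> x \<bullet> (mat n2 n2 F *\<^sub>v Zvec2 d2 \<eta> \<xi>))
      = (\<Sum>i<n2. \<Sum>j<n2. F (i, j) * (x ^ q i * ((H i j t - H i j s) * \<xi> ^ q j)))" for s t x \<xi> F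
  proof -
    have "Zvec2 d2 \<eta> x \<bullet> (mat n2 n2 F *\<^sub>v Zvec2 d2 \<eta> \<xi>)
        = (\<Sum>i<n2. \<Sum>j<n2. (F (i, j) * x ^ q i * \<xi> ^ q j) * \<eta> ^ (p i + p j))" for \<eta>
      by (subst scalar_prod_mat_mult_vec[OF dim(2) dim(2)])
        (auto simp: Z power_add intro!: sum.cong)
    then have "(LBINT \<eta>=ereal s..ereal t. Zvec2 d2 \<eta> x \<bullet> (mat n2 n2 F *\<^sub>v Zvec2 d2 \<eta> \<xi>))
        = (\<Sum>i<n2. \<Sum>j<n2. (F (i, j) * x ^ q i * \<xi> ^ q j) * (H i j t - H i j s))"
      by (simp only: interval_integral_monomials H_def)
    then show ?thesis by (simp add: mult_ac)
  qed
  have H0: "H i j 0 = 0" for i j by (simp add: H_def)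
  have 4: "K1 x \<xi> =
       (\<Sum>i<n1. \<Sum>j<n2. U $$ (i, n1+j) * (x ^ i * (x ^ p j * \<xi> ^ q j)))
     + (\<Sum>i<n2. \<Sum>j<n1. U $$ (n1+n2+i, j) * (\<xi> ^ p i * x ^ q i * \<xi> ^ j))
     + (\<Sum>i<n2. \<Sum>j<n2. U $$ (n1+n2+i, n1+n2+j) * (x ^ q i * (H i j \<xi> * \<xi> ^ q j)))
     + (\<Sum>i<n2. \<Sum>j<n2. U $$ (n1+n2+i, n1+j) * (x ^ q i * ((H i j x - H i j \<xi>) * \<xi> ^ q j)))
     + (\<Sum>i<n2. \<Sum>j<n2. U $$ (n1+i, n1+j) * (x ^ q i * ((H i j 1 - H i j x) * \<xi> ^ q j)))" for x \<xi>
    unfolding U(5) blk off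
    unfolding zero_ereal_def one_ereal_def L
    by (subst (1 2) scalar_prod_mat_mult_vec) (auto simp: dim Z H0 intro!: sum.cong simp del: Zvec1_simps Zvec2_simps)
  show thesis
    by (rule that[of "\<lambda>r s. U $$ (r, s)"]) (use 1 2 3 4 U(6) in blast)+
qed

lemma integral_sum2:
  fixes h :: "nat \<Rightarrow> nat \<Rightarrow> real \<Rightarrow> real"
  assumes "\<And>i j. continuous_on {a..b} (h i j)"
  shows "integral {a..b} (\<lambda>x. \<Sum>i<m. \<Sum>j<k. c i j * h i j x) = (\<Sum>i<m. \<Sum>j<k. c i j * integral {a..b} (h i j))"
    "(\<lambda>x. \<Sum>i<m. \<Sum>j<k. c i j * h i j x) integrable_on {a..b}"
proof -
  have "((\<lambda>x. \<Sum>i<m. \<Sum>j<k. c i j * h i j x) has_integral (\<Sum>i<m. \<Sum>j<k. c i j * integral {a..b} (h i j))) {a..b}"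
    by (intro has_integral_sum has_integral_mult_right integrable_integral integrable_continuous_real assms) auto
  then show "integral {a..b} (\<lambda>x. \<Sum>i<m. \<Sum>j<k. c i j * h i j x) = (\<Sum>i<m. \<Sum>j<k. c i j * integral {a..b} (h i j))"
    "(\<lambda>x. \<Sum>i<m. \<Sum>j<k. c i j * h i j x) integrable_on {a..b}"
    by (auto simp: integral_unique)
qed

text \<open>Let \<open>\<phi>(x)\<close> be the vector whose blocks are \<open>Z1(x) z(x)\<close>,
  the integral of \<open>Z2(x,\<xi>) z(\<xi>)\<close> over \<open>\<xi>\<close> below
  \<open>x\<close>, and the same integral over \<open>\<xi>\<close> above \<open>x\<close>. The
  formula for \<open>K1\<close> is made so that \<open>qform M K1 z\<close> is the integral of
  \<open>\<phi>\<^sup>T U \<phi>\<close>; the lower bound for \<open>U\<close> is then applied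
  pointwise under the integral.\<close>

lemma Xi_coercive:
  assumes X: "(M, K1, K2) \<in> Xi d1 d2 \<epsilon> \<epsilon>'" and "0 \<le> \<epsilon>" and z: "continuous_on {0..1} z"
  shows "\<epsilon> * ip z z \<le> qform M K1 z"
proof -
  define n1 n2 where "n1 = Suc d1" and "n2 = length (monos2 d2)"
  define p q where "p = (\<lambda>j. fst (monos2 d2 ! j))" and "q = (\<lambda>j. snd (monos2 d2 ! j))"
  define H :: "nat \<Rightarrow> nat \<Rightarrow> real \<Rightarrow> real" where "H = (\<lambda>i j x. x ^ Suc (p i + p j) / Suc (p i + p j))"
  obtain U :: "nat \<Rightarrow> nat \<Rightarrow> real" where
    sym: "\<And>r s. r < n1+n2+n2 \<Longrightarrow> s < n1+n2+n2 \<Longrightarrow> U r s = U s r" and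
    pos: "\<And>\<phi>. (\<Sum>r<n1+n2+n2. \<Sum>s<n1+n2+n2. U r s * (\<phi> r * \<phi> s)) \<ge> \<epsilon> * (\<Sum>r<n1. (\<phi> r)\<^sup>2)" and
    Mx: "\<And>x. M x = (\<Sum>i<n1. \<Sum>j<n1. U i j * (x ^ i * x ^ j))" and
    Kx: "\<And>x \<xi>. K1 x \<xi> =
       (\<Sum>i<n1. \<Sum>j<n2. U i (n1+j) * (x ^ i * (x ^ p j * \<xi> ^ q j)))
     + (\<Sum>i<n2. \<Sum>j<n1. U (n1+n2+i) j * (\<xi> ^ p i * x ^ q i * \<xi> ^ j))
     + (\<Sum>i<n2. \<Sum>j<n2. U (n1+n2+i) (n1+n2+j) * (x ^ q i * (H i j \<xi> * \<xi> ^ q j)))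
     + (\<Sum>i<n2. \<Sum>j<n2. U (n1+n2+i) (n1+j) * (x ^ q i * ((H i j x - H i j \<xi>) * \<xi> ^ q j)))
     + (\<Sum>i<n2. \<Sum>j<n2. U (n1+i) (n1+j) * (x ^ q i * ((H i j 1 - H i j x) * \<xi> ^ q j)))"
    by (rule Xi_expand[OF X n1_def n2_def p_def q_def H_def]) (rule that; assumption)
  let ?N = "n1 + n2 + n2"
  define A B where "A = (\<lambda>u x. integral {0..x::real} (u :: real \<Rightarrow> real))" and "B = (\<lambda>u x. integral {x..1::real} (u :: real \<Rightarrow> real))"
  define u where "u = (\<lambda>j x. x ^ q j * z x)"
  define v where "v = (\<lambda>i j x. x ^ (p i + j) * z x)"
  define \<phi> where "\<phi> = (\<lambda>r x. if r < n1 then x ^ r * z x else if r < n1 + n2 then x ^ p (r - n1) * A (u (r - n1)) x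
      else x ^ p (r - n1 - n2) * B (u (r - n1 - n2)) x)"
  have \<phi>_simps: "i < n1 \<Longrightarrow> \<phi> i = (\<lambda>x. x ^ i * z x)" "j < n2 \<Longrightarrow> \<phi> (n1 + j) = (\<lambda>x. x ^ p j * A (u j) x)"
    "\<phi> (n1 + n2 + j) = (\<lambda>x. x ^ p j * B (u j) x)" for i j by (auto simp: \<phi>_def fun_eq_iff)
  have cA: "continuous_on {0..1} (A w)" "continuous_on {0..1} (B w)" if "continuous_on {0..1} w" for w
    unfolding A_def B_def using that by (rule continuous_on_integral_upto continuous_on_integral_from)+
  have cH: "continuous_on S (H i j)" for S i j unfolding H_def by (intro continuous_intros) auto
  have cu: "continuous_on {0..1} (u j)" and cv: "continuous_on {0..1} (v i j)" for i j
    unfolding u_def v_def by (intro continuous_intros z)+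
  have c\<phi>: "continuous_on {0..1} (\<phi> r)" for r
    unfolding \<phi>_def by (cases "r < n1"; cases "r < n1 + n2"; simp; intro continuous_intros cA cu z)
  note cs = cA cH cu cv c\<phi> z
  have dH: "(H i j has_real_derivative x ^ (p i + p j)) (at x within {0..1})" for i j x
  proof -
    have "(H i j has_real_derivative (Suc (p i + p j) * x ^ (p i + p j)) / Suc (p i + p j)) (at x within {0..1})"
      unfolding H_def using DERIV_pow[of "Suc (p i + p j)" x "{0..1}"] by (intro DERIV_cdivide) simp
    then show ?thesis by (simp del: of_nat_Suc)
  qed
  have H0: "H i j 0 = 0" and H_sym: "H i j = H j i" for i j
    by (simp_all add: H_def add.commute)
  define G where "G = (\<lambda>r s. ip (\<phi> r) (\<phi> s))"
  have G_sym: "G r s = G s r" for r s by (simp add: G_def ip_commute)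
  have "\<epsilon> * ip z z = integral {0..1} (\<lambda>x. \<epsilon> * (z x * z x))" by (simp add: ip_def)
  also have "\<dots> \<le> integral {0..1} (\<lambda>x. \<Sum>r<?N. \<Sum>s<?N. U r s * (\<phi> r x * \<phi> s x))"
  proof (rule integral_le)
    show "(\<lambda>x. \<epsilon> * (z x * z x)) integrable_on {0..1}"
      by (intro integrable_continuous_real continuous_intros z)
    show "(\<lambda>x. \<Sum>r<?N. \<Sum>s<?N. U r s * (\<phi> r x * \<phi> s x)) integrable_on {0..1}"
      by (rule integral_sum2(2)) (intro continuous_intros cs)
    fix x :: real assume "x \<in> {0..1}"
    \<comment> \<open>The first monomial is 1, so the first entry of the vector is
      \<open>z x\<close> itself.\<close>
    have "z x * z x = (\<phi> 0 x)\<^sup>2" by (simp add: \<phi>_def n1_def power2_eq_square)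
    also have "\<dots> \<le> (\<Sum>r<n1. (\<phi> r x)\<^sup>2)"
      by (rule member_le_sum) (auto simp: n1_def)
    finally have "\<epsilon> * (z x * z x) \<le> \<epsilon> * (\<Sum>r<n1. (\<phi> r x)\<^sup>2)"
      using \<open>0 \<le> \<epsilon>\<close> by (rule mult_left_mono)
    also have "\<dots> \<le> (\<Sum>r<?N. \<Sum>s<?N. U r s * (\<phi> r x * \<phi> s x))" by (rule pos)
    finally show "\<epsilon> * (z x * z x) \<le> (\<Sum>r<?N. \<Sum>s<?N. U r s * (\<phi> r x * \<phi> s x))" .
  qed
  also have "\<dots> = (\<Sum>r<?N. \<Sum>s<?N. U r s * G r s)"
    unfolding G_def ip_def by (rule integral_sum2(1)) (intro continuous_intros cs)
  also have "\<dots> = (\<Sum>i<n1. \<Sum>j<n1. U i j * G i j)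
      + 2 * (\<Sum>i<n1. \<Sum>j<n2. U i (n1+j) * G i (n1+j))
      + 2 * (\<Sum>i<n2. \<Sum>j<n1. U (n1+n2+i) j * G (n1+n2+i) j)
      + 2 * (\<Sum>i<n2. \<Sum>j<n2. U (n1+n2+i) (n1+j) * G (n1+n2+i) (n1+j))
      + (\<Sum>i<n2. \<Sum>j<n2. U (n1+n2+i) (n1+n2+j) * G (n1+n2+i) (n1+n2+j))
      + (\<Sum>i<n2. \<Sum>j<n2. U (n1+i) (n1+j) * G (n1+i) (n1+j))"
  proof -
    \<comment> \<open>By the symmetry of \<open>U\<close> and \<open>G\<close>, an off-diagonal
      block and its mirror image contribute equally; this is the origin of the factors 2.\<close>
    have t: "(\<Sum>i<k. \<Sum>j<l. U (a+i) (b+j) * G (a+i) (b+j)) = (\<Sum>j<l. \<Sum>i<k. U (b+j) (a+i) * G (b+j) (a+i))"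
      if "a + k \<le> ?N" "b + l \<le> ?N" for a b k l
      by (subst sum.swap, intro sum.cong refl) (use that in \<open>simp add: sym G_sym\<close>)
    show ?thesis
      using t[of n1 n2 0 n1] t[of 0 n1 "n1+n2" n2] t[of n1 n2 "n1+n2" n2]
      by (simp add: sum_lessThan_split3 sum.distrib)
  qed
  also have "\<dots> = qform M K1 z"
  proof -
    have M: "ip z (\<lambda>x. M x * z x) = (\<Sum>i<n1. \<Sum>j<n1. U i j * G i j)"
    proof -
      have "ip z (\<lambda>x. M x * z x) = integral {0..1} (\<lambda>x. \<Sum>i<n1. \<Sum>j<n1. U i j * (x ^ i * z x * (x ^ j * z x)))"
        unfolding ip_def Mx by (intro integral_cong) (simp add: sum_distrib_left sum_distrib_right algebra_simps)
      also have "\<dots> = (\<Sum>i<n1. \<Sum>j<n1. U i j * G i j)"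
        by (subst integral_sum2(1)) (auto intro!: continuous_intros z sum.cong simp: G_def \<phi>_simps ip_def)
      finally show ?thesis .
    qed
    \<comment> \<open>For fixed \<open>x\<close> each term of \<open>K1\<close> splits into a factor
      in \<open>x\<close> and one in \<open>\<xi>\<close>, so the inner integral becomes polynomials
      times primitives.\<close>
    have K: "integral {0..x} (\<lambda>\<xi>. K1 x \<xi> * z \<xi>) =
         (\<Sum>i<n1. \<Sum>j<n2. U i (n1+j) * (x ^ i * (x ^ p j * A (u j) x)))
       + (\<Sum>i<n2. \<Sum>j<n1. U (n1+n2+i) j * (x ^ q i * A (v i j) x))
       + (\<Sum>i<n2. \<Sum>j<n2. U (n1+n2+i) (n1+n2+j) * (x ^ q i * A (\<lambda>\<xi>. H i j \<xi> * u j \<xi>) x))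
       + (\<Sum>i<n2. \<Sum>j<n2. U (n1+n2+i) (n1+j) * (x ^ q i * (H i j x * A (u j) x - A (\<lambda>\<xi>. H i j \<xi> * u j \<xi>) x)))
       + (\<Sum>i<n2. \<Sum>j<n2. U (n1+i) (n1+j) * (x ^ q i * ((H i j 1 - H i j x) * A (u j) x)))"
      if x: "x \<in> {0..1}" for x
    proof -
      have c: "continuous_on {0..x} w" if "continuous_on {0..1} w" for w :: "real \<Rightarrow> real"
        using that by (rule continuous_on_subset) (use x in auto)
      note ci = c[OF z] c[OF cu] c[OF cv] cH
      have "integral {0..x} (\<lambda>\<xi>. K1 x \<xi> * z \<xi>) = integral {0..x} (\<lambda>\<xi>.
         (\<Sum>i<n1. \<Sum>j<n2. U i (n1+j) * ((x ^ i * x ^ p j) * u j \<xi>))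
       + (\<Sum>i<n2. \<Sum>j<n1. U (n1+n2+i) j * (x ^ q i * v i j \<xi>))
       + (\<Sum>i<n2. \<Sum>j<n2. U (n1+n2+i) (n1+n2+j) * (x ^ q i * (H i j \<xi> * u j \<xi>)))
       + (\<Sum>i<n2. \<Sum>j<n2. U (n1+n2+i) (n1+j) * (x ^ q i * (H i j x * u j \<xi> - H i j \<xi> * u j \<xi>)))
       + (\<Sum>i<n2. \<Sum>j<n2. U (n1+i) (n1+j) * (x ^ q i * (H i j 1 - H i j x) * u j \<xi>)))"
        unfolding Kx distrib_right sum_distrib_right
        by (intro integral_cong) (simp add: u_def v_def power_add algebra_simps)
      also have "\<dots> = integral {0..x} (\<lambda>\<xi>. (\<Sum>i<n1. \<Sum>j<n2. U i (n1+j) * ((x ^ i * x ^ p j) * u j \<xi>)))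
       + integral {0..x} (\<lambda>\<xi>. (\<Sum>i<n2. \<Sum>j<n1. U (n1+n2+i) j * (x ^ q i * v i j \<xi>)))
       + integral {0..x} (\<lambda>\<xi>. (\<Sum>i<n2. \<Sum>j<n2. U (n1+n2+i) (n1+n2+j) * (x ^ q i * (H i j \<xi> * u j \<xi>))))
       + integral {0..x} (\<lambda>\<xi>. (\<Sum>i<n2. \<Sum>j<n2. U (n1+n2+i) (n1+j) * (x ^ q i * (H i j x * u j \<xi> - H i j \<xi> * u j \<xi>))))
       + integral {0..x} (\<lambda>\<xi>. (\<Sum>i<n2. \<Sum>j<n2. U (n1+i) (n1+j) * (x ^ q i * (H i j 1 - H i j x) * u j \<xi>)))"
        by (subst integral_add, (intro integrable_continuous_real continuous_intros ci)+)+ simp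
      also have "\<dots> =
         (\<Sum>i<n1. \<Sum>j<n2. U i (n1+j) * integral {0..x} (\<lambda>\<xi>. (x ^ i * x ^ p j) * u j \<xi>))
       + (\<Sum>i<n2. \<Sum>j<n1. U (n1+n2+i) j * integral {0..x} (\<lambda>\<xi>. x ^ q i * v i j \<xi>))
       + (\<Sum>i<n2. \<Sum>j<n2. U (n1+n2+i) (n1+n2+j) * integral {0..x} (\<lambda>\<xi>. x ^ q i * (H i j \<xi> * u j \<xi>)))
       + (\<Sum>i<n2. \<Sum>j<n2. U (n1+n2+i) (n1+j) * integral {0..x} (\<lambda>\<xi>. x ^ q i * (H i j x * u j \<xi> - H i j \<xi> * u j \<xi>)))
       + (\<Sum>i<n2. \<Sum>j<n2. U (n1+i) (n1+j) * integral {0..x} (\<lambda>\<xi>. x ^ q i * (H i j 1 - H i j x) * u j \<xi>))"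
        by (subst integral_sum2(1), intro continuous_intros ci)+ simp
      moreover have "integral {0..x} (\<lambda>\<xi>. H i j x * u j \<xi> - H i j \<xi> * u j \<xi>)
          = H i j x * A (u j) x - A (\<lambda>\<xi>. H i j \<xi> * u j \<xi>) x" for i j
        by (subst integral_diff, (intro integrable_continuous_real continuous_intros ci)+) (simp add: A_def)
      ultimately show ?thesis by (simp add: A_def mult.assoc)
    qed
    define S where "S = (\<lambda>i j. ip (u i) (A (\<lambda>\<xi>. H i j \<xi> * u j \<xi>)))"
    define R where "R = (\<lambda>i j. ip (u i) (\<lambda>x. (H i j 1 - H i j x) * A (u j) x))"
    have "ip z (\<lambda>x. integral {0..x} (\<lambda>\<xi>. K1 x \<xi> * z \<xi>)) = integral {0..1} (\<lambda>x.
         (\<Sum>i<n1. \<Sum>j<n2. U i (n1+j) * (x ^ i * z x * (x ^ p j * A (u j) x)))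
       + (\<Sum>i<n2. \<Sum>j<n1. U (n1+n2+i) j * (u i x * A (v i j) x))
       + (\<Sum>i<n2. \<Sum>j<n2. U (n1+n2+i) (n1+n2+j) * (u i x * A (\<lambda>\<xi>. H i j \<xi> * u j \<xi>) x))
       + (\<Sum>i<n2. \<Sum>j<n2. U (n1+n2+i) (n1+j) * (u i x * (H i j x * A (u j) x) - u i x * A (\<lambda>\<xi>. H i j \<xi> * u j \<xi>) x))
       + (\<Sum>i<n2. \<Sum>j<n2. U (n1+i) (n1+j) * (u i x * ((H i j 1 - H i j x) * A (u j) x))))"
      unfolding ip_def
      by (intro integral_cong) (simp only: K, simp add: distrib_left sum_distrib_left u_def algebra_simps)
    also have "\<dots> = integral {0..1} (\<lambda>x. (\<Sum>i<n1. \<Sum>j<n2. U i (n1+j) * (x ^ i * z x * (x ^ p j * A (u j) x))))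
       + integral {0..1} (\<lambda>x. (\<Sum>i<n2. \<Sum>j<n1. U (n1+n2+i) j * (u i x * A (v i j) x)))
       + integral {0..1} (\<lambda>x. (\<Sum>i<n2. \<Sum>j<n2. U (n1+n2+i) (n1+n2+j) * (u i x * A (\<lambda>\<xi>. H i j \<xi> * u j \<xi>) x)))
       + integral {0..1} (\<lambda>x. (\<Sum>i<n2. \<Sum>j<n2. U (n1+n2+i) (n1+j) * (u i x * (H i j x * A (u j) x) - u i x * A (\<lambda>\<xi>. H i j \<xi> * u j \<xi>) x)))
       + integral {0..1} (\<lambda>x. (\<Sum>i<n2. \<Sum>j<n2. U (n1+i) (n1+j) * (u i x * ((H i j 1 - H i j x) * A (u j) x))))"
      by (subst integral_add, (intro integrable_continuous_real continuous_intros cs)+)+ simp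
    also have "\<dots> =
         (\<Sum>i<n1. \<Sum>j<n2. U i (n1+j) * integral {0..1} (\<lambda>x. x ^ i * z x * (x ^ p j * A (u j) x)))
       + (\<Sum>i<n2. \<Sum>j<n1. U (n1+n2+i) j * integral {0..1} (\<lambda>x. u i x * A (v i j) x))
       + (\<Sum>i<n2. \<Sum>j<n2. U (n1+n2+i) (n1+n2+j) * integral {0..1} (\<lambda>x. u i x * A (\<lambda>\<xi>. H i j \<xi> * u j \<xi>) x))
       + (\<Sum>i<n2. \<Sum>j<n2. U (n1+n2+i) (n1+j) * integral {0..1} (\<lambda>x. u i x * (H i j x * A (u j) x) - u i x * A (\<lambda>\<xi>. H i j \<xi> * u j \<xi>) x))
       + (\<Sum>i<n2. \<Sum>j<n2. U (n1+i) (n1+j) * integral {0..1} (\<lambda>x. u i x * ((H i j 1 - H i j x) * A (u j) x)))"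
      by (subst integral_sum2(1), intro continuous_intros cs)+ simp
    also have "\<dots> =
         (\<Sum>i<n1. \<Sum>j<n2. U i (n1+j) * G i (n1+j))
       + (\<Sum>i<n2. \<Sum>j<n1. U (n1+n2+i) j * G (n1+n2+i) j)
       + (\<Sum>i<n2. \<Sum>j<n2. U (n1+n2+i) (n1+n2+j) * S i j)
       + (\<Sum>i<n2. \<Sum>j<n2. U (n1+n2+i) (n1+j) * G (n1+n2+i) (n1+j))
       + (\<Sum>i<n2. \<Sum>j<n2. U (n1+i) (n1+j) * R i j)"
    proof -
      have "integral {0..1} (\<lambda>x. x ^ i * z x * (x ^ p j * A (u j) x)) = G i (n1+j)" if "i < n1" "j < n2" for i j
        using that by (simp add: G_def ip_def \<phi>_simps)
      moreover have "integral {0..1} (\<lambda>x. u i x * A (v i j) x) = G (n1+n2+i) j" if "j < n1" for i j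
      proof -
        have "integral {0..1} (\<lambda>x. u i x * A (v i j) x) = ip (v i j) (B (u i))"
          unfolding A_def B_def using integral_triangle_swap[OF cv cu] by (simp add: ip_def)
        also have "\<dots> = G (n1+n2+i) j" using that
          by (simp add: G_def ip_def \<phi>_simps v_def power_add mult_ac)
        finally show ?thesis .
      qed
      moreover have "integral {0..1} (\<lambda>x. u i x * (H i j x * A (u j) x) - u i x * A (\<lambda>\<xi>. H i j \<xi> * u j \<xi>) x)
          = G (n1+n2+i) (n1+j)" if "j < n2" for i j
      proof -
        have "integral {0..1} (\<lambda>x. u i x * (H i j x * A (u j) x) - u i x * A (\<lambda>\<xi>. H i j \<xi> * u j \<xi>) x)
          = ip (u i) (\<lambda>x. H i j x * A (u j) x) - ip (u i) (A (\<lambda>\<xi>. H i j \<xi> * u j \<xi>))"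
          unfolding ip_def by (intro integral_diff integrable_continuous_real continuous_intros cs)
        also have "\<dots> = integral {0..1} (\<lambda>x. x ^ (p i + p j) * (B (u i) x * A (u j) x))"
          unfolding A_def B_def
          by (rule integral_mult_antiderivative(2)[OF dH H0 _ cu cu, symmetric]) (intro continuous_intros)
        also have "\<dots> = G (n1+n2+i) (n1+j)" using that
          by (simp add: G_def ip_def \<phi>_simps power_add mult_ac)
        finally show ?thesis .
      qed
      ultimately show ?thesis by (simp add: S_def R_def ip_def)
    qed
    finally have K1: "ip z (\<lambda>x. integral {0..x} (\<lambda>\<xi>. K1 x \<xi> * z \<xi>)) = \<dots>" .
    \<comment> \<open>\<open>S\<close> itself is not symmetric, but symmetric coefficients only see
      \<open>S i j + S j i\<close>, which is the entry of \<open>G\<close>. The same symmetrisation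
      is used for \<open>R\<close>.\<close>
    have S: "2 * (\<Sum>i<n2. \<Sum>j<n2. U (n1+n2+i) (n1+n2+j) * S i j)
        = (\<Sum>i<n2. \<Sum>j<n2. U (n1+n2+i) (n1+n2+j) * G (n1+n2+i) (n1+n2+j))"
    proof -
      have G: "G (n1+n2+i) (n1+n2+j) = S i j + S j i" for i j
      proof -
        have "G (n1+n2+i) (n1+n2+j) = integral {0..1} (\<lambda>x. x ^ (p i + p j) * (B (u i) x * B (u j) x))"
          by (simp add: G_def ip_def \<phi>_simps power_add mult_ac)
        also have "\<dots> = S i j + S j i"
          unfolding A_def B_def S_def H_sym[of j i]
          by (rule integral_mult_antiderivative(1)[OF dH H0 _ cu cu]) (intro continuous_intros)
        finally show ?thesis .
      qed
      have "(\<Sum>i<n2. \<Sum>j<n2. U (n1+n2+i) (n1+n2+j) * S i j) = (\<Sum>i<n2. \<Sum>j<n2. U (n1+n2+i) (n1+n2+j) * S j i)"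
        by (subst sum.swap, intro sum.cong refl) (simp add: sym)
      then show ?thesis by (simp add: G distrib_left sum.distrib)
    qed
    have R: "2 * (\<Sum>i<n2. \<Sum>j<n2. U (n1+i) (n1+j) * R i j)
        = (\<Sum>i<n2. \<Sum>j<n2. U (n1+i) (n1+j) * G (n1+i) (n1+j))"
    proof -
      have G: "G (n1+i) (n1+j) = R i j + R j i" if "i < n2" "j < n2" for i j
      proof -
        have "G (n1+i) (n1+j) = integral {0..1} (\<lambda>x. x ^ (p i + p j) * (A (u i) x * A (u j) x))"
          using that by (simp add: G_def ip_def \<phi>_simps power_add mult_ac)
        also have "\<dots> = R i j + R j i"
          unfolding A_def R_def H_sym[of j i]
          by (rule integral_mult_antiderivative(3)[OF dH H0 _ cu cu]) (intro continuous_intros)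
        finally show ?thesis .
      qed
      have "(\<Sum>i<n2. \<Sum>j<n2. U (n1+i) (n1+j) * R i j) = (\<Sum>i<n2. \<Sum>j<n2. U (n1+i) (n1+j) * R j i)"
        by (subst sum.swap, intro sum.cong refl) (simp add: sym)
      then show ?thesis by (simp add: G distrib_left sum.distrib)
    qed
    show ?thesis unfolding qform_def M K1 distrib_left R S by simp
  qed
  finally show ?thesis .
qed

text \<open>Tests \<open>U\<close> on the vector supported in the first block with entries
  \<open>x ^ i\<close>, whose first entry is 1.\<close>

lemma Xi_multiplier_ge:
  assumes X: "(M, K1, K2) \<in> Xi d1 d2 \<epsilon> \<epsilon>'" and "0 \<le> \<epsilon>"
  shows "\<epsilon> \<le> M x"
proof -
  obtain U where
    pos: "\<And>\<phi>. (\<Sum>r<Suc d1 + length (monos2 d2) + length (monos2 d2). \<Sum>s<Suc d1 + length (monos2 d2) + length (monos2 d2).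
        U r s * (\<phi> r * \<phi> s)) \<ge> \<epsilon> * (\<Sum>r<Suc d1. (\<phi> r)\<^sup>2)" and
    Mx: "\<And>x. M x = (\<Sum>i<Suc d1. \<Sum>j<Suc d1. U i j * (x ^ i * x ^ j))"
    by (rule Xi_expand[OF X refl refl refl refl refl]) (rule that; assumption)
  define \<phi> where "\<phi> = (\<lambda>r. if r < Suc d1 then x ^ r else 0)"
  have "(1::real) = (\<phi> 0)\<^sup>2" by (simp add: \<phi>_def)
  also have "\<dots> \<le> (\<Sum>r<Suc d1. (\<phi> r)\<^sup>2)" by (rule member_le_sum) auto
  finally have "\<epsilon> * 1 \<le> \<epsilon> * (\<Sum>r<Suc d1. (\<phi> r)\<^sup>2)"
    using \<open>0 \<le> \<epsilon>\<close> by (rule mult_left_mono)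
  also have "\<dots> \<le> M x"
    using pos[of \<phi>] unfolding Mx sum_lessThan_split3 by (simp add: \<phi>_def del: sum.lessThan_Suc)
  finally show ?thesis by simp
qed

section \<open>Operators with semi-separable kernels\<close>

lemma ip_uniform_limit:
  assumes "uniform_limit {0..1} u u0 F" "uniform_limit {0..1} v v0 F"
    and ev: "\<forall>\<^sub>F s in F. continuous_on {0..1} (u s)" "\<forall>\<^sub>F s in F. continuous_on {0..1} (v s)"
    and c: "continuous_on {0..1} u0" "continuous_on {0..1} v0"
  shows "((\<lambda>s. ip (u s) (v s)) \<longlongrightarrow> ip u0 v0) F"
proof (rule tendstoI)
  fix e :: real assume "0 < e"
  have "uniform_limit {0..1} (\<lambda>s x. u s x * v s x) (\<lambda>x. u0 x * v0 x) F"
    by (rule uniform_lim_mult[OF assms(1,2)])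
      (intro compact_imp_bounded compact_continuous_image c compact_Icc)+
  then have "\<forall>\<^sub>F s in F. \<forall>x\<in>{0..1}. dist (u s x * v s x) (u0 x * v0 x) < e / 2"
    by (rule uniform_limitD) (use \<open>0 < e\<close> in simp)
  then show "\<forall>\<^sub>F s in F. dist (ip (u s) (v s)) (ip u0 v0) < e"
    using ev
  proof eventually_elim
    case (elim s)
    have "ip (u s) (v s) - ip u0 v0 = integral {0..1} (\<lambda>x. u s x * v s x - u0 x * v0 x)"
      unfolding ip_def by (rule integral_diff[symmetric]) (intro integrable_mult01 c elim)+
    also have "norm \<dots> \<le> e / 2 * (1 - 0)"
      by (rule integral_bound) (use elim c in \<open>auto intro!: continuous_intros simp: dist_real_def less_imp_le\<close>)
    finally show ?case using \<open>0 < e\<close> by (simp add: dist_real_def)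
  qed
qed

lemma L2_01_continuous:
  assumes "continuous_on {0..1} z"
  shows "L2_01 z"
proof -
  have "set_integrable lborel {0..1} z" by (rule borel_integrable_atLeastAtMost'[OF assms])
  then show ?thesis
    unfolding L2_01_def set_integrable_def set_borel_measurable_def
    using borel_integrable_atLeastAtMost'[of 0 1 "\<lambda>x. (z x)\<^sup>2"] assms
    by (auto simp: set_integrable_def intro: continuous_intros)
qed

lemma triangle_separable:
  fixes h l :: "nat \<Rightarrow> real \<Rightarrow> real"
  assumes z: "continuous_on {0..1} z" "\<And>k. real_polynomial_function (h k)" "\<And>k. real_polynomial_function (l k)"
  shows "ip z (\<lambda>x. integral {0..x} (\<lambda>\<xi>. (\<Sum>k<m. h k x * l k \<xi>) * z \<xi>))
    = (\<Sum>k<m. ip (\<lambda>x. h k x * z x) (\<lambda>x. integral {0..x} (\<lambda>\<xi>. l k \<xi> * z \<xi>)))"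
proof -
  note c = z(1) poly_fun_continuous_on[OF z(2)] poly_fun_continuous_on[OF z(3)]
  have i: "integral {0..x} (\<lambda>\<xi>. (\<Sum>k<m. h k x * l k \<xi>) * z \<xi>) = (\<Sum>k<m. h k x * integral {0..x} (\<lambda>\<xi>. l k \<xi> * z \<xi>))"
    if "x \<in> {0..1}" for x
  proof -
    have cz: "continuous_on {0..x} z" by (rule continuous_on_subset[OF c(1)]) (use that in auto)
    have "integral {0..x} (\<lambda>\<xi>. (\<Sum>k<m. h k x * l k \<xi>) * z \<xi>) = integral {0..x} (\<lambda>\<xi>. \<Sum>k<m. h k x * (l k \<xi> * z \<xi>))"
      by (simp add: sum_distrib_right mult.assoc)
    also have "\<dots> = (\<Sum>k<m. integral {0..x} (\<lambda>\<xi>. h k x * (l k \<xi> * z \<xi>)))"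
      by (rule integral_sum) (auto intro!: integrable_continuous_real continuous_intros c cz)
    finally show ?thesis by simp
  qed
  have "ip z (\<lambda>x. integral {0..x} (\<lambda>\<xi>. (\<Sum>k<m. h k x * l k \<xi>) * z \<xi>))
      = integral {0..1} (\<lambda>x. \<Sum>k<m. h k x * z x * integral {0..x} (\<lambda>\<xi>. l k \<xi> * z \<xi>))"
    unfolding ip_def by (intro integral_cong) (simp only: i, simp add: sum_distrib_left mult_ac)
  also have "\<dots> = (\<Sum>k<m. integral {0..1} (\<lambda>x. h k x * z x * integral {0..x} (\<lambda>\<xi>. l k \<xi> * z \<xi>)))"
    by (rule integral_sum) (auto intro!: integrable_continuous_real continuous_intros continuous_on_integral_upto c)
  finally show ?thesis by (simp add: ip_def)
qed

text \<open>Two families of products appear in the kernels of the differentiated functional, where a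
  differential operator acts on either factor of each product.\<close>

lemma triangle_separable2:
  fixes h l h' l' :: "nat \<Rightarrow> real \<Rightarrow> real"
  assumes z: "continuous_on {0..1} z"
    and p: "\<And>k. real_polynomial_function (h k)" "\<And>k. real_polynomial_function (l k)"
      "\<And>k. real_polynomial_function (h' k)" "\<And>k. real_polynomial_function (l' k)"
  shows "ip z (\<lambda>x. integral {0..x} (\<lambda>\<xi>. (\<Sum>k<m. h k x * l k \<xi> + h' k x * l' k \<xi>) * z \<xi>))
    = (\<Sum>k<m. ip (\<lambda>x. h k x * z x) (\<lambda>x. integral {0..x} (\<lambda>\<xi>. l k \<xi> * z \<xi>))
           + ip (\<lambda>x. h' k x * z x) (\<lambda>x. integral {0..x} (\<lambda>\<xi>. l' k \<xi> * z \<xi>)))"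
proof -
  let ?H = "\<lambda>k. if k < m then h k else h' (k - m)" and ?L = "\<lambda>k. if k < m then l k else l' (k - m)"
  have s: "(\<Sum>k<m + m. F k) = (\<Sum>k<m. F k) + (\<Sum>k<m. F (m + k))" for F :: "nat \<Rightarrow> real"
    using sum_lessThan_split3[of F m m 0] by simp
  have "real_polynomial_function (?H k)" "real_polynomial_function (?L k)" for k using p by auto
  from triangle_separable[where h = ?H and l = ?L and m = "m + m", OF z this] show ?thesis
    by (simp add: s sum.distrib)
qed

text \<open>A kernel with \<open>K1 x \<xi> = (\<Sum>k<n. f k x * g k \<xi>)\<close> below the diagonal and its mirror image
  above. Every polynomial kernel has this form.\<close>

locale semiseparable =
  fixes M :: "real \<Rightarrow> real" and n :: nat and f g :: "nat \<Rightarrow> real \<Rightarrow> real" and \<epsilon> :: real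
  assumes M_poly: "real_polynomial_function M"
    and f_poly: "\<And>k. real_polynomial_function (f k)" and g_poly: "\<And>k. real_polynomial_function (g k)"
    and eps: "0 < \<epsilon>" and M_ge: "\<And>x. \<epsilon> \<le> M x"
    and qform_ge: "\<And>z. continuous_on {0..1} z \<Longrightarrow> \<epsilon> * ip z z \<le> qform M (\<lambda>x \<xi>. \<Sum>k<n. f k x * g k \<xi>) z"
begin

section \<open>The operator, its symmetry and its bounds\<close>

definition lower :: "nat \<Rightarrow> (real \<Rightarrow> real) \<Rightarrow> real \<Rightarrow> real" where
  "lower k z x = integral {0..x} (\<lambda>\<xi>. g k \<xi> * z \<xi>)"

definition upper :: "nat \<Rightarrow> (real \<Rightarrow> real) \<Rightarrow> real \<Rightarrow> real" where
  "upper k z x = integral {x..1} (\<lambda>\<xi>. f k \<xi> * z \<xi>)"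

definition kop :: "(real \<Rightarrow> real) \<Rightarrow> real \<Rightarrow> real" where
  "kop z x = (\<Sum>k<n. f k x * lower k z x + g k x * upper k z x)"

definition pop :: "(real \<Rightarrow> real) \<Rightarrow> real \<Rightarrow> real" where
  "pop z x = M x * z x + kop z x"

lemmas poly_cont = poly_fun_continuous_on[OF M_poly] poly_fun_continuous_on[OF f_poly]
  poly_fun_continuous_on[OF g_poly]

lemma M_pos: "0 < M x"
  using M_ge[of x] eps by linarith

lemma lower_deriv:
  assumes "continuous_on {0..1} z" "x \<in> {0..1}"
  shows "(lower k z has_real_derivative g k x * z x) (at x within {0..1})"
  unfolding lower_def by (rule has_real_derivative_integral_upto) (intro continuous_intros assms poly_cont)+

lemma upper_deriv:
  assumes "continuous_on {0..1} z" "x \<in> {0..1}"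
  shows "(upper k z has_real_derivative - (f k x * z x)) (at x within {0..1})"
  unfolding upper_def by (rule has_real_derivative_integral_from) (intro continuous_intros assms poly_cont)+

lemma lower_cont: "continuous_on {0..1} z \<Longrightarrow> continuous_on {0..1} (lower k z)"
  by (rule continuous_on_if_deriv01[OF lower_deriv])

lemma upper_cont: "continuous_on {0..1} z \<Longrightarrow> continuous_on {0..1} (upper k z)"
  by (rule continuous_on_if_deriv01[OF upper_deriv])

lemma kop_cont: "continuous_on {0..1} z \<Longrightarrow> continuous_on {0..1} (kop z)"
  unfolding kop_def by (intro continuous_intros lower_cont upper_cont poly_cont)

lemma pop_cont: "continuous_on {0..1} z \<Longrightarrow> continuous_on {0..1} (pop z)"
  unfolding pop_def by (intro continuous_intros kop_cont poly_cont)

lemma kop_lincomb: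
  assumes u: "continuous_on {0..1} u" and v: "continuous_on {0..1} v" and x: "x \<in> {0..1}"
  shows "kop (\<lambda>x. s * u x + r * v x) x = s * kop u x + r * kop v x"
proof -
  have I: "integral A (\<lambda>\<xi>. h \<xi> * (s * u \<xi> + r * v \<xi>)) = s * integral A (\<lambda>\<xi>. h \<xi> * u \<xi>) + r * integral A (\<lambda>\<xi>. h \<xi> * v \<xi>)"
    if "real_polynomial_function h" "A = {0..x} \<or> A = {x..1}" for A h
  proof -
    have c: "continuous_on A u" "continuous_on A v" "continuous_on A h"
      using that x by (auto intro: continuous_on_subset[OF u] continuous_on_subset[OF v] poly_fun_continuous_on)
    have i: "(\<lambda>\<xi>. s * (h \<xi> * u \<xi>)) integrable_on A" "(\<lambda>\<xi>. r * (h \<xi> * v \<xi>)) integrable_on A"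
      using that(2) c by (auto intro!: integrable_continuous_real continuous_intros)
    have "integral A (\<lambda>\<xi>. h \<xi> * (s * u \<xi> + r * v \<xi>)) = integral A (\<lambda>\<xi>. s * (h \<xi> * u \<xi>) + r * (h \<xi> * v \<xi>))"
      by (intro integral_cong) (simp add: algebra_simps)
    then show ?thesis by (simp add: integral_add[OF i])
  qed
  show ?thesis
    unfolding kop_def lower_def upper_def
    by (simp add: I f_poly g_poly) (simp add: sum_distrib_left sum.distrib distrib_left mult_ac)
qed

lemma pop_lincomb:
  assumes "continuous_on {0..1} u" "continuous_on {0..1} v" "x \<in> {0..1}"
  shows "pop (\<lambda>x. s * u x + r * v x) x = s * pop u x + r * pop v x"
  by (simp add: pop_def kop_lincomb[OF assms]) (simp add: algebra_simps)

lemma kop_cong: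
  assumes "\<And>x. x \<in> {0..1} \<Longrightarrow> u x = v x" "x \<in> {0..1}"
  shows "kop u x = kop v x"
  unfolding kop_def lower_def upper_def
  by (intro sum.cong refl arg_cong2[where f = "(+)"] arg_cong2[where f = "(*)"] integral_cong)
    (use assms in auto)

lemma pop_cong:
  assumes "\<And>x. x \<in> {0..1} \<Longrightarrow> u x = v x" "x \<in> {0..1}"
  shows "pop u x = pop v x"
  using kop_cong[OF assms] assms by (simp add: pop_def)

text \<open>Exchanging the order of integration turns each \<open>upper\<close> term into a
  \<open>lower\<close> term. The result is symmetric in \<open>u\<close> and \<open>v\<close>, which
  yields both the symmetry of the operator and its agreement with \<open>qform\<close>.\<close>

lemma ip_kop:
  assumes u: "continuous_on {0..1} u" and v: "continuous_on {0..1} v"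
  shows "ip v (kop u) = (\<Sum>k<n. ip (\<lambda>x. f k x * v x) (lower k u) + ip (\<lambda>x. f k x * u x) (lower k v))"
proof -
  have "ip v (kop u) = integral {0..1} (\<lambda>x. \<Sum>k<n. f k x * v x * lower k u x + g k x * v x * upper k u x)"
    unfolding ip_def kop_def by (simp add: sum_distrib_left algebra_simps)
  also have "\<dots> = (\<Sum>k<n. integral {0..1} (\<lambda>x. f k x * v x * lower k u x + g k x * v x * upper k u x))"
    by (rule integral_sum) (auto intro!: integrable_continuous_real continuous_intros lower_cont upper_cont poly_cont u v)
  also have "\<dots> = (\<Sum>k<n. ip (\<lambda>x. f k x * v x) (lower k u) + ip (\<lambda>x. g k x * v x) (upper k u))"
    unfolding ip_def by (intro sum.cong integral_add integrable_continuous_real continuous_intros lower_cont upper_cont poly_cont u v) auto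
  also have "\<dots> = (\<Sum>k<n. ip (\<lambda>x. f k x * v x) (lower k u) + ip (\<lambda>x. f k x * u x) (lower k v))"
  proof (intro sum.cong refl arg_cong2[where f = "(+)"])
    fix k
    show "ip (\<lambda>x. g k x * v x) (upper k u) = ip (\<lambda>x. f k x * u x) (lower k v)"
      unfolding lower_def upper_def by (rule integral_triangle_swap) (intro continuous_intros poly_cont u v)+
  qed
  finally show ?thesis .
qed

lemma pop_sym:
  assumes u: "continuous_on {0..1} u" and v: "continuous_on {0..1} v"
  shows "ip (pop u) v = ip u (pop v)"
proof -
  have "ip v (pop u) = ip v (\<lambda>x. M x * u x) + ip v (kop u)"
    unfolding pop_def by (intro ip_add_right continuous_intros poly_cont kop_cont u v)
  moreover have "ip u (pop v) = ip u (\<lambda>x. M x * v x) + ip u (kop v)"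
    unfolding pop_def by (intro ip_add_right continuous_intros poly_cont kop_cont u v)
  moreover have "ip v (\<lambda>x. M x * u x) = ip u (\<lambda>x. M x * v x)"
    by (simp add: ip_def algebra_simps)
  moreover have "ip v (kop u) = ip u (kop v)"
    unfolding ip_kop[OF u v] ip_kop[OF v u] by (simp add: add.commute)
  ultimately show ?thesis by (simp add: ip_commute)
qed

lemma qform_eq:
  assumes z: "continuous_on {0..1} z"
  shows "qform M (\<lambda>x \<xi>. \<Sum>k<n. f k x * g k \<xi>) z = ip z (pop z)"
proof -
  have "ip z (pop z) = ip z (\<lambda>x. M x * z x) + ip z (kop z)"
    unfolding pop_def by (intro ip_add_right continuous_intros poly_cont kop_cont z)
  then show ?thesis
    unfolding qform_def triangle_separable[OF z f_poly g_poly] ip_kop[OF z z]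
    by (simp add: lower_def[abs_def] sum.distrib sum_distrib_left)
qed

lemma pop_coercive: "continuous_on {0..1} z \<Longrightarrow> \<epsilon> * ip z z \<le> ip z (pop z)"
  using qform_ge qform_eq by simp

text \<open>The integral part is bounded from \<open>L\<^sub>2\<close> into the supremum norm. This
  makes the images of the iterates in \<open>pop_surj\<close> converge uniformly, and later bounds
  integral terms at the boundary by \<open>L\<^sub>2\<close> norms.\<close>

lemma kop_bound:
  obtains C where "0 < C" "\<And>z x. continuous_on {0..1} z \<Longrightarrow> x \<in> {0..1} \<Longrightarrow> \<bar>kop z x\<bar> \<le> C * sqrt (ip z z)"
    "\<And>z k x. k < n \<Longrightarrow> continuous_on {0..1} z \<Longrightarrow> x \<in> {0..1} \<Longrightarrow> \<bar>lower k z x\<bar> \<le> C * sqrt (ip z z)"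
proof -
  have int: "\<bar>integral A (\<lambda>\<xi>. h \<xi> * z \<xi>)\<bar> \<le> sqrt (ip h h) * sqrt (ip z z)"
    if z: "continuous_on {0..1} z" and h: "continuous_on {0..1} h" and A: "A = {0..x} \<or> A = {x..1}" "x \<in> {0..1}" for A h z x
  proof -
    have sub: "A \<subseteq> {0..1}" using A by auto
    have i: "(\<lambda>\<xi>. \<bar>h \<xi>\<bar> * \<bar>z \<xi>\<bar>) integrable_on A" "(\<lambda>\<xi>. h \<xi> * z \<xi>) integrable_on A"
      using A(1) sub by (auto intro!: integrable_continuous_real continuous_intros
          continuous_on_subset[OF z] continuous_on_subset[OF h])
    have "\<bar>integral A (\<lambda>\<xi>. h \<xi> * z \<xi>)\<bar> \<le> integral A (\<lambda>\<xi>. \<bar>h \<xi>\<bar> * \<bar>z \<xi>\<bar>)"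
      using integral_norm_bound_integral[OF i(2) i(1)] by (simp add: abs_mult)
    also have "\<dots> \<le> ip (\<lambda>x. \<bar>h x\<bar>) (\<lambda>x. \<bar>z x\<bar>)"
      unfolding ip_def by (rule integral_subset_le[OF sub i(1)])
        (auto intro!: integrable_continuous_real continuous_intros z h)
    also have "\<dots> \<le> sqrt (ip (\<lambda>x. \<bar>h x\<bar>) (\<lambda>x. \<bar>h x\<bar>) * ip (\<lambda>x. \<bar>z x\<bar>) (\<lambda>x. \<bar>z x\<bar>))"
      by (intro real_le_rsqrt ip_cauchy_schwarz continuous_intros z h)
    also have "\<dots> = sqrt (ip h h) * sqrt (ip z z)"
      by (simp add: ip_def real_sqrt_mult flip: power2_eq_square)
    finally show ?thesis .
  qed
  have "\<exists>B>0. \<forall>x\<in>{0..1}. \<bar>h k x\<bar> \<le> B" if "continuous_on {0..1} (h k)" for h :: "nat \<Rightarrow> real \<Rightarrow> real" and k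
    using bounded_on01[OF that] by metis
  then have "\<forall>k. \<exists>B>0. \<forall>x\<in>{0..1}. \<bar>f k x\<bar> \<le> B" "\<forall>k. \<exists>B>0. \<forall>x\<in>{0..1}. \<bar>g k x\<bar> \<le> B"
    using poly_cont by blast+
  then obtain F G where F: "\<And>k. 0 < F k" "\<And>k x. x \<in> {0..1} \<Longrightarrow> \<bar>f k x\<bar> \<le> F k"
    and G: "\<And>k. 0 < G k" "\<And>k x. x \<in> {0..1} \<Longrightarrow> \<bar>g k x\<bar> \<le> G k" by metis
  define C where "C = (\<Sum>k<n. F k * sqrt (ip (g k) (g k)) + G k * sqrt (ip (f k) (f k)))"
  define D where "D = (\<Sum>k<n. sqrt (ip (g k) (g k)))"
  have C0: "0 \<le> C" "0 \<le> D" unfolding C_def D_def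
    by (intro sum_nonneg add_nonneg_nonneg mult_nonneg_nonneg less_imp_le[OF F(1)] less_imp_le[OF G(1)] real_sqrt_ge_zero ip_nonneg)+
  show thesis
  proof (rule that[of "C + D + 1"])
    fix z :: "real \<Rightarrow> real" and x :: real assume z: "continuous_on {0..1} z" and x: "x \<in> {0..1}"
    have l: "\<bar>lower k z x\<bar> \<le> sqrt (ip (g k) (g k)) * sqrt (ip z z)" "\<bar>upper k z x\<bar> \<le> sqrt (ip (f k) (f k)) * sqrt (ip z z)" for k
      unfolding lower_def upper_def by (rule int[OF z poly_cont(3), of _ x] int[OF z poly_cont(2), of _ x], use x in auto)+
    have s0: "0 \<le> sqrt (ip z z)" by (simp add: ip_nonneg)
    have "\<bar>kop z x\<bar> \<le> (\<Sum>k<n. \<bar>f k x * lower k z x + g k x * upper k z x\<bar>)"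
      unfolding kop_def by (rule sum_abs)
    also have "\<dots> \<le> (\<Sum>k<n. F k * (sqrt (ip (g k) (g k)) * sqrt (ip z z)) + G k * (sqrt (ip (f k) (f k)) * sqrt (ip z z)))"
    proof (rule sum_mono)
      fix k
      have "\<bar>f k x * lower k z x + g k x * upper k z x\<bar> \<le> \<bar>f k x\<bar> * \<bar>lower k z x\<bar> + \<bar>g k x\<bar> * \<bar>upper k z x\<bar>"
        by (metis abs_mult abs_triangle_ineq)
      also have "\<dots> \<le> F k * (sqrt (ip (g k) (g k)) * sqrt (ip z z)) + G k * (sqrt (ip (f k) (f k)) * sqrt (ip z z))"
        using F G l x by (intro add_mono mult_mono) (auto simp: less_imp_le)
      finally show "\<bar>f k x * lower k z x + g k x * upper k z x\<bar> \<le> \<dots>" .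
    qed
    also have "\<dots> = C * sqrt (ip z z)"
      by (simp add: C_def sum_distrib_right sum.distrib distrib_right mult.assoc)
    also have "\<dots> \<le> (C + D + 1) * sqrt (ip z z)" using s0 C0 by (intro mult_right_mono) auto
    finally show "\<bar>kop z x\<bar> \<le> (C + D + 1) * sqrt (ip z z)" .
    fix k assume "k < n"
    have "sqrt (ip (g k) (g k)) \<le> D" unfolding D_def
      using \<open>k < n\<close> by (intro member_le_sum) (auto simp: ip_nonneg)
    then have "sqrt (ip (g k) (g k)) * sqrt (ip z z) \<le> (C + D + 1) * sqrt (ip z z)"
      using s0 C0 by (intro mult_right_mono) auto
    with l(1)[of k] show "\<bar>lower k z x\<bar> \<le> (C + D + 1) * sqrt (ip z z)" by linarith
  qed (use C0 in simp)
qed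

lemma pop_bound:
  obtains C where "0 < C" "\<And>z. continuous_on {0..1} z \<Longrightarrow> ip (pop z) (pop z) \<le> C * ip z z"
proof -
  obtain C where C: "0 < C" "\<And>z x. continuous_on {0..1} z \<Longrightarrow> x \<in> {0..1} \<Longrightarrow> \<bar>kop z x\<bar> \<le> C * sqrt (ip z z)"
    by (rule kop_bound) blast
  obtain B where B: "0 < B" "\<And>x. x \<in> {0..1} \<Longrightarrow> \<bar>M x\<bar> \<le> B"
    using bounded_on01[OF poly_cont(1)] by blast
  show thesis
  proof (rule that[of "2 * B\<^sup>2 + 2 * C\<^sup>2"])
    fix z :: "real \<Rightarrow> real" assume z: "continuous_on {0..1} z"
    have "ip (\<lambda>x. M x * z x) (\<lambda>x. M x * z x) \<le> ip (\<lambda>x. B * z x) (\<lambda>x. B * z x)"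
    proof (rule ip_mono)
      fix x :: real assume "x \<in> {0..1}"
      then have "(M x)\<^sup>2 \<le> B\<^sup>2" using B by (simp add: abs_le_square_iff[symmetric])
      then have "(M x)\<^sup>2 * (z x)\<^sup>2 \<le> B\<^sup>2 * (z x)\<^sup>2" by (rule mult_right_mono) simp
      then show "M x * z x * (M x * z x) \<le> B * z x * (B * z x)" by (simp add: power2_eq_square algebra_simps)
    qed (intro continuous_intros poly_cont z)+
    moreover have "ip (kop z) (kop z) \<le> C\<^sup>2 * ip z z"
    proof -
      have "ip (kop z) (kop z) \<le> ip (\<lambda>x. C\<^sup>2 * ip z z) (\<lambda>x. 1)"
      proof (rule ip_mono)
        fix x :: real assume "x \<in> {0..1}"
        then have "(kop z x)\<^sup>2 \<le> (C * sqrt (ip z z))\<^sup>2"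
          using C(2)[OF z] by (metis abs_ge_zero power2_abs power_mono)
        then show "kop z x * kop z x \<le> C\<^sup>2 * ip z z * 1"
          using ip_nonneg[of z] by (simp add: power_mult_distrib) (simp add: power2_eq_square)
      qed (intro continuous_intros kop_cont z)+
      then show ?thesis by (simp add: ip_def)
    qed
    moreover have "ip (pop z) (pop z) \<le> 2 * ip (\<lambda>x. M x * z x) (\<lambda>x. M x * z x) + 2 * ip (kop z) (kop z)"
      unfolding pop_def by (rule ip_sum_sq) (intro continuous_intros poly_cont kop_cont z)+
    ultimately show "ip (pop z) (pop z) \<le> (2 * B\<^sup>2 + 2 * C\<^sup>2) * ip z z"
      by (simp only: ip_scale_left ip_scale_right power2_eq_square) (simp only: algebra_simps)
  qed (use B C in \<open>simp add: add_pos_pos\<close>)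
qed

text \<open>Richardson iteration: the residuals decay geometrically in \<open>L\<^sub>2\<close>. The iterates need not
  converge uniformly, but their images under the smoothing part do, and the solution is recovered
  from that limit by dividing by the multiplier.\<close>

lemma pop_surj:
  assumes h: "continuous_on {0..1} h"
  obtains z where "continuous_on {0..1} z" "\<And>x. x \<in> {0..1} \<Longrightarrow> pop z x = h x"
proof -
  obtain C where C: "0 < C" "\<And>z x. continuous_on {0..1} z \<Longrightarrow> x \<in> {0..1} \<Longrightarrow> \<bar>kop z x\<bar> \<le> C * sqrt (ip z z)"
    by (rule kop_bound) blast
  obtain B0 where B0: "0 < B0" "\<And>z. continuous_on {0..1} z \<Longrightarrow> ip (pop z) (pop z) \<le> B0 * ip z z"
    by (rule pop_bound) blast
  \<comment> \<open>The extra summand gives \<open>\<epsilon>\<^sup>2 < B\<close>, so that the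
    contraction factor \<open>\<rho>\<close> lies between 0 and 1.\<close>
  define B where "B = B0 + \<epsilon>\<^sup>2"
  have B: "ip (pop z) (pop z) \<le> B * ip z z" if "continuous_on {0..1} z" for z
    using B0(2)[OF that] mult_nonneg_nonneg[OF zero_le_power2[of \<epsilon>] ip_nonneg[of z]]
    by (simp add: B_def distrib_right)
  have Bp: "0 < B" "\<epsilon>\<^sup>2 < B" using B0 eps by (simp_all add: B_def add_pos_pos)
  \<comment> \<open>This step size minimises the bound
    \<open>1 - 2 * \<tau> * \<epsilon> + \<tau>\<^sup>2 * B\<close> for the contraction factor; the
    minimum is \<open>\<rho>\<close>.\<close>
  define \<tau> where "\<tau> = \<epsilon> / B"
  define \<rho> where "\<rho> = 1 - \<epsilon>\<^sup>2 / B"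
  have \<rho>: "0 \<le> \<rho>" "\<rho> < 1" using Bp eps by (simp_all add: \<rho>_def)
  define r where "r = (\<lambda>N. ((\<lambda>u x. u x - \<tau> * pop u x) ^^ N) h)"
  have r_Suc: "r (Suc N) x = r N x - \<tau> * pop (r N) x" and r_0: "r 0 = h" for N x by (simp_all add: r_def)
  have rc: "continuous_on {0..1} (r N)" for N
    by (induction N) (auto simp: r_Suc[abs_def] r_0 h intro!: continuous_intros pop_cont)
  have r_decay: "ip (r N) (r N) \<le> \<rho> ^ N * ip h h" for N
  proof (induction N)
    case (Suc N)
    have "ip (r (Suc N)) (r (Suc N)) = ip (\<lambda>x. 1 * r N x + (- \<tau>) * pop (r N) x) (\<lambda>x. 1 * r N x + (- \<tau>) * pop (r N) x)"
      by (intro ip_cong) (auto simp: r_Suc)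
    also have "\<dots> = ip (r N) (r N) - 2 * \<tau> * ip (r N) (pop (r N)) + \<tau>\<^sup>2 * ip (pop (r N)) (pop (r N))"
      unfolding ip_square_lincomb[OF rc pop_cont[OF rc]] by simp
    also have "\<dots> \<le> ip (r N) (r N) - 2 * \<tau> * (\<epsilon> * ip (r N) (r N)) + \<tau>\<^sup>2 * (B * ip (r N) (r N))"
      using Bp eps by (intro add_mono diff_mono mult_left_mono pop_coercive rc B) (auto simp: \<tau>_def)
    also have "\<dots> = \<rho> * ip (r N) (r N)"
      using Bp by (simp add: \<tau>_def \<rho>_def field_simps power2_eq_square)
    also have "\<dots> \<le> \<rho> * (\<rho> ^ N * ip h h)" using Suc \<rho> by (intro mult_left_mono)
    finally show ?case by simp
  qed (simp add: r_0)
  \<comment> \<open>Partial sums of the corrections: the residual of \<open>s N\<close> is exactly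
    \<open>r N\<close>.\<close>
  define s where "s = (\<lambda>N x. \<Sum>i<N. \<tau> * r i x)"
  have sc: "continuous_on {0..1} (s N)" for N unfolding s_def by (intro continuous_intros rc)
  have kop_0: "kop (\<lambda>x. 0) x = 0" for x by (simp add: kop_def lower_def upper_def)
  have kop_s: "kop (s N) x = (\<Sum>i<N. \<tau> * kop (r i) x)" if x: "x \<in> {0..1}" for N x
  proof (induction N)
    case (Suc N)
    have "s (Suc N) = (\<lambda>x. 1 * s N x + \<tau> * r N x)" by (simp add: s_def fun_eq_iff)
    then show ?case using kop_lincomb[OF sc rc x, of 1 N \<tau> N] Suc by simp
  qed (simp add: s_def kop_0)
  have residual: "r N x = h x - pop (s N) x" if x: "x \<in> {0..1}" for N x
  proof (induction N)
    case (Suc N)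
    have "s (Suc N) = (\<lambda>x. 1 * s N x + \<tau> * r N x)" by (simp add: s_def fun_eq_iff)
    then show ?case using pop_lincomb[OF sc rc x, of 1 N \<tau> N] Suc by (simp add: r_Suc)
  qed (simp add: s_def r_0 pop_def kop_0)
  define k where "k = (\<lambda>x. \<Sum>i. \<tau> * kop (r i) x)"
  have "uniform_limit {0..1} (\<lambda>N x. \<Sum>i<N. \<tau> * kop (r i) x) k sequentially"
    unfolding k_def
  proof (rule Weierstrass_m_test)
    fix N and x :: real assume x: "x \<in> {0..1}"
    have "\<bar>kop (r N) x\<bar> \<le> C * sqrt (ip (r N) (r N))" by (rule C(2)[OF rc x])
    also have "\<dots> \<le> C * sqrt (\<rho> ^ N * ip h h)"
      using r_decay[of N] C(1) by (intro mult_left_mono real_sqrt_le_mono) auto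
    also have "\<dots> = C * sqrt (ip h h) * sqrt \<rho> ^ N" by (simp add: real_sqrt_mult real_sqrt_power)
    finally have "\<tau> * \<bar>kop (r N) x\<bar> \<le> \<tau> * (C * sqrt (ip h h) * sqrt \<rho> ^ N)"
      using Bp eps by (intro mult_left_mono) (auto simp: \<tau>_def)
    then show "norm (\<tau> * kop (r N) x) \<le> \<tau> * (C * sqrt (ip h h)) * sqrt \<rho> ^ N"
      using Bp eps by (simp add: abs_mult \<tau>_def)
  next
    show "summable (\<lambda>N. \<tau> * (C * sqrt (ip h h)) * sqrt \<rho> ^ N)"
      using \<rho> by (intro summable_mult summable_geometric) simp
  qed
  then have ul: "uniform_limit {0..1} (\<lambda>N. kop (s N)) k sequentially"
    by (rule uniform_limit_cong[THEN iffD1, rotated 2]) (auto simp: kop_s)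
  have kc: "continuous_on {0..1} k"
    by (rule uniform_limit_theorem[OF _ ul]) (auto intro!: always_eventually kop_cont sc)
  \<comment> \<open>Passing to the limit in \<open>M * s N + kop (s N) = h - r N\<close> suggests
    this function. That \<open>kop z = k\<close> follows from the convergence of \<open>s N\<close>
    to \<open>z\<close> in \<open>L\<^sub>2\<close>.\<close>
  define z where "z = (\<lambda>x. (h x - k x) / M x)"
  have zc: "continuous_on {0..1} z" unfolding z_def
    using M_pos by (intro continuous_intros h kc poly_cont) (auto simp: less_imp_neq[symmetric])
  have "(\<lambda>N. ip (\<lambda>x. s N x - z x) (\<lambda>x. s N x - z x)) \<longlonglongrightarrow> 0"
  proof (rule tendsto_sandwich[OF _ _ tendsto_const])
    have "(\<lambda>N. ip (r N) (r N)) \<longlonglongrightarrow> 0"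
    proof (rule tendsto_sandwich[OF _ _ tendsto_const])
      show "(\<lambda>N. \<rho> ^ N * ip h h) \<longlonglongrightarrow> 0"
        using \<rho> by (intro tendsto_mult_left_zero LIMSEQ_realpow_zero)
    qed (auto intro!: always_eventually ip_nonneg r_decay)
    moreover have "(\<lambda>N. ip (\<lambda>x. kop (s N) x - k x) (\<lambda>x. kop (s N) x - k x)) \<longlonglongrightarrow> ip (\<lambda>x. k x - k x) (\<lambda>x. k x - k x)"
      by (intro ip_uniform_limit uniform_limit_minus ul uniform_limit_const)
        (auto intro!: always_eventually continuous_intros kop_cont sc kc)
    ultimately have "(\<lambda>N. (1 / \<epsilon>)\<^sup>2 * (2 * ip (r N) (r N) + 2 * ip (\<lambda>x. kop (s N) x - k x) (\<lambda>x. kop (s N) x - k x)))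
        \<longlonglongrightarrow> (1 / \<epsilon>)\<^sup>2 * (2 * 0 + 2 * ip (\<lambda>x. k x - k x) (\<lambda>x. k x - k x))"
      by (intro tendsto_intros)
    then show "(\<lambda>N. (1 / \<epsilon>)\<^sup>2 * (2 * ip (r N) (r N) + 2 * ip (\<lambda>x. kop (s N) x - k x) (\<lambda>x. kop (s N) x - k x))) \<longlonglongrightarrow> 0"
      by (simp add: ip_def)
    have "ip (\<lambda>x. s N x - z x) (\<lambda>x. s N x - z x) \<le>
        (1 / \<epsilon>)\<^sup>2 * (2 * ip (r N) (r N) + 2 * ip (\<lambda>x. kop (s N) x - k x) (\<lambda>x. kop (s N) x - k x))" for N
    proof -
      have dc: "continuous_on {0..1} (\<lambda>x. kop (s N) x - k x)" by (intro continuous_intros kop_cont sc kc)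
      let ?w = "\<lambda>x. r N x + (kop (s N) x - k x)"
      have wc: "continuous_on {0..1} ?w" by (intro continuous_intros rc dc)
      have "ip (\<lambda>x. s N x - z x) (\<lambda>x. s N x - z x) \<le> ip (\<lambda>x. (1 / \<epsilon>) * ?w x) (\<lambda>x. (1 / \<epsilon>) * ?w x)"
      proof (rule ip_mono)
        fix x :: real assume x: "x \<in> {0..1}"
        have "M x * z x = h x - k x" using M_pos[of x] by (simp add: z_def)
        then have "M x * (s N x - z x) = - ?w x"
          using residual[OF x, of N] by (simp add: pop_def right_diff_distrib)
        then have "(M x)\<^sup>2 * (s N x - z x)\<^sup>2 = (?w x)\<^sup>2"
          by (metis power2_minus power_mult_distrib)
        moreover have "\<epsilon>\<^sup>2 * (s N x - z x)\<^sup>2 \<le> (M x)\<^sup>2 * (s N x - z x)\<^sup>2"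
          using M_ge[of x] eps by (intro mult_right_mono power_mono) auto
        ultimately have "\<epsilon>\<^sup>2 * (s N x - z x)\<^sup>2 \<le> (?w x)\<^sup>2" by simp
        then have "(s N x - z x)\<^sup>2 \<le> (?w x)\<^sup>2 / \<epsilon>\<^sup>2"
          using eps by (simp add: pos_le_divide_eq mult.commute)
        then show "(s N x - z x) * (s N x - z x) \<le> (1 / \<epsilon>) * ?w x * ((1 / \<epsilon>) * ?w x)"
          by (simp add: power2_eq_square)
      qed (intro continuous_intros sc zc wc)+
      also have "\<dots> = (1 / \<epsilon>)\<^sup>2 * ip ?w ?w"
        by (simp only: ip_scale_left ip_scale_right power2_eq_square mult.assoc)
      also have "\<dots> \<le> (1 / \<epsilon>)\<^sup>2 * (2 * ip (r N) (r N) + 2 * ip (\<lambda>x. kop (s N) x - k x) (\<lambda>x. kop (s N) x - k x))"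
        by (intro mult_left_mono ip_sum_sq rc dc) simp
      finally show ?thesis .
    qed
    then show "\<forall>\<^sub>F N in sequentially. ip (\<lambda>x. s N x - z x) (\<lambda>x. s N x - z x) \<le>
        (1 / \<epsilon>)\<^sup>2 * (2 * ip (r N) (r N) + 2 * ip (\<lambda>x. kop (s N) x - k x) (\<lambda>x. kop (s N) x - k x))"
      by (intro always_eventually allI)
  qed (auto intro!: always_eventually ip_nonneg)
  then have lim: "(\<lambda>N. C * sqrt (ip (\<lambda>x. s N x - z x) (\<lambda>x. s N x - z x))) \<longlonglongrightarrow> C * sqrt 0"
    by (intro tendsto_intros)
  have kz: "kop z x = k x" if x: "x \<in> {0..1}" for x
  proof -
    have "(\<lambda>N. kop (s N) x - kop z x) \<longlonglongrightarrow> 0"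
    proof (rule Lim_null_comparison)
      have "\<bar>kop (s N) x - kop z x\<bar> \<le> C * sqrt (ip (\<lambda>x. s N x - z x) (\<lambda>x. s N x - z x))" for N
      proof -
        have "kop (\<lambda>x. s N x - z x) x = kop (s N) x - kop z x"
          using kop_lincomb[OF sc zc x, of 1 N "-1"] by simp
        then show ?thesis using C(2)[of "\<lambda>x. s N x - z x", OF _ x] sc zc by (auto intro!: continuous_intros)
      qed
      then show "\<forall>\<^sub>F N in sequentially. norm (kop (s N) x - kop z x) \<le> C * sqrt (ip (\<lambda>x. s N x - z x) (\<lambda>x. s N x - z x))"
        by (intro always_eventually allI) simp
      show "(\<lambda>N. C * sqrt (ip (\<lambda>x. s N x - z x) (\<lambda>x. s N x - z x))) \<longlonglongrightarrow> 0" using lim by simp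
    qed
    moreover have "(\<lambda>N. kop (s N) x - kop z x) \<longlonglongrightarrow> k x - kop z x"
      using tendsto_uniform_limitI[OF ul x] by (intro tendsto_intros)
    ultimately show ?thesis using LIMSEQ_unique by fastforce
  qed
  have "M x * z x = h x - k x" for x using M_pos[of x] by (simp add: z_def)
  then show thesis by (intro that[OF zc]) (simp add: pop_def kz)
qed

section \<open>The inverse as a continuous function\<close>

lemma semisep_op_eq_pop:
  assumes K: "\<And>x \<xi>. K1 x \<xi> = (\<Sum>k<n. f k x * g k \<xi>)" "\<And>x \<xi>. K2 x \<xi> = K1 \<xi> x"
    and z: "continuous_on {0..1} z" and x: "x \<in> {0..1}"
  shows "semisep_op M K1 K2 z x = pop z x"
proof -
  let ?k = "\<lambda>\<xi>. (if \<xi> \<le> x then K1 x \<xi> else K2 x \<xi>) * z \<xi>"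
  have zc: "continuous_on {0..x} z" "continuous_on {x..1} z"
    using z x by (auto intro: continuous_on_subset)
  have c: "continuous_on {0..1} ?k"
    unfolding K by (intro continuous_intros continuous_on_cases_le poly_cont z) (auto simp: mult.commute)
  have "(LBINT \<xi>:{0..1}. ?k \<xi>) = integral {0..1} ?k"
    by (intro set_borel_integral_eq_integral borel_integrable_atLeastAtMost' c)
  also have "\<dots> = integral {0..x} ?k + integral {x..1} ?k"
    using x integrable_continuous_real[OF c] by (intro Henstock_Kurzweil_Integration.integral_combine[symmetric]) auto
  also have "integral {0..x} ?k = integral {0..x} (\<lambda>\<xi>. \<Sum>k<n. f k x * (g k \<xi> * z \<xi>))"
    by (intro integral_cong) (auto simp: K sum_distrib_right mult.assoc)
  also have "\<dots> = (\<Sum>k<n. f k x * lower k z x)"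
    unfolding lower_def
    by (subst integral_sum) (auto intro!: integrable_continuous_real continuous_intros zc poly_cont)
  also have "integral {x..1} ?k = integral {x..1} (\<lambda>\<xi>. \<Sum>k<n. g k x * (f k \<xi> * z \<xi>))"
  proof (intro integral_cong)
    fix \<xi> assume "\<xi> \<in> {x..1}"
    \<comment> \<open>At \<open>\<xi> = x\<close> the first branch is taken, but both kernels agree
      on the diagonal.\<close>
    then have "(if \<xi> \<le> x then K1 x \<xi> else K2 x \<xi>) = (\<Sum>k<n. g k x * f k \<xi>)"
      by (cases "\<xi> = x") (auto simp: K mult.commute)
    then show "?k \<xi> = (\<Sum>k<n. g k x * (f k \<xi> * z \<xi>))" by (simp add: sum_distrib_right mult.assoc)
  qed
  also have "\<dots> = (\<Sum>k<n. g k x * upper k z x)"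
    unfolding upper_def
    by (subst integral_sum) (auto intro!: integrable_continuous_real continuous_intros zc poly_cont)
  finally show ?thesis unfolding semisep_op_def pop_def kop_def by (simp add: sum.distrib)
qed

text \<open>The pointwise counterpart of \<open>semisep_inv\<close>, with the same normalisation
  outside the interval so that both can denote the same function.\<close>

definition pinv :: "(real \<Rightarrow> real) \<Rightarrow> real \<Rightarrow> real" where
  "pinv h = (THE z. continuous_on {0..1} z \<and> (\<forall>x\<in>{0..1}. pop z x = h x) \<and> (\<forall>x. x \<notin> {0..1} \<longrightarrow> z x = 0))"

text \<open>Coercivity applied to \<open>u - v\<close>. Equality of the images is asked only almost
  everywhere because \<open>semisep_inv\<close> is specified in that sense.\<close>

lemma pop_inj:
  assumes u: "continuous_on {0..1} u" and v: "continuous_on {0..1} v"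
    and ae: "AE x in lborel. x \<in> {0..1} \<longrightarrow> pop u x = pop v x" and x: "x \<in> {0..1}"
  shows "u x = v x"
proof -
  let ?d = "\<lambda>x. 1 * u x + (-1) * v x"
  have dc: "continuous_on {0..1} ?d" by (intro continuous_intros u v)
  have "AE x in lborel. x \<in> {0..1} \<longrightarrow> ?d x * pop ?d x = 0"
    using ae
  proof eventually_elim
    case (elim x)
    then show ?case using pop_lincomb[OF u v, of x 1 "-1"] by auto
  qed
  then have "((\<lambda>x. ?d x * pop ?d x) has_integral 0) {0..1} = ((\<lambda>x. 0) has_integral 0) {0..1}"
    using has_integral_AE[of "{0..1}" "\<lambda>x. ?d x * pop ?d x" "\<lambda>x. 0" 0] by simp
  then have "ip ?d (pop ?d) = 0"
    unfolding ip_def by (auto intro: integral_unique)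
  then have "ip ?d ?d \<le> 0"
    using pop_coercive[OF dc] eps by (simp add: mult_le_0_iff)
  from ip_eq_0_imp[OF dc this x] show ?thesis by simp
qed

lemma pinv:
  assumes h: "continuous_on {0..1} h"
  shows pinv_cont: "continuous_on {0..1} (pinv h)"
    and pop_pinv: "\<And>x. x \<in> {0..1} \<Longrightarrow> pop (pinv h) x = h x"
    and pinv_outside: "\<And>x. x \<notin> {0..1} \<Longrightarrow> pinv h x = 0"
proof -
  obtain z where z: "continuous_on {0..1} z" "\<And>x. x \<in> {0..1} \<Longrightarrow> pop z x = h x"
    by (rule pop_surj[OF h]) blast
  let ?z = "\<lambda>x. if x \<in> {0..1} then z x else 0"
  have zc: "continuous_on {0..1} ?z" using z(1) by (subst continuous_on_cong[OF refl, of _ _ z]) auto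
  have zp: "pop ?z x = h x" if "x \<in> {0..1}" for x
    using pop_cong[of ?z z x] z(2)[OF that] that by simp
  have "\<exists>!z. continuous_on {0..1} z \<and> (\<forall>x\<in>{0..1}. pop z x = h x) \<and> (\<forall>x. x \<notin> {0..1} \<longrightarrow> z x = 0)"
  proof (rule ex1I[of _ ?z])
    fix y assume y: "continuous_on {0..1} y \<and> (\<forall>x\<in>{0..1}. pop y x = h x) \<and> (\<forall>x. x \<notin> {0..1} \<longrightarrow> y x = 0)"
    show "y = ?z"
    proof
      fix x show "y x = ?z x"
        using pop_inj[of y ?z x] y zc zp by (cases "x \<in> {0..1}") auto
    qed
  qed (use zc zp in auto)
  from theI'[OF this] show "continuous_on {0..1} (pinv h)"
    "\<And>x. x \<in> {0..1} \<Longrightarrow> pop (pinv h) x = h x" "\<And>x. x \<notin> {0..1} \<Longrightarrow> pinv h x = 0"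
    by (auto simp: pinv_def)
qed

lemma pinv_eqI:
  assumes h: "continuous_on {0..1} h" and z: "continuous_on {0..1} z" "\<And>x. x \<in> {0..1} \<Longrightarrow> pop z x = h x"
    and x: "x \<in> {0..1}"
  shows "pinv h x = z x"
  using pop_inj[OF pinv_cont[OF h] z(1) _ x] z(2) pop_pinv[OF h] by auto

lemma semisep_inv_eq_pinv:
  assumes K: "\<And>x \<xi>. K1 x \<xi> = (\<Sum>k<n. f k x * g k \<xi>)" "\<And>x \<xi>. K2 x \<xi> = K1 \<xi> x"
    and h: "continuous_on {0..1} h"
  shows "semisep_inv M K1 K2 h = pinv h"
  unfolding semisep_inv_def
proof (rule the_equality)
  note p = pinv_cont[OF h] pop_pinv[OF h] pinv_outside[OF h]
  show "L2_01 (pinv h) \<and> (AE x in lborel. x \<in> {0..1} \<longrightarrow> semisep_op M K1 K2 (pinv h) x = h x) \<and>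
      continuous_on {0..1} (pinv h) \<and> (\<forall>x. x \<notin> {0..1} \<longrightarrow> pinv h x = 0)"
    using p semisep_op_eq_pop[OF K p(1)] by (auto intro: L2_01_continuous)
  fix z assume z: "L2_01 z \<and> (AE x in lborel. x \<in> {0..1} \<longrightarrow> semisep_op M K1 K2 z x = h x) \<and>
      continuous_on {0..1} z \<and> (\<forall>x. x \<notin> {0..1} \<longrightarrow> z x = 0)"
  then have zc: "continuous_on {0..1} z" by blast
  have "AE x in lborel. x \<in> {0..1} \<longrightarrow> semisep_op M K1 K2 z x = h x" using z by blast
  then have "AE x in lborel. x \<in> {0..1} \<longrightarrow> pop z x = pop (pinv h) x"
    by eventually_elim (use semisep_op_eq_pop[OF K zc] p(2) in auto)
  from pop_inj[OF zc p(1) this] have "x \<in> {0..1} \<Longrightarrow> z x = pinv h x" for x .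
  then show "z = pinv h" using z p(3) by (intro ext) metis
qed

end

section \<open>Lyapunov identities\<close>

text \<open>The derivatives are arguments, one-sided at the end points, so that explicit formulas
  for them can be handed from lemma to lemma.\<close>

definition C2_on01 :: "(real \<Rightarrow> real) \<Rightarrow> (real \<Rightarrow> real) \<Rightarrow> (real \<Rightarrow> real) \<Rightarrow> bool" where
  "C2_on01 u u' u'' \<longleftrightarrow> (\<forall>x\<in>{0..1}. (u has_real_derivative u' x) (at x within {0..1})) \<and>
     (\<forall>x\<in>{0..1}. (u' has_real_derivative u'' x) (at x within {0..1})) \<and> continuous_on {0..1} u''"

lemma C2_on01D:
  assumes "C2_on01 u u' u''"
  shows "\<And>x. x \<in> {0..1} \<Longrightarrow> (u has_real_derivative u' x) (at x within {0..1})"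
    "\<And>x. x \<in> {0..1} \<Longrightarrow> (u' has_real_derivative u'' x) (at x within {0..1})"
    "continuous_on {0..1} u" "continuous_on {0..1} u'" "continuous_on {0..1} u''"
  using assms unfolding C2_on01_def by (auto intro: continuous_on_if_deriv01)

text \<open>The square of \<open>v' - k cot (k x + \<theta>) v\<close> is nonnegative. The phase \<open>\<theta> = pi / 2 - k > 0\<close>
  avoids the singularity of the optimal choice \<open>k = pi / 2\<close>, which is reached in the limit.\<close>

lemma wirtinger:
  assumes v: "\<And>x. x \<in> {0..1} \<Longrightarrow> (v has_real_derivative v' x) (at x within {0..1})"
    and v': "continuous_on {0..1} v'" and "v 0 = 0"
  shows "pi\<^sup>2 / 4 * ip v v \<le> ip v' v'"
proof -
  have vc: "continuous_on {0..1} v" using v by (rule continuous_on_if_deriv01)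
  have k: "k\<^sup>2 * ip v v \<le> ip v' v'" if k: "0 < k" "k < pi / 2" for k
  proof -
    define \<theta> where "\<theta> = pi / 2 - k"
    define q where "q = (\<lambda>x. k * (cos (k * x + \<theta>) / sin (k * x + \<theta>)))"
    have s: "0 < sin (k * x + \<theta>)" if "x \<in> {0..1}" for x
    proof (rule sin_gt_zero)
      have "k * x \<le> k" "0 \<le> k * x" using k that by (auto simp: mult_left_le)
      then show "0 < k * x + \<theta>" "k * x + \<theta> < pi" using k unfolding \<theta>_def by linarith+
    qed
    \<comment> \<open>\<open>q\<close> solves this Riccati equation, and therefore
      \<open>v'\<^sup>2 - k\<^sup>2 v\<^sup>2 - (v' - q v)\<^sup>2\<close> is the exact derivative
      of \<open>q v\<^sup>2\<close>.\<close>
    have q': "(q has_real_derivative - (k\<^sup>2 + (q x)\<^sup>2)) (at x within {0..1})" if x: "x \<in> {0..1}" for x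
    proof -
      have "(q has_real_derivative
          k * ((- sin (k * x + \<theta>) * k * sin (k * x + \<theta>) - cos (k * x + \<theta>) * (cos (k * x + \<theta>) * k)) / (sin (k * x + \<theta>) * sin (k * x + \<theta>))))
          (at x within {0..1})"
        unfolding q_def by (rule derivative_eq_intros refl | use s[OF x] in force)+
      moreover have "k * ((- sin (k * x + \<theta>) * k * sin (k * x + \<theta>) - cos (k * x + \<theta>) * (cos (k * x + \<theta>) * k)) / (sin (k * x + \<theta>) * sin (k * x + \<theta>)))
        = - (k\<^sup>2 + (q x)\<^sup>2)"
        using s[OF x] by (simp add: q_def field_simps power2_eq_square)
      ultimately show ?thesis by simp
    qed
    then have qc: "continuous_on {0..1} q" by (rule continuous_on_if_deriv01)
    \<comment> \<open>At \<open>x = 1\<close> the angle is \<open>pi / 2\<close>; together with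
      \<open>v 0 = 0\<close> this removes both boundary terms.\<close>
    have q1: "q 1 = 0" by (simp add: q_def \<theta>_def)
    have "integral {0..1} (\<lambda>x. v' x * v' x - k\<^sup>2 * (v x * v x) - (v' x - q x * v x)\<^sup>2) = q 1 * (v 1)\<^sup>2 - q 0 * (v 0)\<^sup>2"
      by (rule integral_derivative01)
        (auto intro!: derivative_eq_intros v q' simp: power2_eq_square algebra_simps)
    also have "\<dots> = 0" using assms(3) q1 by simp
    also have "integral {0..1} (\<lambda>x. v' x * v' x - k\<^sup>2 * (v x * v x) - (v' x - q x * v x)\<^sup>2)
        = ip v' v' - k\<^sup>2 * ip v v - integral {0..1} (\<lambda>x. (v' x - q x * v x)\<^sup>2)"
      unfolding ip_def
      by (subst integral_diff, (intro integrable_continuous_real continuous_intros v' vc qc)+)+ simp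
    moreover have "0 \<le> integral {0..1} (\<lambda>x. (v' x - q x * v x)\<^sup>2)"
      by (intro integral_nonneg integrable_continuous_real continuous_intros v' vc qc) auto
    ultimately show ?thesis by linarith
  qed
  have "((\<lambda>k. k\<^sup>2 * ip v v) \<longlongrightarrow> (pi / 2)\<^sup>2 * ip v v) (at_left (pi / 2))"
    by (intro tendsto_intros)
  moreover have "\<forall>\<^sub>F k in at_left (pi / 2). k\<^sup>2 * ip v v \<le> ip v' v'"
    using eventually_at_left_real[of 0 "pi / 2"] k by (auto elim!: eventually_mono)
  ultimately have "(pi / 2)\<^sup>2 * ip v v \<le> ip v' v'"
    by (intro tendsto_upperbound[where F = "at_left (pi / 2)"]) auto
  then show ?thesis by (simp add: power_divide)
qed

section \<open>Derivatives of the operator and of its inverse\<close>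

context semiseparable
begin

definition kop' :: "(real \<Rightarrow> real) \<Rightarrow> real \<Rightarrow> real" where
  "kop' z x = (\<Sum>k<n. deriv (f k) x * lower k z x + deriv (g k) x * upper k z x)"

text \<open>The jump of the first derivative of the kernel across the diagonal; it is the bracket
  evaluated at \<open>\<xi> = x\<close> in \<open>T0\<close> and \<open>Q0\<close>.\<close>

definition jump :: "real \<Rightarrow> real" where
  "jump x = (\<Sum>k<n. deriv (f k) x * g k x - deriv (g k) x * f k x)"

definition kop'' :: "(real \<Rightarrow> real) \<Rightarrow> real \<Rightarrow> real" where
  "kop'' z x = (\<Sum>k<n. deriv (deriv (f k)) x * lower k z x + deriv (deriv (g k)) x * upper k z x) + jump x * z x"

definition pop' where "pop' z z' x = deriv M x * z x + M x * z' x + kop' z x"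

definition pop'' where
  "pop'' z z' z'' x = deriv (deriv M) x * z x + 2 * deriv M x * z' x + M x * z'' x + kop'' z x"

lemmas M_deriv = poly_fun_deriv(2)[OF M_poly] poly_fun_deriv(2)[OF poly_fun_deriv(1)[OF M_poly]]
lemmas f_deriv = poly_fun_deriv(2)[OF f_poly] poly_fun_deriv(2)[OF poly_fun_deriv(1)[OF f_poly]]
lemmas g_deriv = poly_fun_deriv(2)[OF g_poly] poly_fun_deriv(2)[OF poly_fun_deriv(1)[OF g_poly]]

lemmas poly_deriv_cont =
  poly_fun_continuous_on[OF poly_fun_deriv(1)[OF M_poly]]
  poly_fun_continuous_on[OF poly_fun_deriv(1)[OF poly_fun_deriv(1)[OF M_poly]]]
  poly_fun_continuous_on[OF poly_fun_deriv(1)[OF f_poly]]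
  poly_fun_continuous_on[OF poly_fun_deriv(1)[OF poly_fun_deriv(1)[OF f_poly]]]
  poly_fun_continuous_on[OF poly_fun_deriv(1)[OF g_poly]]
  poly_fun_continuous_on[OF poly_fun_deriv(1)[OF poly_fun_deriv(1)[OF g_poly]]]

lemma jump_cont: "continuous_on A jump"
  unfolding jump_def by (intro continuous_intros poly_cont poly_deriv_cont)

text \<open>The kernel is continuous across the diagonal, so the contributions of the moving end
  point cancel in the first derivative. In the second they leave the jump of the kernel derivative
  times \<open>z x\<close>. Continuity of \<open>z\<close> is enough for both.\<close>

lemma kop_deriv:
  assumes z: "continuous_on {0..1} z" and x: "x \<in> {0..1}"
  shows "(kop z has_real_derivative kop' z x) (at x within {0..1})"
    and "(kop' z has_real_derivative kop'' z x) (at x within {0..1})"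
proof -
  have "(kop z has_real_derivative (\<Sum>k<n. deriv (f k) x * lower k z x + (g k x * z x) * f k x
      + (deriv (g k) x * upper k z x + - (f k x * z x) * g k x))) (at x within {0..1})"
    unfolding kop_def[abs_def]
    by (intro DERIV_sum DERIV_add DERIV_mult f_deriv g_deriv lower_deriv upper_deriv z x)
  then show "(kop z has_real_derivative kop' z x) (at x within {0..1})"
    by (simp add: kop'_def algebra_simps)
  have "(kop' z has_real_derivative (\<Sum>k<n. deriv (deriv (f k)) x * lower k z x + (g k x * z x) * deriv (f k) x
      + (deriv (deriv (g k)) x * upper k z x + - (f k x * z x) * deriv (g k) x))) (at x within {0..1})"
    unfolding kop'_def[abs_def]
    by (intro DERIV_sum DERIV_add DERIV_mult f_deriv g_deriv lower_deriv upper_deriv z x)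
  moreover have "(\<Sum>k<n. deriv (deriv (f k)) x * lower k z x + (g k x * z x) * deriv (f k) x
      + (deriv (deriv (g k)) x * upper k z x + - (f k x * z x) * deriv (g k) x)) = kop'' z x"
    unfolding kop''_def jump_def sum_distrib_right sum.distrib[symmetric]
    by (intro sum.cong refl) (simp add: algebra_simps)
  ultimately show "(kop' z has_real_derivative kop'' z x) (at x within {0..1})" by simp
qed

lemma kop''_cont: "continuous_on {0..1} z \<Longrightarrow> continuous_on {0..1} (kop'' z)"
  unfolding kop''_def[abs_def] by (intro continuous_intros lower_cont upper_cont poly_deriv_cont jump_cont)

lemma pop_C2:
  assumes "C2_on01 z z' z''"
  shows "C2_on01 (pop z) (pop' z z') (pop'' z z' z'')"
proof -
  note z = C2_on01D[OF assms]
  show ?thesis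
    unfolding C2_on01_def
  proof (intro conjI ballI)
    fix x :: real assume x: "x \<in> {0..1}"
    show "(pop z has_real_derivative pop' z z' x) (at x within {0..1})"
      unfolding pop_def[abs_def] pop'_def
      by (auto intro!: derivative_eq_intros M_deriv kop_deriv z x)
    show "(pop' z z' has_real_derivative pop'' z z' z'' x) (at x within {0..1})"
      unfolding pop'_def[abs_def] pop''_def
      by (auto intro!: derivative_eq_intros M_deriv kop_deriv z x)
  next
    show "continuous_on {0..1} (pop'' z z' z'')"
      unfolding pop''_def[abs_def] by (intro continuous_intros kop''_cont z poly_cont poly_deriv_cont)
  qed
qed

text \<open>The equation \<open>z = (h - kop z) / M\<close> bootstraps: \<open>kop z\<close> is
  twice differentiable as soon as \<open>z\<close> is continuous. The derivatives \<open>z'\<close>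
  and \<open>z''\<close> are defined by solving the differentiated equations for them, so these hold
  at every \<open>x\<close> by construction.\<close>

lemma pinv_C2:
  assumes h: "C2_on01 h h' h''"
  obtains z' z'' where "C2_on01 (pinv h) z' z''"
    "\<And>x. pop' (pinv h) z' x = h' x" "\<And>x. pop'' (pinv h) z' z'' x = h'' x"
proof -
  note h = C2_on01D[OF h]
  define z where "z = pinv h"
  have z: "continuous_on {0..1} z" and pz: "\<And>x. x \<in> {0..1} \<Longrightarrow> pop z x = h x"
    using pinv_cont pop_pinv h(3) by (auto simp: z_def)
  define z' where "z' = (\<lambda>x. (h' x - kop' z x - deriv M x * z x) / M x)"
  define z'' where "z'' = (\<lambda>x. (h'' x - kop'' z x - deriv (deriv M) x * z x - 2 * deriv M x * z' x) / M x)"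
  have M0: "M x \<noteq> 0" for x using M_pos[of x] by simp
  have z_eq: "(h x - kop z x) / M x = z x" if "x \<in> {0..1}" for x
    using pz[OF that] M0[of x] by (simp add: pop_def field_simps)
  have dz: "(z has_real_derivative z' x) (at x within {0..1})" if x: "x \<in> {0..1}" for x
  proof -
    have "((\<lambda>x. (h x - kop z x) / M x) has_real_derivative
        ((h' x - kop' z x) * M x - (h x - kop z x) * deriv M x) / (M x * M x)) (at x within {0..1})"
      by (intro DERIV_divide DERIV_diff h kop_deriv z x M_deriv M0)
    moreover have "h x - kop z x = z x * M x" using z_eq[OF x] M0[of x] by (simp add: field_simps)
    then have "((h' x - kop' z x) * M x - (h x - kop z x) * deriv M x) / (M x * M x) = z' x"
      using M0[of x] by (simp add: z'_def field_simps)
    ultimately have "((\<lambda>x. (h x - kop z x) / M x) has_real_derivative z' x) (at x within {0..1})" by simp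
    then show ?thesis
      by (rule has_field_derivative_transform_within[where d = 1]) (use x z_eq in auto)
  qed
  have dz': "(z' has_real_derivative z'' x) (at x within {0..1})" if x: "x \<in> {0..1}" for x
  proof -
    have "(z' has_real_derivative
        ((h'' x - kop'' z x - (deriv (deriv M) x * z x + z' x * deriv M x)) * M x
          - (h' x - kop' z x - deriv M x * z x) * deriv M x) / (M x * M x)) (at x within {0..1})"
      unfolding z'_def[abs_def]
      by (intro DERIV_divide DERIV_diff DERIV_mult h kop_deriv z x M_deriv M0 dz[unfolded z'_def])
    moreover have "h' x - kop' z x - deriv M x * z x = z' x * M x" using M0[of x] by (simp add: z'_def)
    then have "((h'' x - kop'' z x - (deriv (deriv M) x * z x + z' x * deriv M x)) * M x
          - (h' x - kop' z x - deriv M x * z x) * deriv M x) / (M x * M x) = z'' x"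
      using M0[of x] by (simp add: z''_def field_simps)
    ultimately show ?thesis by simp
  qed
  have cz': "continuous_on {0..1} z'" using dz' by (rule continuous_on_if_deriv01)
  have "C2_on01 z z' z''"
    unfolding C2_on01_def z''_def
    using dz dz' M0 z cz' by (auto simp: z''_def intro!: continuous_intros h kop''_cont poly_cont poly_deriv_cont)
  moreover have "pop' z z' x = h' x" for x using M0[of x] by (simp add: pop'_def z'_def)
  moreover have "pop'' z z' z'' x = h'' x" for x using M0[of x] by (simp add: pop''_def z''_def)
  ultimately show thesis using that z_def by blast
qed

lemma lower_upper_ends:
  "lower k z 0 = 0" "upper k z 1 = 0"
  "lower k z 1 = integral {0..1} (\<lambda>\<xi>. g k \<xi> * z \<xi>)" "upper k z 0 = integral {0..1} (\<lambda>\<xi>. f k \<xi> * z \<xi>)"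
  by (simp_all add: lower_def upper_def)

lemma ip_sum_g:
  assumes "continuous_on {0..1} z"
  shows "ip (\<lambda>x. \<Sum>k<n. h k * g k x) z = (\<Sum>k<n. h k * lower k z 1)"
proof -
  have "ip (\<lambda>x. \<Sum>k<n. h k * g k x) z = integral {0..1} (\<lambda>x. \<Sum>k<n. h k * (g k x * z x))"
    by (simp add: ip_def sum_distrib_right mult.assoc)
  also have "\<dots> = (\<Sum>k<n. integral {0..1} (\<lambda>x. h k * (g k x * z x)))"
    by (rule integral_sum) (auto intro!: integrable_continuous_real continuous_intros assms poly_cont)
  finally show ?thesis by (simp add: lower_upper_ends)
qed

lemma ip_sum_f:
  assumes "continuous_on {0..1} z"
  shows "ip (\<lambda>x. \<Sum>k<n. h k * f k x) z = (\<Sum>k<n. h k * upper k z 0)"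
proof -
  have "ip (\<lambda>x. \<Sum>k<n. h k * f k x) z = integral {0..1} (\<lambda>x. \<Sum>k<n. h k * (f k x * z x))"
    by (simp add: ip_def sum_distrib_right mult.assoc)
  also have "\<dots> = (\<Sum>k<n. integral {0..1} (\<lambda>x. h k * (f k x * z x)))"
    by (rule integral_sum) (auto intro!: integrable_continuous_real continuous_intros assms poly_cont)
  finally show ?thesis by (simp add: lower_upper_ends)
qed

lemma kop_ends:
  "kop z 0 = (\<Sum>k<n. g k 0 * upper k z 0)" "kop z 1 = (\<Sum>k<n. f k 1 * lower k z 1)"
  "kop' z 0 = (\<Sum>k<n. deriv (g k) 0 * upper k z 0)" "kop' z 1 = (\<Sum>k<n. deriv (f k) 1 * lower k z 1)"
  by (simp_all add: kop_def kop'_def lower_upper_ends)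

end

section \<open>The generator, its adjoint and the dissipation inequalities\<close>

locale lyapunov_data = semiseparable +
  fixes a b c :: "real \<Rightarrow> real" and \<alpha> :: real
  assumes a_poly: "real_polynomial_function a" and b_poly: "real_polynomial_function b"
    and c_poly: "real_polynomial_function c"
    and \<alpha>_pos: "0 < \<alpha>" and a_ge: "\<And>x. x \<in> {0..1} \<Longrightarrow> \<alpha> \<le> a x"
begin

lemmas abc_deriv = poly_fun_deriv(2)[OF a_poly] poly_fun_deriv(2)[OF poly_fun_deriv(1)[OF a_poly]]
  poly_fun_deriv(2)[OF b_poly]

lemmas abc_cont = poly_fun_continuous_on[OF a_poly] poly_fun_continuous_on[OF b_poly] poly_fun_continuous_on[OF c_poly]
  poly_fun_continuous_on[OF poly_fun_deriv(1)[OF a_poly]] poly_fun_continuous_on[OF poly_fun_deriv(1)[OF b_poly]]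
  poly_fun_continuous_on[OF poly_fun_deriv(1)[OF poly_fun_deriv(1)[OF a_poly]]]

definition gen :: "(real \<Rightarrow> real) \<Rightarrow> (real \<Rightarrow> real) \<Rightarrow> (real \<Rightarrow> real) \<Rightarrow> real \<Rightarrow> real" where
  "gen u u' u'' x = a x * u'' x + b x * u' x + c x * u x"

definition genp :: "(real \<Rightarrow> real) \<Rightarrow> real \<Rightarrow> real" where
  "genp h = gen h (deriv h) (deriv (deriv h))"

text \<open>The formal adjoint \<open>(a h)'' - (b h)' + c h\<close> of \<open>gen\<close>,
  expanded.\<close>

definition adjp :: "(real \<Rightarrow> real) \<Rightarrow> real \<Rightarrow> real" where
  "adjp h x = a x * deriv (deriv h) x + (2 * deriv a x - b x) * deriv h x + (deriv (deriv a) x - deriv b x + c x) * h x"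

text \<open>The function \<open>T0\<close> without its constant
  \<open>- pi\<^sup>2 / 2 * \<alpha> * \<epsilon>\<close>, which belongs to Wirtinger's inequality
  and is kept apart; \<open>state_kernel\<close> is \<open>T1\<close>.\<close>

definition state_mult :: "real \<Rightarrow> real" where
  "state_mult x = (deriv (deriv a) x - deriv b x) * M x + b x * deriv M x + a x * deriv (deriv M) x
      + 2 * c x * M x + 2 * a x * jump x"

definition state_kernel :: "real \<Rightarrow> real \<Rightarrow> real" where
  "state_kernel x \<xi> = (\<Sum>k<n. genp (f k) x * g k \<xi> + f k x * genp (g k) \<xi>)"

text \<open>The analogue for \<open>Q0\<close>, with \<open>obs_kernel\<close> for
  \<open>Q1\<close>. It differs from \<open>state_mult\<close> in the coefficient of
  \<open>deriv M\<close>, because the adjoint takes the place of the generator.\<close>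

definition obs_mult :: "real \<Rightarrow> real" where
  "obs_mult x = (deriv (deriv a) x - deriv b x) * M x + (2 * deriv a x - b x) * deriv M x + a x * deriv (deriv M) x
      + 2 * c x * M x + 2 * a x * jump x"

definition obs_kernel :: "real \<Rightarrow> real \<Rightarrow> real" where
  "obs_kernel x \<xi> = (\<Sum>k<n. adjp (f k) x * g k \<xi> + f k x * adjp (g k) \<xi>)"

lemma gen_cont: "C2_on01 u u' u'' \<Longrightarrow> continuous_on {0..1} (gen u u' u'')"
  unfolding gen_def[abs_def] by (intro continuous_intros abc_cont C2_on01D; assumption)

lemma genp_poly:
  assumes h: "real_polynomial_function h"
  shows "real_polynomial_function (genp h)" "real_polynomial_function (adjp h)"
proof -
  note pi = real_polynomial_function.intros(3,4) poly_fun_deriv(1) real_polynomial_function_diff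
    a_poly b_poly c_poly h real_polynomial_function.intros(2)
  show "real_polynomial_function (genp h)"
    unfolding genp_def gen_def[abs_def] by (rule pi | assumption)+
  show "real_polynomial_function (adjp h)"
    unfolding adjp_def[abs_def] by (rule pi | assumption)+
qed

text \<open>Wirtinger's inequality for \<open>z - z 0\<close>, since \<open>z\<close> need not
  vanish at 0. Expanding the square leaves a cross term with the mean of \<open>z\<close> and a
  multiple of \<open>(z 0)\<^sup>2\<close>; the conditions at 0 on \<open>T3\<close>,
  \<open>T4\<close> and \<open>Q3\<close>, \<open>Q4\<close> are made to match these two.\<close>

lemma ip_wirtinger:
  assumes z: "C2_on01 z z' z''"
  shows "pi\<^sup>2 / 2 * \<alpha> * \<epsilon> * (ip z z - 2 * z 0 * integral {0..1} z + (z 0)\<^sup>2) \<le> 2 * ip (\<lambda>x. a x * M x * z' x) z'"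
proof -
  note z = C2_on01D[OF z]
  have "pi\<^sup>2 / 4 * ip (\<lambda>x. z x - z 0) (\<lambda>x. z x - z 0) \<le> ip z' z'"
    by (rule wirtinger) (auto intro!: derivative_eq_intros z)
  moreover have "ip (\<lambda>x. z x - z 0) (\<lambda>x. z x - z 0) = ip z z - 2 * z 0 * integral {0..1} z + (z 0)\<^sup>2"
  proof -
    have "ip (\<lambda>x. 1 * z x + (-1) * z 0) (\<lambda>x. 1 * z x + (-1) * z 0)
      = ip z z - 2 * ip z (\<lambda>x. z 0) + ip (\<lambda>x. z 0) (\<lambda>x. z 0)"
      by (subst ip_square_lincomb) (auto intro!: continuous_intros z)
    then show ?thesis by (simp add: ip_def power2_eq_square mult.commute)
  qed
  ultimately have 1: "pi\<^sup>2 / 4 * (ip z z - 2 * z 0 * integral {0..1} z + (z 0)\<^sup>2) \<le> ip z' z'" by simp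
  have "\<alpha> * \<epsilon> * ip z' z' = ip (\<lambda>x. \<alpha> * \<epsilon> * z' x) z'" by (simp only: ip_scale_left)
  also have "\<dots> \<le> ip (\<lambda>x. a x * M x * z' x) z'"
  proof (rule ip_mono)
    fix x :: real assume "x \<in> {0..1}"
    then have "\<alpha> * \<epsilon> \<le> a x * M x"
      using a_ge[of x] M_ge[of x] \<alpha>_pos eps by (intro mult_mono) auto
    then have "\<alpha> * \<epsilon> * (z' x * z' x) \<le> a x * M x * (z' x * z' x)" by (rule mult_right_mono) simp
    then show "\<alpha> * \<epsilon> * z' x * z' x \<le> a x * M x * z' x * z' x" by (simp only: mult.assoc)
  qed (intro continuous_intros z abc_cont poly_cont)+
  finally have "\<alpha> * \<epsilon> * ip z' z' \<le> ip (\<lambda>x. a x * M x * z' x) z'" .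
  moreover have "\<alpha> * \<epsilon> * (pi\<^sup>2 / 4 * (ip z z - 2 * z 0 * integral {0..1} z + (z 0)\<^sup>2)) \<le> \<alpha> * \<epsilon> * ip z' z'"
    using 1 \<alpha>_pos eps by (intro mult_left_mono) auto
  ultimately have "2 * (\<alpha> * \<epsilon> * (pi\<^sup>2 / 4 * (ip z z - 2 * z 0 * integral {0..1} z + (z 0)\<^sup>2))) \<le> 2 * ip (\<lambda>x. a x * M x * z' x) z'"
    by linarith
  then show ?thesis by (simp add: algebra_simps)
qed

text \<open>The generator acts on \<open>pop z\<close>, so its derivatives fall on the kernel at
  once and only the order of integration has to be exchanged to reach \<open>state_kernel\<close>.
  The multiplier part is integrated by parts; \<open>W\<close> collects its boundary terms.\<close>

lemma state_identity:
  assumes C2: "C2_on01 z z' z''"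
  defines "W \<equiv> \<lambda>x. 2 * a x * M x * z x * z' x + ((b x - deriv a x) * M x + a x * deriv M x) * (z x)\<^sup>2"
  shows "2 * ip z (gen (pop z) (pop' z z') (pop'' z z' z''))
    = qform state_mult state_kernel z - 2 * ip (\<lambda>x. a x * M x * z' x) z' + W 1 - W 0"
proof -
  note z = C2_on01D[OF C2]
  note cs = z abc_cont poly_cont poly_deriv_cont jump_cont lower_cont[OF z(3)] upper_cont[OF z(3)]
  note gc = poly_fun_continuous_on[OF genp_poly(1)[OF f_poly]] poly_fun_continuous_on[OF genp_poly(1)[OF g_poly]]
  have cT0: "continuous_on {0..1} state_mult" unfolding state_mult_def[abs_def] by (intro continuous_intros cs)
  define W' where "W' = (\<lambda>x. 2 * (z x * gen (pop z) (pop' z z') (pop'' z z' z'') x) - z x * (state_mult x * z x)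
      + 2 * (a x * M x * z' x * z' x)
      - 2 * (\<Sum>k<n. genp (f k) x * z x * lower k z x + genp (g k) x * z x * upper k z x))"
  have dW: "(W has_real_derivative W' x) (at x within {0..1})" if x: "x \<in> {0..1}" for x
  proof -
    have "(W has_real_derivative
        2 * deriv a x * M x * z x * z' x + 2 * a x * deriv M x * z x * z' x + 2 * a x * M x * z' x * z' x + 2 * a x * M x * z x * z'' x
        + ((deriv b x - deriv (deriv a) x) * M x + (b x - deriv a x) * deriv M x + deriv a x * deriv M x + a x * deriv (deriv M) x) * (z x)\<^sup>2
        + ((b x - deriv a x) * M x + a x * deriv M x) * (2 * z x * z' x)) (at x within {0..1})"
      unfolding W_def
      by (auto intro!: derivative_eq_intros abc_deriv M_deriv z x simp: algebra_simps power2_eq_square)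
    \<comment> \<open>This is \<open>z\<close> times the generator applied to \<open>kop z\<close>,
      without the jump term of \<open>kop''\<close>, which is already counted in
      \<open>state_mult\<close>.\<close>
    moreover have S: "(\<Sum>k<n. genp (f k) x * z x * lower k z x + genp (g k) x * z x * upper k z x)
        = z x * (a x * (\<Sum>k<n. deriv (deriv (f k)) x * lower k z x + deriv (deriv (g k)) x * upper k z x)
          + b x * kop' z x + c x * kop z x)"
      unfolding kop'_def kop_def sum_distrib_left sum.distrib[symmetric]
      by (intro sum.cong refl) (simp add: genp_def gen_def algebra_simps)
    ultimately show ?thesis
      by (elim DERIV_cong, unfold W'_def S) (simp add: state_mult_def gen_def pop_def pop'_def pop''_def kop''_def power2_eq_square algebra_simps)
  qed
  have sumc: "continuous_on {0..1} (\<lambda>x. \<Sum>k<n. genp (f k) x * z x * lower k z x + genp (g k) x * z x * upper k z x)"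
    by (intro continuous_intros cs gc)
  have "W 1 - W 0 = integral {0..1} W'" by (rule integral_derivative01[OF dW, symmetric])
  also have "\<dots> = 2 * ip z (gen (pop z) (pop' z z') (pop'' z z' z'')) - ip z (\<lambda>x. state_mult x * z x)
      + 2 * ip (\<lambda>x. a x * M x * z' x) z'
      - 2 * integral {0..1} (\<lambda>x. \<Sum>k<n. genp (f k) x * z x * lower k z x + genp (g k) x * z x * upper k z x)"
    unfolding W'_def ip_def
    by (subst integral_diff integral_add, (intro integrable_continuous_real continuous_intros cs gc cT0 gen_cont[OF pop_C2[OF C2]])+)+ simp
  also have "integral {0..1} (\<lambda>x. \<Sum>k<n. genp (f k) x * z x * lower k z x + genp (g k) x * z x * upper k z x)
      = (\<Sum>k<n. integral {0..1} (\<lambda>x. genp (f k) x * z x * lower k z x + genp (g k) x * z x * upper k z x))"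
    by (rule integral_sum) (auto intro!: integrable_continuous_real continuous_intros cs gc)
  also have "\<dots> = (\<Sum>k<n. ip (\<lambda>x. genp (f k) x * z x) (lower k z) + ip (\<lambda>x. genp (g k) x * z x) (upper k z))"
    unfolding ip_def by (intro sum.cong integral_add integrable_continuous_real continuous_intros cs gc refl)
  also have "\<dots> = (\<Sum>k<n. ip (\<lambda>x. genp (f k) x * z x) (\<lambda>x. integral {0..x} (\<lambda>\<xi>. g k \<xi> * z \<xi>))
      + ip (\<lambda>x. f k x * z x) (\<lambda>x. integral {0..x} (\<lambda>\<xi>. genp (g k) \<xi> * z \<xi>)))"
    unfolding lower_def[abs_def] upper_def[abs_def]
    by (intro sum.cong refl arg_cong2[where f = "(+)"] integral_triangle_swap continuous_intros cs gc)
  also have "\<dots> = ip z (\<lambda>x. integral {0..x} (\<lambda>\<xi>. state_kernel x \<xi> * z \<xi>))"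
    unfolding state_kernel_def by (rule triangle_separable2[OF z(3) genp_poly(1)[OF f_poly] g_poly f_poly genp_poly(1)[OF g_poly], symmetric])
  finally show ?thesis unfolding qform_def by simp
qed

text \<open>Here the generator acts on \<open>z\<close> itself, so the kernel part is integrated by
  parts as well: this produces the adjoint in \<open>obs_kernel\<close> and the terms with
  \<open>kop\<close> and \<open>kop'\<close> in \<open>W\<close>.\<close>

lemma observer_identity:
  assumes C2: "C2_on01 z z' z''"
  defines "W \<equiv> \<lambda>x. 2 * a x * M x * z x * z' x + ((b x - deriv a x) * M x - a x * deriv M x) * (z x)\<^sup>2
      + 2 * (kop z x * a x * z' x + ((b x - deriv a x) * kop z x - a x * kop' z x) * z x)"
  shows "2 * ip (pop z) (gen z z' z'')
    = qform obs_mult obs_kernel z - 2 * ip (\<lambda>x. a x * M x * z' x) z' + W 1 - W 0"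
proof -
  note z = C2_on01D[OF C2]
  note cs = z abc_cont poly_cont poly_deriv_cont jump_cont lower_cont[OF z(3)] upper_cont[OF z(3)] pop_cont[OF z(3)]
  note gc = poly_fun_continuous_on[OF genp_poly(2)[OF f_poly]] poly_fun_continuous_on[OF genp_poly(2)[OF g_poly]]
  have cQ0: "continuous_on {0..1} obs_mult" unfolding obs_mult_def[abs_def] by (intro continuous_intros cs)
  define W' where "W' = (\<lambda>x. 2 * (pop z x * gen z z' z'' x) - z x * (obs_mult x * z x)
      + 2 * (a x * M x * z' x * z' x)
      - 2 * (\<Sum>k<n. adjp (f k) x * z x * lower k z x + adjp (g k) x * z x * upper k z x))"
  have dW: "(W has_real_derivative W' x) (at x within {0..1})" if x: "x \<in> {0..1}" for x
  proof -
    have "(W has_real_derivative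
        2 * deriv a x * M x * z x * z' x + 2 * a x * deriv M x * z x * z' x + 2 * a x * M x * z' x * z' x + 2 * a x * M x * z x * z'' x
        + ((deriv b x - deriv (deriv a) x) * M x + (b x - deriv a x) * deriv M x - deriv a x * deriv M x - a x * deriv (deriv M) x) * (z x)\<^sup>2
        + ((b x - deriv a x) * M x - a x * deriv M x) * (2 * z x * z' x)
        + 2 * (kop' z x * a x * z' x + kop z x * deriv a x * z' x + kop z x * a x * z'' x
          + ((deriv b x - deriv (deriv a) x) * kop z x + (b x - deriv a x) * kop' z x - deriv a x * kop' z x - a x * kop'' z x) * z x
          + ((b x - deriv a x) * kop z x - a x * kop' z x) * z' x)) (at x within {0..1})"
      unfolding W_def
      by (auto intro!: derivative_eq_intros abc_deriv M_deriv kop_deriv z x simp: algebra_simps power2_eq_square)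
    moreover have S: "(\<Sum>k<n. adjp (f k) x * z x * lower k z x + adjp (g k) x * z x * upper k z x)
        = z x * (a x * (\<Sum>k<n. deriv (deriv (f k)) x * lower k z x + deriv (deriv (g k)) x * upper k z x)
          + (2 * deriv a x - b x) * kop' z x + (deriv (deriv a) x - deriv b x + c x) * kop z x)"
      unfolding kop'_def kop_def sum_distrib_left sum.distrib[symmetric]
      by (intro sum.cong refl) (simp add: adjp_def algebra_simps)
    ultimately show ?thesis
      by (elim DERIV_cong, unfold W'_def S) (simp add: obs_mult_def gen_def pop_def kop''_def power2_eq_square algebra_simps)
  qed
  have "W 1 - W 0 = integral {0..1} W'" by (rule integral_derivative01[OF dW, symmetric])
  also have "\<dots> = 2 * ip (pop z) (gen z z' z'') - ip z (\<lambda>x. obs_mult x * z x)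
      + 2 * ip (\<lambda>x. a x * M x * z' x) z'
      - 2 * integral {0..1} (\<lambda>x. \<Sum>k<n. adjp (f k) x * z x * lower k z x + adjp (g k) x * z x * upper k z x)"
    unfolding W'_def ip_def
    by (subst integral_diff integral_add, (intro integrable_continuous_real continuous_intros cs gc cQ0 gen_cont[OF C2])+)+ simp
  also have "integral {0..1} (\<lambda>x. \<Sum>k<n. adjp (f k) x * z x * lower k z x + adjp (g k) x * z x * upper k z x)
      = (\<Sum>k<n. integral {0..1} (\<lambda>x. adjp (f k) x * z x * lower k z x + adjp (g k) x * z x * upper k z x))"
    by (rule integral_sum) (auto intro!: integrable_continuous_real continuous_intros cs gc)
  also have "\<dots> = (\<Sum>k<n. ip (\<lambda>x. adjp (f k) x * z x) (lower k z) + ip (\<lambda>x. adjp (g k) x * z x) (upper k z))"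
    unfolding ip_def by (intro sum.cong integral_add integrable_continuous_real continuous_intros cs gc refl)
  also have "\<dots> = (\<Sum>k<n. ip (\<lambda>x. adjp (f k) x * z x) (\<lambda>x. integral {0..x} (\<lambda>\<xi>. g k \<xi> * z \<xi>))
      + ip (\<lambda>x. f k x * z x) (\<lambda>x. integral {0..x} (\<lambda>\<xi>. adjp (g k) \<xi> * z \<xi>)))"
    unfolding lower_def[abs_def] upper_def[abs_def]
    by (intro sum.cong refl arg_cong2[where f = "(+)"] integral_triangle_swap continuous_intros cs gc)
  also have "\<dots> = ip z (\<lambda>x. integral {0..x} (\<lambda>\<xi>. obs_kernel x \<xi> * z \<xi>))"
    unfolding obs_kernel_def by (rule triangle_separable2[OF z(3) genp_poly(2)[OF f_poly] g_poly f_poly genp_poly(2)[OF g_poly], symmetric])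
  finally show ?thesis unfolding qform_def by simp
qed

lemma mult_cont: "continuous_on A state_mult" "continuous_on A obs_mult"
  unfolding state_mult_def[abs_def] obs_mult_def[abs_def]
  by (intro continuous_intros abc_cont poly_cont poly_deriv_cont jump_cont)+

lemma qform_shift:
  assumes "continuous_on {0..1} T0" "continuous_on {0..1} z"
  shows "qform (\<lambda>x. T0 x - s) T1 z = qform T0 T1 z - s * ip z z"
proof -
  have "ip z (\<lambda>x. (T0 x - s) * z x) = ip z (\<lambda>x. T0 x * z x - s * z x)"
    by (simp add: left_diff_distrib)
  also have "\<dots> = ip z (\<lambda>x. T0 x * z x) - ip z (\<lambda>x. s * z x)"
    by (intro ip_diff_right continuous_intros assms)
  finally show ?thesis by (simp add: qform_def ip_scale_right)
qed

text \<open>At 0 the condition \<open>pop' z z' 0 = 0\<close> expresses \<open>z' 0\<close> through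
  \<open>z 0\<close> and \<open>kop' z 0\<close>. The condition on \<open>T4\<close> makes the
  latter a multiple of the mean of \<open>z\<close>, which cancels the cross term of Wirtinger's
  inequality, and the condition on \<open>T3\<close> settles the sign of the
  \<open>(z 0)\<^sup>2\<close> term. The boundary terms at 1 remain.\<close>

lemma state_dissipation:
  assumes C2: "C2_on01 z z' z''" and bc: "pop' z z' 0 = 0"
    and neg: "qform (\<lambda>x. state_mult x - pi\<^sup>2 / 2 * \<alpha> * \<epsilon>) state_kernel z \<le> - 2 * \<delta> * ip z (pop z)"
    and T3: "(deriv a 0 - b 0) * M 0 + a 0 * deriv M 0 - pi\<^sup>2 / 2 * \<alpha> * \<epsilon> \<le> 0"
    and T4: "\<And>x. 2 * a 0 * (\<Sum>k<n. deriv (g k) 0 * f k x) + pi\<^sup>2 * \<alpha> * \<epsilon> = 0"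
  shows "2 * ip z (gen (pop z) (pop' z z') (pop'' z z' z'')) \<le> - 2 * \<delta> * ip z (pop z)
    + ((b 1 - deriv a 1) * M 1 + a 1 * deriv M 1) * (z 1)\<^sup>2 + 2 * a 1 * M 1 * z 1 * z' 1"
proof -
  note z = C2_on01D[OF C2]
  have "2 * a 0 * kop' z 0 = ip (\<lambda>x. 2 * a 0 * (\<Sum>k<n. deriv (g k) 0 * f k x)) z"
    unfolding kop_ends ip_scale_left ip_sum_f[OF z(3)] ..
  also have "(\<lambda>x. 2 * a 0 * (\<Sum>k<n. deriv (g k) 0 * f k x)) = (\<lambda>x. - (pi\<^sup>2 * \<alpha> * \<epsilon>))"
    using T4 by (auto simp: fun_eq_iff algebra_simps eq_neg_iff_add_eq_0)
  finally have k0: "2 * a 0 * kop' z 0 = - (pi\<^sup>2 * \<alpha> * \<epsilon>) * integral {0..1} z" by (simp add: ip_def)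
  have "2 * a 0 * M 0 * z 0 * z' 0 = 2 * a 0 * z 0 * (M 0 * z' 0)" by simp
  also have "M 0 * z' 0 = - deriv M 0 * z 0 - kop' z 0" using bc by (simp add: pop'_def)
  also have "2 * a 0 * z 0 * (- deriv M 0 * z 0 - kop' z 0) = - 2 * a 0 * deriv M 0 * (z 0)\<^sup>2 - z 0 * (2 * a 0 * kop' z 0)"
    by (simp add: algebra_simps power2_eq_square)
  finally have b0: "2 * a 0 * M 0 * z 0 * z' 0 = - 2 * a 0 * deriv M 0 * (z 0)\<^sup>2 + pi\<^sup>2 * \<alpha> * \<epsilon> * (z 0 * integral {0..1} z)"
    unfolding k0 by (simp add: algebra_simps)
  have "((deriv a 0 - b 0) * M 0 + a 0 * deriv M 0 - pi\<^sup>2 / 2 * \<alpha> * \<epsilon>) * (z 0)\<^sup>2 \<le> 0"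
    using T3 by (intro mult_nonpos_nonneg) auto
  then show ?thesis
    using state_identity[OF C2] neg ip_wirtinger[OF C2] b0
    unfolding qform_shift[OF mult_cont(1) z(3)]
    by (simp add: algebra_simps)
qed

text \<open>As for the state, with \<open>z' 0 = 0\<close> and with the condition on
  \<open>Q4\<close> for the integral terms at 0. Integral terms remain at 1; the observer gain is
  designed to cancel them.\<close>

lemma observer_dissipation:
  assumes C2: "C2_on01 z z' z''" and bc: "z' 0 = 0"
    and neg: "qform (\<lambda>x. obs_mult x - pi\<^sup>2 / 2 * \<alpha> * \<epsilon>) obs_kernel z \<le> - 2 * \<delta> * ip z (pop z)"
    and Q3: "(deriv a 0 - b 0) * M 0 + a 0 * deriv M 0 - pi\<^sup>2 / 2 * \<alpha> * \<epsilon> \<le> 0"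
    and Q4: "\<And>x. 2 * (deriv a 0 - b 0) * (\<Sum>k<n. g k 0 * f k x) + 2 * a 0 * (\<Sum>k<n. deriv (g k) 0 * f k x)
        + pi\<^sup>2 * \<alpha> * \<epsilon> = 0"
  shows "2 * ip (pop z) (gen z z' z'') \<le> - 2 * \<delta> * ip z (pop z)
    + ((b 1 - deriv a 1) * M 1 - a 1 * deriv M 1) * (z 1)\<^sup>2 + 2 * a 1 * M 1 * z 1 * z' 1
    + z 1 * (2 * (b 1 - deriv a 1) * kop z 1 - 2 * a 1 * kop' z 1) + z' 1 * (2 * a 1 * kop z 1)"
proof -
  note z = C2_on01D[OF C2]
  have "2 * (deriv a 0 - b 0) * kop z 0 + 2 * a 0 * kop' z 0
      = ip (\<lambda>x. 2 * (deriv a 0 - b 0) * (\<Sum>k<n. g k 0 * f k x)) z + ip (\<lambda>x. 2 * a 0 * (\<Sum>k<n. deriv (g k) 0 * f k x)) z"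
    unfolding kop_ends ip_scale_left ip_sum_f[OF z(3)] ..
  also have "\<dots> = ip (\<lambda>x. 2 * (deriv a 0 - b 0) * (\<Sum>k<n. g k 0 * f k x) + 2 * a 0 * (\<Sum>k<n. deriv (g k) 0 * f k x)) z"
    by (intro ip_add_left[symmetric] continuous_intros poly_cont z)
  also have "(\<lambda>x. 2 * (deriv a 0 - b 0) * (\<Sum>k<n. g k 0 * f k x) + 2 * a 0 * (\<Sum>k<n. deriv (g k) 0 * f k x))
      = (\<lambda>x. - (pi\<^sup>2 * \<alpha> * \<epsilon>))"
    using Q4 by (auto simp: fun_eq_iff eq_neg_iff_add_eq_0)
  finally have k0: "2 * (deriv a 0 - b 0) * kop z 0 + 2 * a 0 * kop' z 0 = - (pi\<^sup>2 * \<alpha> * \<epsilon>) * integral {0..1} z" by (simp add: ip_def)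
  have b0: "2 * ((b 0 - deriv a 0) * kop z 0 - a 0 * kop' z 0) * z 0 = pi\<^sup>2 * \<alpha> * \<epsilon> * (z 0 * integral {0..1} z)"
  proof -
    have "2 * ((b 0 - deriv a 0) * kop z 0 - a 0 * kop' z 0) * z 0 = - z 0 * (2 * (deriv a 0 - b 0) * kop z 0 + 2 * a 0 * kop' z 0)"
      by (simp add: algebra_simps)
    then show ?thesis unfolding k0 by simp
  qed
  have "((deriv a 0 - b 0) * M 0 + a 0 * deriv M 0 - pi\<^sup>2 / 2 * \<alpha> * \<epsilon>) * (z 0)\<^sup>2 \<le> 0"
    using Q3 by (intro mult_nonpos_nonneg) auto
  then show ?thesis
    using observer_identity[OF C2] neg ip_wirtinger[OF C2] b0 bc
    unfolding qform_shift[OF mult_cont(2) z(3)]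
    by (simp add: algebra_simps)
qed

end

section \<open>Dissipation from membership in \<open>Xi\<close>\<close>

lemma poly_fun2_triangle_continuous:
  assumes "poly_fun2 K" "continuous_on {0..1} z"
  shows "continuous_on {0..1} (\<lambda>x. integral {0..x} (\<lambda>\<xi>. K x \<xi> * z \<xi>))"
    and "x \<in> {0..1} \<Longrightarrow> (\<lambda>\<xi>. K x \<xi> * z \<xi>) integrable_on {0..x}"
proof -
  from assms(1) obtain n :: nat and f g where
    fg: "\<And>k. real_polynomial_function (f k)" "\<And>k. real_polynomial_function (g k)"
    and K: "\<And>x y. K x y = (\<Sum>k<n. f k x * g k y)" by (rule poly_fun2_separable) blast
  note c = poly_fun_continuous_on[OF fg(1)] poly_fun_continuous_on[OF fg(2)]
  have zc: "continuous_on {0..x} z" if "x \<in> {0..1}" for x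
    by (rule continuous_on_subset[OF assms(2)]) (use that in auto)
  show "x \<in> {0..1} \<Longrightarrow> (\<lambda>\<xi>. K x \<xi> * z \<xi>) integrable_on {0..x}"
    unfolding K by (intro integrable_continuous_real continuous_intros c zc)
  have "integral {0..x} (\<lambda>\<xi>. K x \<xi> * z \<xi>) = (\<Sum>k<n. f k x * integral {0..x} (\<lambda>\<xi>. g k \<xi> * z \<xi>))"
    if x: "x \<in> {0..1}" for x
  proof -
    have "integral {0..x} (\<lambda>\<xi>. K x \<xi> * z \<xi>) = integral {0..x} (\<lambda>\<xi>. \<Sum>k<n. f k x * (g k \<xi> * z \<xi>))"
      by (simp add: K sum_distrib_right mult.assoc)
    also have "\<dots> = (\<Sum>k<n. integral {0..x} (\<lambda>\<xi>. f k x * (g k \<xi> * z \<xi>)))"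
      by (rule integral_sum) (auto intro!: integrable_continuous_real continuous_intros c zc[OF x])
    finally show ?thesis by simp
  qed
  then show "continuous_on {0..1} (\<lambda>x. integral {0..x} (\<lambda>\<xi>. K x \<xi> * z \<xi>))"
    by (subst continuous_on_cong[OF refl])
      (auto intro!: continuous_intros c continuous_on_integral_upto assms(2))
qed

lemma qform_lincomb:
  assumes p: "real_polynomial_function M" "real_polynomial_function N" "poly_fun2 K" "poly_fun2 L"
    and z: "continuous_on {0..1} z"
  shows "qform (\<lambda>x. s * M x + r * N x) (\<lambda>x \<xi>. s * K x \<xi> + r * L x \<xi>) z = s * qform M K z + r * qform N L z"
proof -
  note c = poly_fun_continuous_on[OF p(1)] poly_fun_continuous_on[OF p(2)]
    poly_fun2_triangle_continuous(1)[OF p(3) z] poly_fun2_triangle_continuous(1)[OF p(4) z] z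
  have "ip z (\<lambda>x. (s * M x + r * N x) * z x) = ip z (\<lambda>x. s * (M x * z x) + r * (N x * z x))"
    by (simp add: distrib_right mult.assoc)
  also have "\<dots> = s * ip z (\<lambda>x. M x * z x) + r * ip z (\<lambda>x. N x * z x)"
    by (subst ip_add_right) (intro continuous_intros c | simp add: ip_scale_right)+
  finally have 1: "ip z (\<lambda>x. (s * M x + r * N x) * z x) = \<dots>" .
  have "ip z (\<lambda>x. integral {0..x} (\<lambda>\<xi>. (s * K x \<xi> + r * L x \<xi>) * z \<xi>))
      = ip z (\<lambda>x. s * integral {0..x} (\<lambda>\<xi>. K x \<xi> * z \<xi>) + r * integral {0..x} (\<lambda>\<xi>. L x \<xi> * z \<xi>))"
  proof (rule ip_cong[OF refl])
    fix x :: real assume x: "x \<in> {0..1}"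
    note i = poly_fun2_triangle_continuous(2)[OF p(3) z x] poly_fun2_triangle_continuous(2)[OF p(4) z x]
    have "integral {0..x} (\<lambda>\<xi>. (s * K x \<xi> + r * L x \<xi>) * z \<xi>)
        = integral {0..x} (\<lambda>\<xi>. s * (K x \<xi> * z \<xi>) + r * (L x \<xi> * z \<xi>))"
      by (simp add: distrib_right mult.assoc)
    also have "\<dots> = integral {0..x} (\<lambda>\<xi>. s * (K x \<xi> * z \<xi>)) + integral {0..x} (\<lambda>\<xi>. r * (L x \<xi> * z \<xi>))"
      by (intro integral_add integrable_on_mult_right i)
    finally show "integral {0..x} (\<lambda>\<xi>. (s * K x \<xi> + r * L x \<xi>) * z \<xi>)
      = s * integral {0..x} (\<lambda>\<xi>. K x \<xi> * z \<xi>) + r * integral {0..x} (\<lambda>\<xi>. L x \<xi> * z \<xi>)" by simp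
  qed
  also have "\<dots> = s * ip z (\<lambda>x. integral {0..x} (\<lambda>\<xi>. K x \<xi> * z \<xi>)) + r * ip z (\<lambda>x. integral {0..x} (\<lambda>\<xi>. L x \<xi> * z \<xi>))"
    by (subst ip_add_right) (intro continuous_intros c | simp add: ip_scale_right)+
  finally show ?thesis using 1 by (simp add: qform_def algebra_simps)
qed

text \<open>\<open>qform\<close> is linear in its data, and membership with 0 as first parameter
  makes the form belonging to \<open>- T - s * M\<close> nonnegative.\<close>

lemma Xi_dissipative:
  assumes X: "(M, K1, K2) \<in> Xi d1 d2 \<epsilon> \<epsilon>'"
    and Y: "(\<lambda>x. - T0 x - s * M x, \<lambda>x \<xi>. - T1 x \<xi> - s * K1 x \<xi>, T2) \<in> Xi d1 d2 0 \<beta>"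
    and z: "continuous_on {0..1} z"
  shows "qform T0 T1 z \<le> - s * qform M K1 z"
proof -
  have p: "real_polynomial_function (\<lambda>x. - T0 x - s * M x)" "real_polynomial_function M"
    "poly_fun2 (\<lambda>x \<xi>. - T1 x \<xi> - s * K1 x \<xi>)" "poly_fun2 K1"
    using X Y by (auto simp: Xi_def)
  have "qform T0 T1 z = - 1 * qform (\<lambda>x. - T0 x - s * M x) (\<lambda>x \<xi>. - T1 x \<xi> - s * K1 x \<xi>) z + (- s) * qform M K1 z"
    unfolding qform_lincomb[OF p z, symmetric] by (simp add: qform_def)
  then show ?thesis using Xi_coercive[OF Y _ z] by simp
qed

section \<open>Time derivatives of quadratic functionals\<close>

lemma uniform_limit_tendsto_const:
  assumes "(h \<longlongrightarrow> l) F"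
  shows "uniform_limit S (\<lambda>s x. h s) (\<lambda>x. l) F"
  by (rule uniform_limitI) (use tendstoD[OF assms] in \<open>auto elim!: eventually_mono\<close>)

text \<open>Differentiability in time at \<open>t\<close> with respect to the supremum norm on
  \<open>[0,1]\<close>; the uniformity in \<open>x\<close> lets limits be taken inside
  \<open>ip\<close>.\<close>

definition slice_deriv :: "(real \<Rightarrow> real \<Rightarrow> real) \<Rightarrow> (real \<Rightarrow> real) \<Rightarrow> real \<Rightarrow> bool" where
  "slice_deriv u ut t \<longleftrightarrow> (\<forall>\<^sub>F s in at t. continuous_on {0..1} (u s)) \<and> continuous_on {0..1} (u t) \<and>
     continuous_on {0..1} ut \<and> uniform_limit {0..1} (\<lambda>s x. (u s x - u t x) / (s - t)) ut (at t)"

lemma bounded_image01: "continuous_on {0..1} (h :: real \<Rightarrow> real) \<Longrightarrow> bounded (h ` {0..1})"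
  by (intro compact_imp_bounded compact_continuous_image compact_Icc)

lemma slice_deriv_limit:
  assumes "slice_deriv u ut t"
  shows "uniform_limit {0..1} u (u t) (at t)"
proof -
  have c: "continuous_on {0..1} ut" and q: "uniform_limit {0..1} (\<lambda>s x. (u s x - u t x) / (s - t)) ut (at t)"
    using assms by (auto simp: slice_deriv_def)
  have "((\<lambda>s. s - t) \<longlongrightarrow> t - t) (at t)" by (intro tendsto_intros)
  then have "uniform_limit {0..1} (\<lambda>s x. s - t) (\<lambda>x. 0) (at t)"
    by (intro uniform_limit_tendsto_const) simp
  from uniform_lim_mult[OF this q bounded_image01[OF continuous_on_const] bounded_image01[OF c]]
  have "uniform_limit {0..1} (\<lambda>s x. (s - t) * ((u s x - u t x) / (s - t))) (\<lambda>x. 0 * ut x) (at t)" .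
  from uniform_limit_add[OF this uniform_limit_const[where c = "u t"]]
  have "uniform_limit {0..1} (\<lambda>s x. (s - t) * ((u s x - u t x) / (s - t)) + u t x) (\<lambda>x. 0 * ut x + u t x) (at t)" .
  then show ?thesis
    by (rule uniform_limit_cong[THEN iffD1, rotated 2]) (auto simp: eventually_at_filter)
qed

lemma ip_slice_deriv:
  assumes u: "slice_deriv u ut t" and k: "continuous_on {0..1} k"
  shows "((\<lambda>s. ip k (u s)) has_real_derivative ip k ut) (at t)"
  unfolding has_field_derivative_iff
proof (rule Lim_transform_eventually)
  have c: "\<forall>\<^sub>F s in at t. continuous_on {0..1} (u s)" "continuous_on {0..1} (u t)" "continuous_on {0..1} ut"
    and q: "uniform_limit {0..1} (\<lambda>s x. (u s x - u t x) / (s - t)) ut (at t)"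
    using u by (auto simp: slice_deriv_def)
  have ne: "\<forall>\<^sub>F s in at t. s - t \<noteq> 0" by (simp add: eventually_at_filter)
  then show "\<forall>\<^sub>F s in at t. ip k (\<lambda>x. (u s x - u t x) / (s - t)) = (ip k (u s) - ip k (u t)) / (s - t)"
    using c(1)
  proof eventually_elim
    case (elim s)
    have "ip k (\<lambda>x. (u s x - u t x) / (s - t)) = ip k (\<lambda>x. (1 / (s - t)) * (u s x - u t x))" by simp
    also have "\<dots> = (1 / (s - t)) * (ip k (u s) - ip k (u t))"
      unfolding ip_scale_right by (subst ip_diff_right[OF elim(2) c(2) k]) simp
    finally show ?case by simp
  qed
  show "((\<lambda>s. ip k (\<lambda>x. (u s x - u t x) / (s - t))) \<longlongrightarrow> ip k ut) (at t)"
  proof (rule ip_uniform_limit[OF uniform_limit_const q _ _ k c(3)])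
    show "\<forall>\<^sub>F s in at t. continuous_on {0..1} (\<lambda>x. (u s x - u t x) / (s - t))"
      using ne c(1) by eventually_elim (auto intro!: continuous_intros c(2))
  qed (use k in auto)
qed

text \<open>With \<open>q\<close> the difference quotient of \<open>u\<close>, that of the quadratic
  functional is \<open>\<langle>q - ut, B u(s)\<rangle> + \<langle>B ut, u(s)\<rangle> + \<langle>B
  u(t), q\<rangle>\<close>. Symmetry has moved \<open>B\<close> onto functions independent of
  \<open>s\<close>, and the first summand tends to 0 by Cauchy-Schwarz and the bound on
  \<open>B\<close>, so no limit of \<open>B (u s)\<close> itself is taken. It is applied to the
  identity, \<open>pop\<close> and \<open>pinv\<close>.\<close>

lemma quadratic_slice_deriv:
  assumes u: "slice_deriv u ut t"
    and Bc: "\<And>v. continuous_on {0..1} v \<Longrightarrow> continuous_on {0..1} (B v)"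
    and Bs: "\<And>v w. continuous_on {0..1} v \<Longrightarrow> continuous_on {0..1} w \<Longrightarrow> ip (B v) w = ip v (B w)"
    and Bb: "\<And>v. continuous_on {0..1} v \<Longrightarrow> ip (B v) (B v) \<le> C * ip v v"
  shows "((\<lambda>s. ip (u s) (B (u s))) has_real_derivative 2 * ip ut (B (u t))) (at t)"
  unfolding has_field_derivative_iff
proof (rule Lim_transform_eventually)
  let ?q = "\<lambda>s x. (u s x - u t x) / (s - t)"
  have c: "\<forall>\<^sub>F s in at t. continuous_on {0..1} (u s)" "continuous_on {0..1} (u t)" "continuous_on {0..1} ut"
    and q: "uniform_limit {0..1} ?q ut (at t)"
    using u by (auto simp: slice_deriv_def)
  have ne: "\<forall>\<^sub>F s in at t. s - t \<noteq> 0" by (simp add: eventually_at_filter)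
  have qc: "\<forall>\<^sub>F s in at t. continuous_on {0..1} (?q s)"
    using ne c(1) by eventually_elim (auto intro!: continuous_intros c(2))
  show "\<forall>\<^sub>F s in at t. ip (\<lambda>x. ?q s x - ut x) (B (u s)) + ip (B ut) (u s) + ip (B (u t)) (?q s)
      = (ip (u s) (B (u s)) - ip (u t) (B (u t))) / (s - t)"
    using ne c(1) qc
  proof eventually_elim
    case (elim s)
    have "ip (\<lambda>x. ?q s x - ut x) (B (u s)) + ip (B ut) (u s) = ip (?q s) (B (u s))"
      by (subst ip_diff_left[OF elim(3) c(3) Bc[OF elim(2)]]) (simp add: Bs c elim)
    moreover have "ip (?q s) w = (ip (u s) w - ip (u t) w) / (s - t)" if "continuous_on {0..1} w" for w
    proof -
      have "ip (?q s) w = ip (\<lambda>x. (1 / (s - t)) * (u s x - u t x)) w" by simp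
      also have "\<dots> = (1 / (s - t)) * (ip (u s) w - ip (u t) w)"
        unfolding ip_scale_left by (subst ip_diff_left[OF elim(2) c(2) that]) simp
      finally show ?thesis by simp
    qed
    moreover have "ip (u t) (B (u s)) = ip (u s) (B (u t))"
      using Bs[OF elim(2) c(2)] by (simp add: ip_commute)
    ultimately show ?case
      by (simp add: ip_commute[of "B (u t)"] Bc c elim diff_divide_distrib)
  qed
  have ul: "uniform_limit {0..1} u (u t) (at t)" by (rule slice_deriv_limit[OF u])
  have 1: "((\<lambda>s. ip (\<lambda>x. ?q s x - ut x) (B (u s))) \<longlongrightarrow> 0) (at t)"
  proof (rule Lim_null_comparison)
    have d: "((\<lambda>s. ip (\<lambda>x. ?q s x - ut x) (\<lambda>x. ?q s x - ut x)) \<longlongrightarrow> ip (\<lambda>x. ut x - ut x) (\<lambda>x. ut x - ut x)) (at t)"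
      by (intro ip_uniform_limit uniform_limit_minus q uniform_limit_const; (rule eventually_mono[OF qc])?)
        (auto intro!: continuous_intros c)
    have "((\<lambda>s. ip (u s) (u s)) \<longlongrightarrow> ip (u t) (u t)) (at t)"
      by (intro ip_uniform_limit ul c)
    from tendsto_mult[OF d tendsto_mult[OF tendsto_const[of C] this]]
    have "((\<lambda>s. sqrt (ip (\<lambda>x. ?q s x - ut x) (\<lambda>x. ?q s x - ut x) * (C * ip (u s) (u s)))) \<longlongrightarrow> sqrt 0) (at t)"
      by (intro tendsto_real_sqrt) (simp add: ip_def)
    then show "((\<lambda>s. sqrt (ip (\<lambda>x. ?q s x - ut x) (\<lambda>x. ?q s x - ut x) * (C * ip (u s) (u s)))) \<longlongrightarrow> 0) (at t)" by simp
    show "\<forall>\<^sub>F s in at t. norm (ip (\<lambda>x. ?q s x - ut x) (B (u s)))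
        \<le> sqrt (ip (\<lambda>x. ?q s x - ut x) (\<lambda>x. ?q s x - ut x) * (C * ip (u s) (u s)))"
      using c(1) qc
    proof eventually_elim
      case (elim s)
      have "(ip (\<lambda>x. ?q s x - ut x) (B (u s)))\<^sup>2 \<le> ip (\<lambda>x. ?q s x - ut x) (\<lambda>x. ?q s x - ut x) * ip (B (u s)) (B (u s))"
        by (intro ip_cauchy_schwarz continuous_intros elim c Bc)
      also have "\<dots> \<le> ip (\<lambda>x. ?q s x - ut x) (\<lambda>x. ?q s x - ut x) * (C * ip (u s) (u s))"
        by (intro mult_left_mono Bb elim ip_nonneg)
      finally show ?case by (simp add: real_le_rsqrt)
    qed
  qed
  have 2: "((\<lambda>s. ip (B ut) (u s)) \<longlongrightarrow> ip (B ut) (u t)) (at t)"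
    by (intro ip_uniform_limit uniform_limit_const ul c Bc) (simp add: Bc c)
  have 3: "((\<lambda>s. ip (B (u t)) (?q s)) \<longlongrightarrow> ip (B (u t)) ut) (at t)"
    by (intro ip_uniform_limit uniform_limit_const q c Bc qc) (simp add: Bc c)
  have "((\<lambda>s. ip (\<lambda>x. ?q s x - ut x) (B (u s)) + ip (B ut) (u s) + ip (B (u t)) (?q s)) \<longlongrightarrow>
     0 + ip (B ut) (u t) + ip (B (u t)) ut) (at t)"
    by (intro tendsto_add 1 2 3)
  also have "0 + ip (B ut) (u t) + ip (B (u t)) ut = 2 * ip ut (B (u t))"
    by (simp add: Bs c ip_commute)
  finally show "((\<lambda>s. ip (\<lambda>x. ?q s x - ut x) (B (u s)) + ip (B ut) (u s) + ip (B (u t)) (?q s)) \<longlongrightarrow> 2 * ip ut (B (u t))) (at t)" .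
qed

lemma slice_deriv_diff:
  assumes "slice_deriv u ut t" "slice_deriv v vt t"
  shows "slice_deriv (\<lambda>s x. u s x - v s x) (\<lambda>x. ut x - vt x) t"
proof -
  have "uniform_limit {0..1} (\<lambda>s x. (u s x - u t x) / (s - t) - (v s x - v t x) / (s - t)) (\<lambda>x. ut x - vt x) (at t)"
    using assms by (intro uniform_limit_minus) (auto simp: slice_deriv_def)
  also have "(\<lambda>s x. (u s x - u t x) / (s - t) - (v s x - v t x) / (s - t))
      = (\<lambda>s x. (u s x - v s x - (u t x - v t x)) / (s - t))"
    by (simp add: fun_eq_iff diff_divide_distrib[symmetric] algebra_simps)
  finally show ?thesis
    using assms by (auto simp: slice_deriv_def intro!: continuous_intros elim: eventually_elim2)
qed

lemma slice_deriv_scale: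
  assumes k: "(k has_real_derivative k') (at t)" and \<psi>: "continuous_on {0..1} \<psi>"
  shows "slice_deriv (\<lambda>s x. k s * \<psi> x) (\<lambda>x. k' * \<psi> x) t"
proof -
  have "uniform_limit {0..1} (\<lambda>s x. ((k s - k t) / (s - t)) * \<psi> x) (\<lambda>x. k' * \<psi> x) (at t)"
    by (intro uniform_lim_mult uniform_limit_tendsto_const uniform_limit_const bounded_image01[OF \<psi>] bounded_image01[OF continuous_on_const])
      (use k in \<open>auto simp: has_field_derivative_iff\<close>)
  then show ?thesis
    by (simp add: slice_deriv_def left_diff_distrib[symmetric] continuous_intros \<psi>)
qed

section \<open>Classical solutions as curves of continuous functions\<close>

lemma classicalD:
  assumes "classical w"
  shows "x \<in> {0..1} \<Longrightarrow> 0 < t \<Longrightarrow> w x differentiable at t"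
    "x \<in> {0..1} \<Longrightarrow> 0 < t \<Longrightarrow> (\<lambda>s. w s t) differentiable at x within {0..1}"
    "x \<in> {0..1} \<Longrightarrow> 0 < t \<Longrightarrow> (\<lambda>s. dx w s t) differentiable at x within {0..1}"
    "continuous_on ({0..1} \<times> {0<..}) (\<lambda>(x, t). w x t)"
    "continuous_on ({0..1} \<times> {0<..}) (\<lambda>(x, t). dt w x t)"
    "continuous_on ({0..1} \<times> {0<..}) (\<lambda>(x, t). dx w x t)"
    "continuous_on ({0..1} \<times> {0<..}) (\<lambda>(x, t). dx (dx w) x t)"
  using assms unfolding classical_def by blast+

lemma classical_slices:
  assumes "classical w" and t: "0 < t"
  shows "C2_on01 (\<lambda>x. w x t) (\<lambda>x. dx w x t) (\<lambda>x. dx (dx w) x t)"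
    and "continuous_on {0..1} (\<lambda>x. dt w x t)"
proof -
  have sl: "continuous_on {0..1} (\<lambda>x. h x t)" if "continuous_on ({0..1} \<times> {0<..}) (\<lambda>(x, t). h x t)" for h :: "real \<Rightarrow> real \<Rightarrow> real"
  proof -
    have "continuous_on {0..1} (\<lambda>x. (x, t))" by (intro continuous_intros)
    from continuous_on_compose2[OF that this] t show ?thesis by auto
  qed
  show "C2_on01 (\<lambda>x. w x t) (\<lambda>x. dx w x t) (\<lambda>x. dx (dx w) x t)"
    unfolding C2_on01_def
  proof (intro conjI ballI)
    fix x :: real assume "x \<in> {0..1}"
    then have d: "(\<lambda>s. w s t) differentiable at x within {0..1}" "(\<lambda>s. dx w s t) differentiable at x within {0..1}"
      using classicalD(2,3)[OF assms(1) _ t] by blast+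
    show "((\<lambda>x. w x t) has_real_derivative dx w x t) (at x within {0..1})"
      unfolding dx_def D01_def has_real_derivative_iff_has_vector_derivative
      using d(1) by (rule vector_derivative_works[THEN iffD1])
    show "((\<lambda>x. dx w x t) has_real_derivative dx (dx w) x t) (at x within {0..1})"
      unfolding dx_def[of "dx w" x t] D01_def has_real_derivative_iff_has_vector_derivative
      using d(2) by (rule vector_derivative_works[THEN iffD1])
  qed (rule sl[OF classicalD(7)[OF assms(1)]])
  show "continuous_on {0..1} (\<lambda>x. dt w x t)" by (rule sl[OF classicalD(5)[OF assms(1)]])
qed

text \<open>The mean value theorem in time replaces the quotient by a value of the time derivative
  at a nearby time; uniform continuity on the compact set \<open>[0,1] \<times> [t/2, 2t]\<close>
  makes the limit uniform in \<open>x\<close>.\<close>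

lemma classical_slice_deriv:
  assumes w: "classical w" and t: "0 < t"
  shows "slice_deriv (\<lambda>s x. w x s) (\<lambda>x. dt w x t) t"
  unfolding slice_deriv_def
proof (intro conjI)
  have "\<forall>\<^sub>F s in at t. 0 < s" using t by (intro order_tendstoD(1)[OF tendsto_ident_at]) auto
  then show "\<forall>\<^sub>F s in at t. continuous_on {0..1} (\<lambda>x. w x s)"
    by eventually_elim (use C2_on01D(3)[OF classical_slices(1)[OF w]] in blast)
  show "continuous_on {0..1} (\<lambda>x. w x t)" using C2_on01D(3)[OF classical_slices(1)[OF w t]] .
  show "continuous_on {0..1} (\<lambda>x. dt w x t)" using classical_slices(2)[OF w t] .
  show "uniform_limit {0..1} (\<lambda>s x. (w x s - w x t) / (s - t)) (\<lambda>x. dt w x t) (at t)"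
  proof (rule uniform_limitI)
    fix e :: real assume e: "0 < e"
    let ?R = "{0..1} \<times> {t/2..2*t}"
    have "continuous_on ?R (\<lambda>(x, t). dt w x t)"
      by (rule continuous_on_subset[OF classicalD(5)[OF w]]) (use t in auto)
    then have "uniformly_continuous_on ?R (\<lambda>(x, t). dt w x t)"
      by (intro compact_uniformly_continuous compact_Times) auto
    then obtain d where d: "0 < d" "\<And>p p'. p \<in> ?R \<Longrightarrow> p' \<in> ?R \<Longrightarrow> dist p' p < d \<Longrightarrow>
        dist (case p' of (x, t) \<Rightarrow> dt w x t) (case p of (x, t) \<Rightarrow> dt w x t) < e"
      unfolding uniformly_continuous_on_def using e by metis
    have D: "(w x has_real_derivative dt w x r) (at r)" if "x \<in> {0..1}" "0 < r" for x r
    proof -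
      have "w x differentiable at r" using classicalD(1)[OF w that] .
      then show ?thesis
        unfolding dt_def has_real_derivative_iff_has_vector_derivative by (simp add: vector_derivative_works[symmetric])
    qed
    have main: "dist ((w x s - w x t) / (s - t)) (dt w x t) < e"
      if s: "s \<noteq> t" "\<bar>s - t\<bar> < min d (t/2)" and x: "x \<in> {0..1}" for s x
    proof -
      obtain r where r: "\<bar>r - t\<bar> < \<bar>s - t\<bar>" "w x s - w x t = (s - t) * dt w x r"
      proof (cases "s < t")
        case True
        have "\<And>r. s \<le> r \<Longrightarrow> r \<le> t \<Longrightarrow> (w x has_real_derivative dt w x r) (at r)"
          using D[OF x] s True t by auto
        from MVT2[OF True this] obtain r where "s < r" "r < t" "w x t - w x s = (t - s) * dt w x r" by blast
        then show ?thesis by (intro that[of r]) (auto simp: algebra_simps)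
      next
        case False
        then have ts: "t < s" using s by simp
        have "\<And>r. t \<le> r \<Longrightarrow> r \<le> s \<Longrightarrow> (w x has_real_derivative dt w x r) (at r)"
          using D[OF x] t by auto
        from MVT2[OF ts this] obtain r where "t < r" "r < s" "w x s - w x t = (s - t) * dt w x r" by blast
        then show ?thesis by (intro that[of r]) auto
      qed
      have "t / 2 \<le> r" "r \<le> 2 * t" using r(1) s t unfolding abs_less_iff min_less_iff_conj by linarith+
      then have "dist (dt w x r) (dt w x t) < e"
        using d(2)[of "(x, t)" "(x, r)"] r(1) s x t by (auto simp: dist_Pair_Pair dist_real_def)
      then show ?thesis using r(2) s by simp
    qed
    have "\<forall>\<^sub>F s in at t. s \<noteq> t \<and> \<bar>s - t\<bar> < min d (t/2)"
      unfolding eventually_at using d(1) t by (intro exI[of _ "min d (t/2)"]) (auto simp: dist_real_def)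
    then show "\<forall>\<^sub>F s in at t. \<forall>x\<in>{0..1}. dist ((w x s - w x t) / (s - t)) (dt w x t) < e"
      by eventually_elim (use main in blast)
  qed
qed

section \<open>Decay estimates\<close>

lemma D01_eq:
  assumes "(u has_real_derivative d) (at x within {0..1})" "x \<in> {0..1}"
  shows "D01 u x = d"
  unfolding D01_def
  by (rule vector_derivative_within_closed_interval)
    (use assms in \<open>auto simp: has_real_derivative_iff_has_vector_derivative\<close>)

lemma ip_mult_bound:
  assumes h: "continuous_on {0..1} h" and v: "continuous_on {0..1} v" and B: "\<And>x. x \<in> {0..1} \<Longrightarrow> \<bar>h x\<bar> \<le> B"
  shows "ip (\<lambda>x. h x * v x) (\<lambda>x. h x * v x) \<le> B\<^sup>2 * ip v v"
proof -
  have "ip (\<lambda>x. h x * v x) (\<lambda>x. h x * v x) \<le> ip (\<lambda>x. B * v x) (\<lambda>x. B * v x)"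
  proof (rule ip_mono)
    fix x :: real assume "x \<in> {0..1}"
    then have "(h x)\<^sup>2 \<le> B\<^sup>2" using B by (metis abs_ge_zero power2_abs power_mono)
    then have "(h x)\<^sup>2 * (v x)\<^sup>2 \<le> B\<^sup>2 * (v x)\<^sup>2" by (rule mult_right_mono) simp
    then show "h x * v x * (h x * v x) \<le> B * v x * (B * v x)" by (simp add: power2_eq_square algebra_simps)
  qed (intro continuous_intros h v)+
  also have "\<dots> = B\<^sup>2 * ip v v" by (simp only: ip_scale_left ip_scale_right power2_eq_square mult.assoc)
  finally show ?thesis .
qed

lemma power2_sum3_le: "((x::real) + y + z)\<^sup>2 \<le> 3 * (x\<^sup>2 + y\<^sup>2 + z\<^sup>2)"
proof -
  have "0 \<le> (x - y)\<^sup>2 + (y - z)\<^sup>2 + (x - z)\<^sup>2" by simp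
  then show ?thesis by (simp add: power2_eq_square algebra_simps)
qed

lemma power2_sum4_le: "((w::real) + x + y + z)\<^sup>2 \<le> 4 * (w\<^sup>2 + x\<^sup>2 + y\<^sup>2 + z\<^sup>2)"
proof -
  have "0 \<le> (w - x)\<^sup>2 + (w - y)\<^sup>2 + (w - z)\<^sup>2 + (x - y)\<^sup>2 + (y - z)\<^sup>2 + (x - z)\<^sup>2" by simp
  then show ?thesis by (simp add: power2_eq_square algebra_simps)
qed

section \<open>Bounds for the inverse\<close>

context semiseparable
begin

text \<open>Coercivity, and Young's inequality with weight \<open>\<epsilon>\<close>, which uses up
  half of the coercive term.\<close>

lemma pinv_bound:
  assumes h: "continuous_on {0..1} h"
  shows "ip (pinv h) (pinv h) \<le> (1 / \<epsilon>\<^sup>2) * ip h h"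
proof -
  note p = pinv_cont[OF h]
  have "ip (pinv h) (pop (pinv h)) = ip (pinv h) h" by (rule ip_cong) (simp_all add: pop_pinv[OF h])
  then have "\<epsilon> * ip (pinv h) (pinv h) \<le> ip (pinv h) h" using pop_coercive[OF p] by simp
  moreover have "2 * \<bar>ip (pinv h) h\<bar> \<le> \<epsilon> * ip (pinv h) (pinv h) + ip h h / \<epsilon>" by (rule ip_young[OF p h eps])
  ultimately have "\<epsilon> * ip (pinv h) (pinv h) \<le> ip h h / \<epsilon>" by linarith
  then show ?thesis using eps by (simp add: field_simps power2_eq_square)
qed

lemma pinv_sym:
  assumes h: "continuous_on {0..1} h" and l: "continuous_on {0..1} l"
  shows "ip (pinv h) l = ip h (pinv l)"
proof -
  have "ip (pinv h) l = ip (pinv h) (pop (pinv l))" by (rule ip_cong) (simp_all add: pop_pinv[OF l])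
  also have "\<dots> = ip (pop (pinv h)) (pinv l)" by (rule pop_sym[OF pinv_cont[OF h] pinv_cont[OF l], symmetric])
  also have "\<dots> = ip h (pinv l)" by (rule ip_cong) (simp_all add: pop_pinv[OF h])
  finally show ?thesis .
qed

text \<open>The differentiated equation gives \<open>M 1 * z' 1\<close> in terms of
  \<open>h' 1\<close>, \<open>pinv h 1\<close> and an integral term. Eliminating
  \<open>pinv h 1\<close> by the equation itself leaves \<open>h 1\<close> and integral terms, which
  the \<open>L\<^sub>2\<close> norm of \<open>h\<close> controls. It is applied to the error, whose
  traces at 1 are dissipated.\<close>

lemma pinv_boundary_deriv:
  obtains C where "0 \<le> C"
    "\<And>h h' h'' z' z''. C2_on01 h h' h'' \<Longrightarrow> C2_on01 (pinv h) z' z'' \<Longrightarrow> (z' 1)\<^sup>2 \<le> C * ((h 1)\<^sup>2 + (h' 1)\<^sup>2 + ip h h)"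
proof -
  obtain C where C: "0 < C" "\<And>z x. continuous_on {0..1} z \<Longrightarrow> x \<in> {0..1} \<Longrightarrow> \<bar>kop z x\<bar> \<le> C * sqrt (ip z z)"
    "\<And>z k x. k < n \<Longrightarrow> continuous_on {0..1} z \<Longrightarrow> x \<in> {0..1} \<Longrightarrow> \<bar>lower k z x\<bar> \<le> C * sqrt (ip z z)"
    by (rule kop_bound) blast
  define F where "F = (\<Sum>k<n. \<bar>deriv (f k) 1\<bar>)"
  define m where "m = deriv M 1 / M 1"
  have F0: "0 \<le> F" unfolding F_def by (intro sum_nonneg) simp
  define A where "A = 1 + \<bar>m\<bar>"
  define G where "G = (F * C + \<bar>m\<bar> * C) / \<epsilon>"
  \<comment> \<open>The factor 3 comes from squaring a sum of three terms;
    \<open>1 + \<bar>m\<bar> + G\<close> dominates the coefficient of each.\<close>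
  define D where "D = 3 * (1 + \<bar>m\<bar> + G)\<^sup>2 / (M 1)\<^sup>2"
  have G0: "0 \<le> G" using F0 C(1) eps by (simp add: G_def)
  show thesis
  proof (rule that[of D])
    show "0 \<le> D" by (simp add: D_def)
    fix h h' h'' z' z'' assume h: "C2_on01 h h' h''" and z: "C2_on01 (pinv h) z' z''"
    let ?z = "pinv h"
    note hc = C2_on01D[OF h] and zc = C2_on01D[OF z]
    have one: "(1::real) \<in> {0..1}" by simp
    have d: "(pop ?z has_real_derivative pop' ?z z' 1) (at 1 within {0..1})"
      using C2_on01D(1)[OF pop_C2[OF z] one] .
    have "(h has_real_derivative pop' ?z z' 1) (at 1 within {0..1})"
      by (rule has_field_derivative_transform_within[OF d, where d = 1]) (auto simp: pop_pinv[OF hc(3)])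
    then have h'1: "h' 1 = pop' ?z z' 1" using D01_eq[OF _ one] hc(1)[OF one] by metis
    have h1: "h 1 = M 1 * ?z 1 + kop ?z 1" using pop_pinv[OF hc(3) one] by (simp add: pop_def)
    have z1: "M 1 * z' 1 = h' 1 - m * h 1 + (m * kop ?z 1 - kop' ?z 1)"
      using h1 h'1 M_pos[of 1] by (simp add: pop'_def m_def field_simps)
    have sq: "sqrt (ip ?z ?z) \<le> sqrt (ip h h) / \<epsilon>"
    proof -
      have "sqrt (ip ?z ?z) \<le> sqrt ((1 / \<epsilon>\<^sup>2) * ip h h)" by (rule real_sqrt_le_mono[OF pinv_bound[OF hc(3)]])
      also have "\<dots> = sqrt (ip h h) / \<epsilon>" using eps by (simp add: real_sqrt_mult real_sqrt_divide)
      finally show ?thesis .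
    qed
    have "\<bar>kop' ?z 1\<bar> \<le> (\<Sum>k<n. \<bar>deriv (f k) 1 * lower k ?z 1\<bar>)" unfolding kop_ends by (rule sum_abs)
    also have "\<dots> \<le> (\<Sum>k<n. \<bar>deriv (f k) 1\<bar> * (C * sqrt (ip ?z ?z)))"
      by (intro sum_mono) (auto simp: abs_mult intro!: mult_left_mono C(3) zc)
    also have "\<dots> = F * C * sqrt (ip ?z ?z)" by (simp add: F_def sum_distrib_right mult.assoc)
    finally have k': "\<bar>kop' ?z 1\<bar> \<le> F * C * sqrt (ip ?z ?z)" .
    have "\<bar>m * kop ?z 1 - kop' ?z 1\<bar> \<le> \<bar>m\<bar> * \<bar>kop ?z 1\<bar> + \<bar>kop' ?z 1\<bar>"
      by (metis abs_mult abs_triangle_ineq4)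
    also have "\<dots> \<le> \<bar>m\<bar> * (C * sqrt (ip ?z ?z)) + F * C * sqrt (ip ?z ?z)"
      by (intro add_mono mult_left_mono C(2) zc k') auto
    also have "\<dots> = (F * C + \<bar>m\<bar> * C) * sqrt (ip ?z ?z)" by (simp add: algebra_simps)
    also have "\<dots> \<le> (F * C + \<bar>m\<bar> * C) * (sqrt (ip h h) / \<epsilon>)"
      using sq F0 C(1) by (intro mult_left_mono) auto
    also have "\<dots> = G * sqrt (ip h h)" by (simp add: G_def)
    finally have "\<bar>m * kop ?z 1 - kop' ?z 1\<bar> \<le> G * sqrt (ip h h)" .
    from power_mono[OF this abs_ge_zero, of 2]
    have g: "(m * kop ?z 1 - kop' ?z 1)\<^sup>2 \<le> G\<^sup>2 * ip h h"
      using ip_nonneg[of h] by (simp add: power_mult_distrib)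
    have sqs: "1 \<le> (1 + \<bar>m\<bar> + G)\<^sup>2" "m\<^sup>2 \<le> (1 + \<bar>m\<bar> + G)\<^sup>2" "G\<^sup>2 \<le> (1 + \<bar>m\<bar> + G)\<^sup>2"
      using G0 power_mono[of 1 "1 + \<bar>m\<bar> + G" 2] power_mono[of "\<bar>m\<bar>" "1 + \<bar>m\<bar> + G" 2] power_mono[of G "1 + \<bar>m\<bar> + G" 2]
      by auto
    have "(M 1)\<^sup>2 * (z' 1)\<^sup>2 = (h' 1 + (- m * h 1) + (m * kop ?z 1 - kop' ?z 1))\<^sup>2"
      using z1 by (metis power_mult_distrib diff_conv_add_uminus mult_minus_left)
    also have "\<dots> \<le> 3 * ((h' 1)\<^sup>2 + (- m * h 1)\<^sup>2 + (m * kop ?z 1 - kop' ?z 1)\<^sup>2)" by (rule power2_sum3_le)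
    also have "\<dots> \<le> 3 * (1 * (h' 1)\<^sup>2 + m\<^sup>2 * (h 1)\<^sup>2 + G\<^sup>2 * ip h h)"
      using g by (simp add: power_mult_distrib)
    also have "\<dots> \<le> 3 * ((1 + \<bar>m\<bar> + G)\<^sup>2 * (h' 1)\<^sup>2 + (1 + \<bar>m\<bar> + G)\<^sup>2 * (h 1)\<^sup>2 + (1 + \<bar>m\<bar> + G)\<^sup>2 * ip h h)"
      using ip_nonneg[of h] sqs by (intro mult_left_mono add_mono mult_right_mono) auto
    also have "\<dots> = (M 1)\<^sup>2 * (D * ((h 1)\<^sup>2 + (h' 1)\<^sup>2 + ip h h))"
    proof -
      have D: "3 * (1 + \<bar>m\<bar> + G)\<^sup>2 = (M 1)\<^sup>2 * D" using M_pos[of 1] by (simp add: D_def)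
      have E: "3 * (p * u + p * v + p * w) = (3 * p) * (v + u + w)" for p u v w :: real
        by (simp add: algebra_simps)
      show ?thesis unfolding E[of "(1 + \<bar>m\<bar> + G)\<^sup>2"] D by (simp only: mult.assoc)
    qed
    finally show "(z' 1)\<^sup>2 \<le> D * ((h 1)\<^sup>2 + (h' 1)\<^sup>2 + ip h h)"
      using M_pos[of 1] by simp
  qed
qed

end

section \<open>Estimates for the error and for the state\<close>

context lyapunov_data
begin

text \<open>Pairing with \<open>pop e\<close> turns \<open>pinv R1\<close> back into
  \<open>R1\<close>, and \<open>R1\<close> is made so that \<open>2 * e' 1 * ip R1 e\<close> cancels
  the integral terms at 1 left by \<open>observer_dissipation\<close> once
  \<open>e 1 = O2 * e' 1\<close> is inserted. What remains at 1 is
  \<open>O2\<^sup>2 * (Q5 + Q7 / O2)\<close> times \<open>(e' 1)\<^sup>2\<close>, with a negative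
  coefficient.\<close>

lemma observer_decay:
  assumes \<delta>: "0 < \<delta>" and R1: "continuous_on {0..1} R1" and O2: "O2 < 0"
    and neg: "\<And>z. continuous_on {0..1} z \<Longrightarrow>
      qform (\<lambda>x. obs_mult x - pi\<^sup>2 / 2 * \<alpha> * \<epsilon>) obs_kernel z \<le> - 2 * \<delta> * ip z (pop z)"
    and Q3: "(deriv a 0 - b 0) * M 0 + a 0 * deriv M 0 - pi\<^sup>2 / 2 * \<alpha> * \<epsilon> \<le> 0"
    and Q4: "\<And>x. 2 * (deriv a 0 - b 0) * (\<Sum>k<n. g k 0 * f k x) + 2 * a 0 * (\<Sum>k<n. deriv (g k) 0 * f k x)
        + pi\<^sup>2 * \<alpha> * \<epsilon> = 0"
    and Q57: "((b 1 - deriv a 1) * M 1 - a 1 * deriv M 1) + 1 / O2 * (2 * a 1 * M 1) < 0"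
    and R1_eq: "\<And>x. R1 x = - 1 / 2 * (O2 * (2 * (b 1 - deriv a 1) * (\<Sum>k<n. f k 1 * g k x)
        - 2 * a 1 * (\<Sum>k<n. deriv (f k) 1 * g k x)) + 2 * a 1 * (\<Sum>k<n. f k 1 * g k x))"
  obtains \<kappa> C where "0 < \<kappa>" "0 \<le> C"
    "\<And>e e' e'' et \<phi>. C2_on01 e e' e'' \<Longrightarrow> e' 0 = 0 \<Longrightarrow> e 1 = O2 * e' 1 \<Longrightarrow> continuous_on {0..1} \<phi> \<Longrightarrow>
      (\<And>x. x \<in> {0..1} \<Longrightarrow> et x = gen e e' e'' x + pinv R1 x * e' 1 - \<phi> x) \<Longrightarrow>
      2 * ip et (pop e) \<le> - \<kappa> * ip e e - \<kappa> * (e' 1)\<^sup>2 + C * ip \<phi> \<phi>"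
proof -
  obtain B where B: "0 < B" "\<And>z. continuous_on {0..1} z \<Longrightarrow> ip (pop z) (pop z) \<le> B * ip z z"
    by (rule pop_bound) blast
  define Q where "Q = - (O2\<^sup>2 * (((b 1 - deriv a 1) * M 1 - a 1 * deriv M 1) + 1 / O2 * (2 * a 1 * M 1)))"
  have Q: "0 < Q" using Q57 O2 by (simp add: Q_def mult_pos_neg)
  define \<kappa> where "\<kappa> = min Q (\<delta> * \<epsilon>)"
  \<comment> \<open>With this Young weight the disturbance uses up half of the decay
    \<open>2 * \<delta>\<close>, after the bound \<open>B\<close> on the operator and coercivity;
    the other half gives the stated decay of \<open>ip e e\<close>.\<close>
  define s where "s = \<delta> * \<epsilon> / B"
  have s: "0 < s" "s * B = \<delta> * \<epsilon>" using \<delta> eps B by (simp_all add: s_def)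
  have oc: "continuous_on {0..1} (pinv R1)" by (rule pinv_cont[OF R1])
  show thesis
  proof (rule that[of \<kappa> "1 / s"])
    show "0 < \<kappa>" using Q \<delta> eps by (simp add: \<kappa>_def)
    show "0 \<le> 1 / s" using s by simp
    fix e e' e'' et \<phi> assume C2: "C2_on01 e e' e''" and e0: "e' 0 = 0" and e1: "e 1 = O2 * e' 1"
      and \<phi>: "continuous_on {0..1} \<phi>" and et: "\<And>x. x \<in> {0..1} \<Longrightarrow> et x = gen e e' e'' x + pinv R1 x * e' 1 - \<phi> x"
    note e = C2_on01D[OF C2]
    have pc: "continuous_on {0..1} (pop e)" by (rule pop_cont[OF e(3)])
    have gc: "continuous_on {0..1} (gen e e' e'')" by (rule gen_cont[OF C2])
    have "ip et (pop e) = ip (\<lambda>x. gen e e' e'' x + e' 1 * pinv R1 x - \<phi> x) (pop e)"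
      by (rule ip_cong) (simp_all add: et)
    also have "\<dots> = ip (gen e e' e'') (pop e) + e' 1 * ip (pinv R1) (pop e) - ip \<phi> (pop e)"
      by (subst ip_diff_left ip_add_left, (intro continuous_intros gc oc \<phi> pc)+)+ (simp add: ip_scale_left)
    also have "ip (pinv R1) (pop e) = ip R1 e"
    proof -
      have "ip (pinv R1) (pop e) = ip (pop (pinv R1)) e" by (rule pop_sym[OF oc e(3), symmetric])
      also have "\<dots> = ip R1 e" by (rule ip_cong) (simp_all add: pop_pinv[OF R1])
      finally show ?thesis .
    qed
    finally have 1: "2 * ip et (pop e) = 2 * ip (pop e) (gen e e' e'') + 2 * e' 1 * ip R1 e - 2 * ip \<phi> (pop e)"
      by (simp add: ip_commute algebra_simps)
    have R: "2 * ip R1 e = - (O2 * (2 * (b 1 - deriv a 1) * kop e 1 - 2 * a 1 * kop' e 1) + 2 * a 1 * kop e 1)"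
    proof -
      let ?r = "\<lambda>k. - 1 / 2 * (O2 * (2 * (b 1 - deriv a 1) * f k 1 - 2 * a 1 * deriv (f k) 1) + 2 * a 1 * f k 1)"
      have "R1 x = (\<Sum>k<n. ?r k * g k x)" for x
        unfolding R1_eq
        by (simp add: sum_distrib_left sum_distrib_right sum_subtractf sum.distrib sum_negf algebra_simps)
      then have "R1 = (\<lambda>x. \<Sum>k<n. ?r k * g k x)" by blast
      then have A: "ip R1 e = (\<Sum>k<n. ?r k * lower k e 1)"
        using ip_sum_g[OF e(3), of ?r] by (simp only:)
      have "2 * (\<Sum>k<n. ?r k * lower k e 1) = - (O2 * (2 * (b 1 - deriv a 1) * kop e 1 - 2 * a 1 * kop' e 1) + 2 * a 1 * kop e 1)"
        unfolding kop_ends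
        by (simp add: sum_distrib_left sum_distrib_right sum_subtractf sum.distrib sum_negf algebra_simps)
      then show ?thesis by (simp only: A)
    qed
    have 2: "2 * ip (pop e) (gen e e' e'') + 2 * e' 1 * ip R1 e \<le> - 2 * \<delta> * ip e (pop e) - Q * (e' 1)\<^sup>2"
    proof -
      have "2 * e' 1 * ip R1 e = - e' 1 * (O2 * (2 * (b 1 - deriv a 1) * kop e 1 - 2 * a 1 * kop' e 1) + 2 * a 1 * kop e 1)"
      proof -
        have "2 * e' 1 * ip R1 e = e' 1 * (2 * ip R1 e)" by simp
        also have "\<dots> = - e' 1 * (O2 * (2 * (b 1 - deriv a 1) * kop e 1 - 2 * a 1 * kop' e 1) + 2 * a 1 * kop e 1)"
          unfolding R by (simp only: mult_minus_left mult_minus_right)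
        finally show ?thesis .
      qed
      moreover have "Q * (e' 1)\<^sup>2 = - (((b 1 - deriv a 1) * M 1 - a 1 * deriv M 1) * (e 1)\<^sup>2 + 2 * a 1 * M 1 * e 1 * e' 1)"
        using O2 by (simp add: Q_def e1 power2_eq_square field_simps)
      ultimately show ?thesis
        using observer_dissipation[OF C2 e0 neg[OF e(3)] Q3 Q4] by (simp add: e1 algebra_simps)
    qed
    have 3: "- 2 * ip \<phi> (pop e) \<le> s * ip (pop e) (pop e) + ip \<phi> \<phi> / s"
      using ip_young[OF pc \<phi> s(1)] by (simp add: ip_commute)
    have 4: "s * ip (pop e) (pop e) \<le> \<delta> * \<epsilon> * ip e e"
      using mult_left_mono[OF B(2)[OF e(3)], of s] s by (simp flip: mult.assoc)
    have 5: "\<delta> * (\<epsilon> * ip e e) \<le> \<delta> * ip e (pop e)"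
      using pop_coercive[OF e(3)] \<delta> by (intro mult_left_mono) auto
    have 6: "\<kappa> * ip e e \<le> \<delta> * \<epsilon> * ip e e" "\<kappa> * (e' 1)\<^sup>2 \<le> Q * (e' 1)\<^sup>2"
      by (intro mult_right_mono ip_nonneg; simp add: \<kappa>_def)+
    show "2 * ip et (pop e) \<le> - \<kappa> * ip e e - \<kappa> * (e' 1)\<^sup>2 + 1 / s * ip \<phi> \<phi>"
      using 1 2 3 4 5 6 by simp
  qed
qed

text \<open>The plain norm of the error, for the sake of the gradient term, which was spent in the
  weighted functional. The boundary term at 1 is \<open>a 1 * O2 * (e' 1)\<^sup>2\<close>,
  favourable since \<open>O2 < 0\<close>; everything else is charged to the disturbance or to
  quantities that \<open>observer_decay\<close> dissipates.\<close>

lemma energy_decay: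
  assumes O1: "continuous_on {0..1} O1" and O2: "O2 < 0"
  obtains C where "0 \<le> C"
    "\<And>e e' e'' et \<phi>. C2_on01 e e' e'' \<Longrightarrow> e' 0 = 0 \<Longrightarrow> e 1 = O2 * e' 1 \<Longrightarrow> continuous_on {0..1} \<phi> \<Longrightarrow>
      (\<And>x. x \<in> {0..1} \<Longrightarrow> et x = gen e e' e'' x + O1 x * e' 1 - \<phi> x) \<Longrightarrow>
      2 * ip et e \<le> - \<alpha> * ip e' e' + C * (ip e e + (e' 1)\<^sup>2 + ip \<phi> \<phi>)"
proof -
  obtain B where B: "0 < B" "\<And>x. x \<in> {0..1} \<Longrightarrow> \<bar>b x - deriv a x\<bar> \<le> B"
    using bounded_on01[of "\<lambda>x. b x - deriv a x"] abc_cont by (metis continuous_on_diff)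
  obtain D where D: "0 < D" "\<And>x. x \<in> {0..1} \<Longrightarrow> \<bar>c x\<bar> \<le> D"
    using bounded_on01[OF abc_cont(3)] by blast
  define C where "C = B\<^sup>2 / \<alpha> + D\<^sup>2 + 3 + ip O1 O1"
  have C0: "0 \<le> B\<^sup>2 / \<alpha>" "0 \<le> D\<^sup>2" "0 \<le> ip O1 O1" using \<alpha>_pos by (simp_all add: ip_nonneg)
  show thesis
  proof (rule that[of C])
    show "0 \<le> C" using C0 by (simp add: C_def)
    fix e e' e'' et \<phi> assume C2: "C2_on01 e e' e''" and e0: "e' 0 = 0" and e1: "e 1 = O2 * e' 1"
      and \<phi>: "continuous_on {0..1} \<phi>" and et: "\<And>x. x \<in> {0..1} \<Longrightarrow> et x = gen e e' e'' x + O1 x * e' 1 - \<phi> x"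
    note e = C2_on01D[OF C2]
    have gc: "continuous_on {0..1} (gen e e' e'')" by (rule gen_cont[OF C2])
    have ba: "continuous_on {0..1} (\<lambda>x. b x - deriv a x)" by (intro continuous_intros abc_cont)
    have "ip et e = ip (\<lambda>x. gen e e' e'' x + e' 1 * O1 x - \<phi> x) e"
      by (rule ip_cong) (simp_all add: et)
    also have "\<dots> = ip (gen e e' e'') e + e' 1 * ip O1 e - ip \<phi> e"
      by (subst ip_diff_left ip_add_left, (intro continuous_intros gc O1 \<phi> e)+)+ (simp add: ip_scale_left)
    finally have 1: "2 * ip et e = 2 * ip (gen e e' e'') e + 2 * e' 1 * ip O1 e - 2 * ip \<phi> e" by simp
    have "((\<lambda>x. a x * e x * e' x) has_real_derivative
        gen e e' e'' x * e x + a x * e' x * e' x - (b x - deriv a x) * e x * e' x - c x * e x * e x) (at x within {0..1})"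
      if x: "x \<in> {0..1}" for x
      by (auto intro!: derivative_eq_intros abc_deriv e x simp: gen_def algebra_simps)
    from integral_derivative01[OF this]
    have "integral {0..1} (\<lambda>x. gen e e' e'' x * e x + a x * e' x * e' x - (b x - deriv a x) * e x * e' x - c x * e x * e x)
        = a 1 * e 1 * e' 1" by (simp add: e0)
    moreover have "integral {0..1} (\<lambda>x. gen e e' e'' x * e x + a x * e' x * e' x - (b x - deriv a x) * e x * e' x - c x * e x * e x)
        = ip (gen e e' e'') e + ip (\<lambda>x. a x * e' x) e' - ip (\<lambda>x. (b x - deriv a x) * e x) e' - ip (\<lambda>x. c x * e x) e"
      unfolding ip_def
      by (subst integral_diff integral_add, (intro integrable_continuous_real continuous_intros gc e abc_cont)+)+ simp
    ultimately have 2: "ip (gen e e' e'') e = a 1 * e 1 * e' 1 - ip (\<lambda>x. a x * e' x) e'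
        + ip (\<lambda>x. (b x - deriv a x) * e x) e' + ip (\<lambda>x. c x * e x) e" by simp
    have "a 1 * e 1 * e' 1 = a 1 * O2 * (e' 1)\<^sup>2" by (simp add: e1 power2_eq_square)
    also have "\<dots> \<le> 0" using a_ge[of 1] \<alpha>_pos O2 by (intro mult_nonpos_nonneg mult_nonneg_nonpos) auto
    finally have 3: "a 1 * e 1 * e' 1 \<le> 0" .
    have "ip (\<lambda>x. \<alpha> * e' x) e' \<le> ip (\<lambda>x. a x * e' x) e'"
    proof (rule ip_mono)
      fix x :: real assume "x \<in> {0..1}"
      then have "\<alpha> * (e' x * e' x) \<le> a x * (e' x * e' x)" by (intro mult_right_mono a_ge) auto
      then show "\<alpha> * e' x * e' x \<le> a x * e' x * e' x" by (simp only: mult.assoc)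
    qed (intro continuous_intros e abc_cont)+
    then have 4: "\<alpha> * ip e' e' \<le> ip (\<lambda>x. a x * e' x) e'" by (simp add: ip_scale_left)
    have bc: "continuous_on {0..1} (\<lambda>x. (b x - deriv a x) * e x)" "continuous_on {0..1} (\<lambda>x. c x * e x)"
      by (intro continuous_intros e abc_cont)+
    \<comment> \<open>The weight \<open>1 / \<alpha>\<close> spends one of the two available copies
      of \<open>\<alpha> * ip e' e'\<close>.\<close>
    have 5: "2 * ip (\<lambda>x. (b x - deriv a x) * e x) e' \<le> B\<^sup>2 / \<alpha> * ip e e + \<alpha> * ip e' e'"
    proof -
      have "2 * ip (\<lambda>x. (b x - deriv a x) * e x) e'
        \<le> (1 / \<alpha>) * ip (\<lambda>x. (b x - deriv a x) * e x) (\<lambda>x. (b x - deriv a x) * e x) + ip e' e' / (1 / \<alpha>)"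
        using ip_young[OF bc(1) e(4), of "1 / \<alpha>"] \<alpha>_pos by simp
      also have "\<dots> \<le> (1 / \<alpha>) * (B\<^sup>2 * ip e e) + ip e' e' / (1 / \<alpha>)"
        using \<alpha>_pos by (intro add_mono mult_left_mono ip_mult_bound ba e B(2)) auto
      finally show ?thesis by (simp add: mult.commute)
    qed
    have 6: "2 * ip (\<lambda>x. c x * e x) e \<le> D\<^sup>2 * ip e e + ip e e"
      using ip_young[OF bc(2) e(3), of 1] ip_mult_bound[OF abc_cont(3) e(3) D(2)] by simp
    have 7: "2 * e' 1 * ip O1 e \<le> ip O1 O1 * (e' 1)\<^sup>2 + ip e e"
    proof -
      have "continuous_on {0..1} (\<lambda>x. e' 1 * O1 x)" by (intro continuous_intros O1)
      from ip_young[OF this e(3), of 1] show ?thesis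
        unfolding ip_scale_left ip_scale_right by (simp add: power2_eq_square algebra_simps)
    qed
    have 8: "- 2 * ip \<phi> e \<le> ip \<phi> \<phi> + ip e e"
      using ip_young[OF \<phi> e(3), of 1] by simp
    have 9: "(B\<^sup>2 / \<alpha> + D\<^sup>2 + 3) * ip e e \<le> C * ip e e" "ip O1 O1 * (e' 1)\<^sup>2 \<le> C * (e' 1)\<^sup>2" "1 * ip \<phi> \<phi> \<le> C * ip \<phi> \<phi>"
      using C0 by (intro mult_right_mono ip_nonneg; simp add: C_def)+
    show "2 * ip et e \<le> - \<alpha> * ip e' e' + C * (ip e e + (e' 1)\<^sup>2 + ip \<phi> \<phi>)"
      using 1 2 3 4 5 6 7 8 9 by (simp add: distrib_left distrib_right)
  qed
qed

text \<open>One integration by parts moves a derivative from \<open>e''\<close> to \<open>k\<close>,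
  so the second derivative of the error disappears; the end point 0 drops out by
  \<open>e' 0 = 0\<close>. This is what gives the lifted functional a controlled time
  derivative.\<close>

lemma functional_rate:
  assumes O1: "continuous_on {0..1} O1"
    and k: "\<And>x. x \<in> {0..1} \<Longrightarrow> (k has_real_derivative k' x) (at x within {0..1})" "continuous_on {0..1} k'"
  obtains C where "0 \<le> C"
    "\<And>e e' e'' et \<phi>. C2_on01 e e' e'' \<Longrightarrow> e' 0 = 0 \<Longrightarrow> continuous_on {0..1} \<phi> \<Longrightarrow>
      (\<And>x. x \<in> {0..1} \<Longrightarrow> et x = gen e e' e'' x + O1 x * e' 1 - \<phi> x) \<Longrightarrow>
      (ip k et)\<^sup>2 \<le> C * (ip e e + (e' 1)\<^sup>2 + ip e' e' + ip \<phi> \<phi>)"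
proof -
  have kc: "continuous_on {0..1} k" using k(1) by (rule continuous_on_if_deriv01)
  define A where "A = k 1 * a 1 + ip k O1"
  define h1 where "h1 = (\<lambda>x. k x * b x - k' x * a x - k x * deriv a x)"
  define h2 where "h2 = (\<lambda>x. k x * c x)"
  have hc: "continuous_on {0..1} h1" "continuous_on {0..1} h2"
    unfolding h1_def h2_def by (intro continuous_intros abc_cont kc k(2))+
  define C where "C = 4 * (A\<^sup>2 + ip h1 h1 + ip h2 h2 + ip k k)"
  have C0: "0 \<le> A\<^sup>2" "0 \<le> ip h1 h1" "0 \<le> ip h2 h2" "0 \<le> ip k k" by (simp_all add: ip_nonneg)
  show thesis
  proof (rule that[of C])
    show "0 \<le> C" using C0 by (simp add: C_def)
    fix e e' e'' et \<phi> assume C2: "C2_on01 e e' e''" and e0: "e' 0 = 0"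
      and \<phi>: "continuous_on {0..1} \<phi>" and et: "\<And>x. x \<in> {0..1} \<Longrightarrow> et x = gen e e' e'' x + O1 x * e' 1 - \<phi> x"
    note e = C2_on01D[OF C2]
    have gc: "continuous_on {0..1} (gen e e' e'')" by (rule gen_cont[OF C2])
    have "ip k et = ip k (\<lambda>x. gen e e' e'' x + e' 1 * O1 x - \<phi> x)"
      by (rule ip_cong) (simp_all add: et)
    also have "\<dots> = ip k (gen e e' e'') + e' 1 * ip k O1 - ip k \<phi>"
      by (subst ip_diff_right ip_add_right, (intro continuous_intros gc O1 \<phi> kc)+)+ (simp add: ip_scale_right)
    finally have 1: "ip k et = ip k (gen e e' e'') + e' 1 * ip k O1 - ip k \<phi>" .
    have "((\<lambda>x. k x * a x * e' x) has_real_derivative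
        k x * gen e e' e'' x - h1 x * e' x - h2 x * e x) (at x within {0..1})" if x: "x \<in> {0..1}" for x
      by (auto intro!: derivative_eq_intros abc_deriv e k x simp: gen_def h1_def h2_def algebra_simps)
    from integral_derivative01[OF this]
    have "integral {0..1} (\<lambda>x. k x * gen e e' e'' x - h1 x * e' x - h2 x * e x) = k 1 * a 1 * e' 1" by (simp add: e0)
    moreover have "integral {0..1} (\<lambda>x. k x * gen e e' e'' x - h1 x * e' x - h2 x * e x)
        = ip k (gen e e' e'') - ip h1 e' - ip h2 e"
      unfolding ip_def
      by (subst integral_diff, (intro integrable_continuous_real continuous_intros gc e hc kc)+)+ simp
    ultimately have "ip k et = A * e' 1 + ip h1 e' + ip h2 e + - ip k \<phi>" using 1 by (simp add: A_def algebra_simps)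
    then have "(ip k et)\<^sup>2 \<le> 4 * ((A * e' 1)\<^sup>2 + (ip h1 e')\<^sup>2 + (ip h2 e)\<^sup>2 + (ip k \<phi>)\<^sup>2)"
      using power2_sum4_le[of "A * e' 1" "ip h1 e'" "ip h2 e" "- ip k \<phi>"] by simp
    also have "\<dots> \<le> 4 * (A\<^sup>2 * (e' 1)\<^sup>2 + ip h1 h1 * ip e' e' + ip h2 h2 * ip e e + ip k k * ip \<phi> \<phi>)"
      by (intro mult_left_mono add_mono ip_cauchy_schwarz hc e kc \<phi>) (auto simp: power_mult_distrib)
    also have "\<dots> = (4 * A\<^sup>2) * (e' 1)\<^sup>2 + (4 * ip h1 h1) * ip e' e' + (4 * ip h2 h2) * ip e e + (4 * ip k k) * ip \<phi> \<phi>"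
      by (simp add: algebra_simps)
    also have "\<dots> \<le> C * (e' 1)\<^sup>2 + C * ip e' e' + C * ip e e + C * ip \<phi> \<phi>"
      using C0 by (intro add_mono mult_right_mono ip_nonneg) (auto simp: C_def)
    finally show "(ip k et)\<^sup>2 \<le> C * (ip e e + (e' 1)\<^sup>2 + ip e' e' + ip \<phi> \<phi>)" by (simp add: algebra_simps)
  qed
qed

text \<open>Put \<open>r = z' 1 + d\<close>. Then \<open>(M 1)\<^sup>2\<close> times the boundary
  term at 1 is \<open>Z1 * (q * r\<^sup>2 - T6 * M 1 * r * d)\<close> with
  \<open>q = T5 * Z1 + T6 * M 1 > 0\<close>. Completing the square bounds it by a multiple of
  \<open>- Z1 * d\<^sup>2\<close>, and here the sign of \<open>Z1\<close> enters. For
  \<open>Z1 = 0\<close> this form of the boundary condition forces \<open>z 1 = 0\<close>, so other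
  boundary perturbations have to be lifted beforehand.\<close>

lemma state_decay:
  assumes \<delta>: "0 < \<delta>"
    and neg: "\<And>z. continuous_on {0..1} z \<Longrightarrow>
      qform (\<lambda>x. state_mult x - pi\<^sup>2 / 2 * \<alpha> * \<epsilon>) state_kernel z \<le> - 2 * \<delta> * ip z (pop z)"
    and T3: "(deriv a 0 - b 0) * M 0 + a 0 * deriv M 0 - pi\<^sup>2 / 2 * \<alpha> * \<epsilon> \<le> 0"
    and T4: "\<And>x. 2 * a 0 * (\<Sum>k<n. deriv (g k) 0 * f k x) + pi\<^sup>2 * \<alpha> * \<epsilon> = 0"
    and Z1: "Z1 \<le> 0" and T56: "((b 1 - deriv a 1) * M 1 + a 1 * deriv M 1) * Z1 > - (2 * a 1 * M 1) * M 1"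
  obtains C where "0 \<le> C"
    "\<And>z z' z'' wt G d. C2_on01 z z' z'' \<Longrightarrow> pop' z z' 0 = 0 \<Longrightarrow> M 1 * z 1 = Z1 * (z' 1 + d) \<Longrightarrow> continuous_on {0..1} G \<Longrightarrow>
      (\<And>x. x \<in> {0..1} \<Longrightarrow> wt x = gen (pop z) (pop' z z') (pop'' z z' z'') x + G x) \<Longrightarrow>
      2 * ip wt z \<le> - \<delta> * \<epsilon> * ip z z + C * (d\<^sup>2 + ip G G)"
proof -
  define T5 where "T5 = (b 1 - deriv a 1) * M 1 + a 1 * deriv M 1"
  define T6 where "T6 = 2 * a 1 * M 1"
  define q where "q = T5 * Z1 + T6 * M 1"
  have q: "0 < q" using T56 by (simp add: q_def T5_def T6_def)
  \<comment> \<open>The remainder from completing the square, divided by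
    \<open>(M 1)\<^sup>2\<close>.\<close>
  define D where "D = - Z1 * T6\<^sup>2 / (4 * q)"
  have D0: "0 \<le> D" using Z1 q by (auto simp: D_def intro!: divide_nonpos_pos mult_nonpos_nonneg)
  have s0: "0 < \<delta> * \<epsilon>" using \<delta> eps by simp
  define C where "C = D + 1 / (\<delta> * \<epsilon>)"
  show thesis
  proof (rule that[of C])
    show "0 \<le> C" using D0 s0 by (simp add: C_def)
    fix z z' z'' wt G d assume C2: "C2_on01 z z' z''" and z0: "pop' z z' 0 = 0" and z1: "M 1 * z 1 = Z1 * (z' 1 + d)"
      and G: "continuous_on {0..1} G" and wt: "\<And>x. x \<in> {0..1} \<Longrightarrow> wt x = gen (pop z) (pop' z z') (pop'' z z' z'') x + G x"
    note z = C2_on01D[OF C2]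
    let ?g = "gen (pop z) (pop' z z') (pop'' z z' z'')"
    have gc: "continuous_on {0..1} ?g" by (rule gen_cont[OF pop_C2[OF C2]])
    have "ip wt z = ip (\<lambda>x. ?g x + G x) z" by (rule ip_cong) (simp_all add: wt)
    also have "\<dots> = ip ?g z + ip G z" by (rule ip_add_left[OF gc G z(3)])
    finally have 1: "2 * ip wt z = 2 * ip z ?g + 2 * ip z G" by (simp add: ip_commute)
    have 2: "T5 * (z 1)\<^sup>2 + T6 * z 1 * z' 1 \<le> D * d\<^sup>2"
    proof -
      let ?s = "z' 1 + d"
      have "0 \<le> (q * ?s - T6 * M 1 * d / 2)\<^sup>2 / q" using q by simp
      also have "\<dots> = q * ?s\<^sup>2 - T6 * M 1 * ?s * d + (T6 * M 1 * d)\<^sup>2 / (4 * q)"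
        using q by (simp add: power2_eq_square field_simps)
      finally have "Z1 * (q * ?s\<^sup>2 - T6 * M 1 * ?s * d + (T6 * M 1 * d)\<^sup>2 / (4 * q)) \<le> 0"
        using Z1 by (rule mult_nonpos_nonneg[rotated])
      moreover have "(M 1)\<^sup>2 * (T5 * (z 1)\<^sup>2 + T6 * z 1 * z' 1) = Z1 * (q * ?s\<^sup>2 - T6 * M 1 * ?s * d)"
      proof -
        have "(M 1)\<^sup>2 * (T5 * (z 1)\<^sup>2 + T6 * z 1 * z' 1) = T5 * (M 1 * z 1)\<^sup>2 + T6 * M 1 * (M 1 * z 1) * z' 1"
          by (simp add: power2_eq_square algebra_simps)
        also have "\<dots> = Z1 * (q * ?s\<^sup>2 - T6 * M 1 * ?s * d)"
          unfolding z1 q_def by (simp add: power2_eq_square algebra_simps)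
        finally show ?thesis .
      qed
      moreover have "Z1 * ((T6 * M 1 * d)\<^sup>2 / (4 * q)) = - ((M 1)\<^sup>2 * (D * d\<^sup>2))"
        by (simp add: D_def power_mult_distrib)
      ultimately have "(M 1)\<^sup>2 * (T5 * (z 1)\<^sup>2 + T6 * z 1 * z' 1) \<le> (M 1)\<^sup>2 * (D * d\<^sup>2)"
        by (simp add: distrib_left)
      then show ?thesis using M_pos[of 1] by simp
    qed
    have 3: "2 * ip z G \<le> \<delta> * \<epsilon> * ip z z + ip G G / (\<delta> * \<epsilon>)"
      using ip_young[OF z(3) G s0] by simp
    have 4: "\<delta> * (\<epsilon> * ip z z) \<le> \<delta> * ip z (pop z)"
      using pop_coercive[OF z(3)] \<delta> by (intro mult_left_mono) auto
    have 5: "D * d\<^sup>2 \<le> C * d\<^sup>2" "(1 / (\<delta> * \<epsilon>)) * ip G G \<le> C * ip G G"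
      using D0 s0 by (intro mult_right_mono ip_nonneg; simp add: C_def)+
    show "2 * ip wt z \<le> - \<delta> * \<epsilon> * ip z z + C * (d\<^sup>2 + ip G G)"
      using 1 2 3 4 5 state_dissipation[OF C2 z0 neg[OF z(3)] T3 T4]
      by (simp add: T5_def T6_def distrib_left)
  qed
qed

end

section \<open>The closed loop\<close>

lemma C2_on01_lincomb:
  assumes "C2_on01 u u' u''" "C2_on01 v v' v''"
  shows "C2_on01 (\<lambda>x. u x + s * v x) (\<lambda>x. u' x + s * v' x) (\<lambda>x. u'' x + s * v'' x)"
  using assms unfolding C2_on01_def
  by (auto intro!: derivative_eq_intros continuous_intros)

text \<open>The hypotheses of the theorem with the two maps evaluated on separable kernels. Both
  operators share the coefficients and the lower bound \<open>\<epsilon>\<close> but have separate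
  factorisations of their kernels.\<close>

locale observer_feedback =
  P: lyapunov_data M n f g \<epsilon> a b c \<alpha> + S: lyapunov_data N m h l \<epsilon> a b c \<alpha>
  for M n f g \<epsilon> a b c \<alpha> N m h l +
  fixes \<delta> Z1 O2 :: real and R1 :: "real \<Rightarrow> real"
  assumes \<delta>: "0 < \<delta>" and R1_cont: "continuous_on {0..1} R1" and O2: "O2 < 0"
    and P_neg: "\<And>z. continuous_on {0..1} z \<Longrightarrow>
      qform (\<lambda>x. P.state_mult x - pi\<^sup>2 / 2 * \<alpha> * \<epsilon>) P.state_kernel z \<le> - 2 * \<delta> * ip z (P.pop z)"
    and T3: "(deriv a 0 - b 0) * M 0 + a 0 * deriv M 0 - pi\<^sup>2 / 2 * \<alpha> * \<epsilon> \<le> 0"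
    and T4: "\<And>x. 2 * a 0 * (\<Sum>k<n. deriv (g k) 0 * f k x) + pi\<^sup>2 * \<alpha> * \<epsilon> = 0"
    and Z1: "Z1 \<le> 0" and T56: "((b 1 - deriv a 1) * M 1 + a 1 * deriv M 1) * Z1 > - (2 * a 1 * M 1) * M 1"
    and S_neg: "\<And>z. continuous_on {0..1} z \<Longrightarrow>
      qform (\<lambda>x. S.obs_mult x - pi\<^sup>2 / 2 * \<alpha> * \<epsilon>) S.obs_kernel z \<le> - 2 * \<delta> * ip z (S.pop z)"
    and Q3: "(deriv a 0 - b 0) * N 0 + a 0 * deriv N 0 - pi\<^sup>2 / 2 * \<alpha> * \<epsilon> \<le> 0"
    and Q4: "\<And>x. 2 * (deriv a 0 - b 0) * (\<Sum>k<m. l k 0 * h k x) + 2 * a 0 * (\<Sum>k<m. deriv (l k) 0 * h k x)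
        + pi\<^sup>2 * \<alpha> * \<epsilon> = 0"
    and Q57: "((b 1 - deriv a 1) * N 1 - a 1 * deriv N 1) + 1 / O2 * (2 * a 1 * N 1) < 0"
    and R1_eq: "\<And>x. R1 x = - 1 / 2 * (O2 * (2 * (b 1 - deriv a 1) * (\<Sum>k<m. h k 1 * l k x)
        - 2 * a 1 * (\<Sum>k<m. deriv (h k) 1 * l k x)) + 2 * a 1 * (\<Sum>k<m. h k 1 * l k x))"
begin

definition K1at1 :: "real \<Rightarrow> real" where "K1at1 x = (\<Sum>k<n. f k 1 * g k x)"

text \<open>The representer of the functional that lifting has to remove: by the symmetry of the
  inverse, \<open>ip k e = ip K1at1 (P.pinv e)\<close>.\<close>

definition k :: "real \<Rightarrow> real" where "k = P.pinv K1at1"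

text \<open>The boundary value of the closed loop contains the term \<open>ip k e\<close>, which has no counterpart in
  the form \<open>Z1 * (\<dots>)\<close> and cannot be absorbed by the boundary dissipation when \<open>Z1 = 0\<close>. It is lifted
  by a multiple of \<open>\<psi> = P.pop \<phi>\<close>; the polynomial \<open>\<phi>\<close> is chosen with \<open>M 1 * \<phi> 1 = 1\<close> and with
  \<open>\<phi> 0\<close>, \<open>\<phi>' 0\<close> and the mean all zero, so that \<open>\<psi>' 0 = 0\<close>.\<close>

definition \<phi> :: "real \<Rightarrow> real" where "\<phi> x = (5 * x ^ 4 - 3 * x\<^sup>2) / (2 * M 1)"
definition \<phi>' :: "real \<Rightarrow> real" where "\<phi>' x = (20 * x ^ 3 - 6 * x) / (2 * M 1)"
definition \<phi>'' :: "real \<Rightarrow> real" where "\<phi>'' x = (60 * x\<^sup>2 - 6) / (2 * M 1)"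

definition \<psi> where "\<psi> = P.pop \<phi>"
definition \<psi>' where "\<psi>' = P.pop' \<phi> \<phi>'"
definition \<psi>'' where "\<psi>'' = P.pop'' \<phi> \<phi>' \<phi>''"

lemma phi_C2: "C2_on01 \<phi> \<phi>' \<phi>''"
proof -
  have M1: "M 1 \<noteq> 0" using P.M_pos[of 1] by simp
  have "(\<phi> has_real_derivative \<phi>' x) (at x within {0..1})" for x
    unfolding \<phi>_def[abs_def] \<phi>'_def by (rule DERIV_cdivide) (auto intro!: derivative_eq_intros)
  moreover have "(\<phi>' has_real_derivative \<phi>'' x) (at x within {0..1})" for x
    unfolding \<phi>'_def[abs_def] \<phi>''_def by (rule DERIV_cdivide) (auto intro!: derivative_eq_intros)
  moreover have "continuous_on {0..1} \<phi>''" unfolding \<phi>''_def[abs_def] by (intro continuous_intros) (simp add: M1)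
  ultimately show ?thesis by (simp add: C2_on01_def)
qed

lemma psi_C2: "C2_on01 \<psi> \<psi>' \<psi>''"
  unfolding \<psi>_def \<psi>'_def \<psi>''_def by (rule P.pop_C2[OF phi_C2])

lemma phi_mean: "integral {0..1} \<phi> = 0"
proof -
  have "((\<lambda>x. (x ^ 5 - x ^ 3) / (2 * M 1)) has_real_derivative \<phi> x) (at x within {0..1})" for x
    unfolding \<phi>_def by (rule DERIV_cdivide) (auto intro!: derivative_eq_intros)
  from integral_derivative01[OF this] show ?thesis by simp
qed

text \<open>By the condition on \<open>T4\<close> the derivative of the kernel at 0 is constant in
  its second argument, so \<open>P.kop' \<phi> 0\<close> is a multiple of the mean of
  \<open>\<phi>\<close>.\<close>

lemma psi'_0: "\<psi>' 0 = 0"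
proof -
  have "2 * a 0 * P.kop' \<phi> 0 = ip (\<lambda>x. 2 * a 0 * (\<Sum>k<n. deriv (g k) 0 * f k x)) \<phi>"
    unfolding P.kop_ends ip_scale_left P.ip_sum_f[OF C2_on01D(3)[OF phi_C2]] ..
  also have "(\<lambda>x. 2 * a 0 * (\<Sum>k<n. deriv (g k) 0 * f k x)) = (\<lambda>x. - (pi\<^sup>2 * \<alpha> * \<epsilon>))"
    using T4 by (auto simp: fun_eq_iff algebra_simps eq_neg_iff_add_eq_0)
  also have "ip (\<lambda>x. - (pi\<^sup>2 * \<alpha> * \<epsilon>)) \<phi> = 0" by (simp add: ip_def phi_mean)
  finally have "P.kop' \<phi> 0 = 0" using P.a_ge[of 0] P.\<alpha>_pos by simp
  then show ?thesis by (simp add: \<psi>'_def P.pop'_def \<phi>_def \<phi>'_def)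
qed

lemma K1at1_cont: "continuous_on A K1at1"
  unfolding K1at1_def[abs_def] by (intro continuous_intros P.poly_cont)

lemma K1at1_C2: "\<exists>u' u''. C2_on01 K1at1 u' u''"
proof (intro exI)
  show "C2_on01 K1at1 (\<lambda>x. \<Sum>k<n. f k 1 * deriv (g k) x) (\<lambda>x. \<Sum>k<n. f k 1 * deriv (deriv (g k)) x)"
    unfolding C2_on01_def K1at1_def[abs_def]
    by (auto intro!: DERIV_sum DERIV_cmult P.g_deriv continuous_intros P.poly_deriv_cont)
qed

lemma ip_K1at1:
  assumes "continuous_on {0..1} z"
  shows "ip K1at1 z = P.kop z 1"
  unfolding K1at1_def[abs_def] P.ip_sum_g[OF assms] P.kop_ends ..

lemma k_cont: "continuous_on {0..1} k"
  unfolding k_def by (rule P.pinv_cont[OF K1at1_cont])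

text \<open>By linearity the preimage of \<open>w + e\<close> is
  \<open>pinv v + \<kappa> * \<phi> + pinv e\<close>, so the integral part of the feedback is
  \<open>kop (pinv v) 1 + \<kappa> * kop \<phi> 1 + \<kappa>\<close>. Since
  \<open>\<psi> 1 = 1 + kop \<phi> 1\<close>, subtracting \<open>\<kappa> * \<psi> 1\<close> removes
  the last two terms, and the operator equation for \<open>v\<close> at 1 removes the first. Only
  terms with the factor \<open>Z1\<close> survive.\<close>

lemma lifted_boundary:
  assumes w: "C2_on01 w w' w''" and e: "C2_on01 e e' e''" and w0: "w' 0 = 0"
    and w1: "w 1 = Z1 * D01 (P.pinv (\<lambda>x. w x + e x)) 1 + ip K1at1 (P.pinv (\<lambda>x. w x + e x))"
    and y: "C2_on01 (P.pinv e) y' y''"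
  defines "\<kappa> \<equiv> ip k e"
  defines "v \<equiv> \<lambda>x. w x + (- \<kappa>) * \<psi> x" and "v' \<equiv> \<lambda>x. w' x + (- \<kappa>) * \<psi>' x" and "v'' \<equiv> \<lambda>x. w'' x + (- \<kappa>) * \<psi>'' x"
  obtains z' z'' where "C2_on01 (P.pinv v) z' z''"
    "P.pop' (P.pinv v) z' 0 = 0" "M 1 * P.pinv v 1 = Z1 * (z' 1 + (y' 1 + \<kappa> * \<phi>' 1))"
    "\<And>x. x \<in> {0..1} \<Longrightarrow> P.gen (P.pop (P.pinv v)) (P.pop' (P.pinv v) z') (P.pop'' (P.pinv v) z' z'') x = P.gen v v' v'' x"
proof -
  note wc = C2_on01D[OF w] and ec = C2_on01D[OF e] and yc = C2_on01D[OF y] and pc = C2_on01D[OF phi_C2] and sc = C2_on01D[OF psi_C2]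
  have v: "C2_on01 v v' v''" unfolding v_def v'_def v''_def by (rule C2_on01_lincomb[OF w psi_C2])
  note vc = C2_on01D[OF v]
  obtain z' z'' where z: "C2_on01 (P.pinv v) z' z''" and z': "\<And>x. P.pop' (P.pinv v) z' x = v' x"
    and z'': "\<And>x. P.pop'' (P.pinv v) z' z'' x = v'' x"
    by (rule P.pinv_C2[OF v]) blast
  note zc = C2_on01D[OF z]
  have one: "(1::real) \<in> {0..1}" by simp
  have sum: "P.pinv (\<lambda>x. w x + e x) x = P.pinv v x + \<kappa> * \<phi> x + P.pinv e x" if x: "x \<in> {0..1}" for x
  proof -
    have cc: "continuous_on {0..1} (\<lambda>x. 1 * P.pinv v x + \<kappa> * \<phi> x)" by (intro continuous_intros zc pc)
    have "P.pinv (\<lambda>x. w x + e x) x = 1 * (1 * P.pinv v x + \<kappa> * \<phi> x) + 1 * P.pinv e x"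
    proof (rule P.pinv_eqI[OF _ _ _ x])
      fix r :: real assume r: "r \<in> {0..1}"
      show "P.pop (\<lambda>x. 1 * (1 * P.pinv v x + \<kappa> * \<phi> x) + 1 * P.pinv e x) r = w r + e r"
        unfolding P.pop_lincomb[OF cc yc(3) r] P.pop_lincomb[OF zc(3) pc(3) r] P.pop_pinv[OF vc(3) r] P.pop_pinv[OF ec(3) r]
        by (simp add: v_def \<psi>_def)
    qed (intro continuous_intros wc ec zc pc yc)+
    then show ?thesis by simp
  qed
  have "((\<lambda>x. P.pinv v x + \<kappa> * \<phi> x + P.pinv e x) has_real_derivative z' 1 + \<kappa> * \<phi>' 1 + y' 1) (at 1 within {0..1})"
    by (intro DERIV_add DERIV_cmult zc pc yc one)
  then have "(P.pinv (\<lambda>x. w x + e x) has_real_derivative z' 1 + \<kappa> * \<phi>' 1 + y' 1) (at 1 within {0..1})"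
    by (rule has_field_derivative_transform_within[where d = 1]) (auto simp: sum)
  then have D: "D01 (P.pinv (\<lambda>x. w x + e x)) 1 = z' 1 + \<kappa> * \<phi>' 1 + y' 1" by (rule D01_eq[OF _ one])
  have "ip K1at1 (P.pinv (\<lambda>x. w x + e x)) = ip K1at1 (\<lambda>x. P.pinv v x + \<kappa> * \<phi> x + P.pinv e x)"
    by (rule ip_cong) (simp_all add: sum)
  also have "\<dots> = ip K1at1 (P.pinv v) + \<kappa> * ip K1at1 \<phi> + ip K1at1 (P.pinv e)"
    by (subst ip_add_right, (intro continuous_intros zc pc yc K1at1_cont)+)+ (simp add: ip_scale_right)
  also have "ip K1at1 (P.pinv e) = \<kappa>"
    unfolding \<kappa>_def k_def by (rule P.pinv_sym[OF K1at1_cont ec(3), symmetric])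
  finally have I: "ip K1at1 (P.pinv (\<lambda>x. w x + e x)) = P.kop (P.pinv v) 1 + \<kappa> * P.kop \<phi> 1 + \<kappa>"
    by (simp add: ip_K1at1 zc pc)
  have "M 1 * \<phi> 1 = 1" using P.M_pos[of 1] by (simp add: \<phi>_def)
  then have \<psi>1: "\<psi> 1 = 1 + P.kop \<phi> 1" by (simp add: \<psi>_def P.pop_def)
  have "M 1 * P.pinv v 1 + P.kop (P.pinv v) 1 = w 1 - \<kappa> * \<psi> 1"
    using P.pop_pinv[OF vc(3) one] by (simp add: P.pop_def v_def)
  then have b: "M 1 * P.pinv v 1 = Z1 * (z' 1 + (y' 1 + \<kappa> * \<phi>' 1))"
    using w1 unfolding D I \<psi>1 by (simp add: algebra_simps)
  show thesis
  proof (rule that[OF z _ b])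
    show "P.pop' (P.pinv v) z' 0 = 0" by (simp add: z' v'_def w0 psi'_0)
    show "P.gen (P.pop (P.pinv v)) (P.pop' (P.pinv v) z') (P.pop'' (P.pinv v) z' z'') x = P.gen v v' v'' x"
      if "x \<in> {0..1}" for x
      by (simp add: P.gen_def z' z'' P.pop_pinv[OF vc(3) that])
  qed
qed

text \<open>The weights follow the order of dependence. The state estimate leaves \<open>e'\<close>
  terms, caused by the rate of \<open>\<kappa>\<close>; \<open>\<mu>1\<close> times the energy
  estimate absorbs them at the cost of more \<open>e\<close> and \<open>e' 1\<close> terms, and
  \<open>\<mu>2\<close> times the observer estimate absorbs all of those.\<close>

lemma closed_loop_rate:
  obtains \<mu>1 \<mu>2 \<sigma> C where "0 \<le> \<mu>1" "0 \<le> \<mu>2" "0 < \<sigma>" "0 \<le> C"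
    "\<And>w w' w'' e e' e'' wt et d. C2_on01 w w' w'' \<Longrightarrow> C2_on01 e e' e'' \<Longrightarrow> continuous_on {0..1} d \<Longrightarrow>
      w' 0 = 0 \<Longrightarrow> e' 0 = 0 \<Longrightarrow> e 1 = O2 * e' 1 \<Longrightarrow>
      w 1 = Z1 * D01 (P.pinv (\<lambda>x. w x + e x)) 1 + ip K1at1 (P.pinv (\<lambda>x. w x + e x)) \<Longrightarrow>
      (\<And>x. x \<in> {0..1} \<Longrightarrow> wt x = P.gen w w' w'' x + d x) \<Longrightarrow>
      (\<And>x. x \<in> {0..1} \<Longrightarrow> et x = P.gen e e' e'' x + S.pinv R1 x * e' 1 - d x) \<Longrightarrow>
      2 * ip (\<lambda>x. wt x - ip k et * \<psi> x) (P.pinv (\<lambda>x. w x - ip k e * \<psi> x)) + \<mu>1 * (2 * ip et e) + \<mu>2 * (2 * ip et (S.pop e))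
        \<le> - \<sigma> * ip w w + C * ip d d"
proof -
  obtain \<kappa>2 C2 where \<kappa>2: "0 < \<kappa>2" "0 \<le> C2" and obs:
    "\<And>e e' e'' et d. C2_on01 e e' e'' \<Longrightarrow> e' 0 = 0 \<Longrightarrow> e 1 = O2 * e' 1 \<Longrightarrow> continuous_on {0..1} d \<Longrightarrow>
      (\<And>x. x \<in> {0..1} \<Longrightarrow> et x = P.gen e e' e'' x + S.pinv R1 x * e' 1 - d x) \<Longrightarrow>
      2 * ip et (S.pop e) \<le> - \<kappa>2 * ip e e - \<kappa>2 * (e' 1)\<^sup>2 + C2 * ip d d"
    proof (rule S.observer_decay[OF \<delta> R1_cont O2 S_neg Q3 Q4 Q57 R1_eq], goal_cases)
      case (1 z) then show ?case by blast
    next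
      case (2 _) show ?case by (rule that[OF 2(2) 2(3)], rule 2(4), assumption+)
    qed
  have oc: "continuous_on {0..1} (S.pinv R1)" by (rule S.pinv_cont[OF R1_cont])
  obtain C3 where C3: "0 \<le> C3" and energy:
    "\<And>e e' e'' et d. C2_on01 e e' e'' \<Longrightarrow> e' 0 = 0 \<Longrightarrow> e 1 = O2 * e' 1 \<Longrightarrow> continuous_on {0..1} d \<Longrightarrow>
      (\<And>x. x \<in> {0..1} \<Longrightarrow> et x = P.gen e e' e'' x + S.pinv R1 x * e' 1 - d x) \<Longrightarrow>
      2 * ip et e \<le> - \<alpha> * ip e' e' + C3 * (ip e e + (e' 1)\<^sup>2 + ip d d)"
    proof (rule P.energy_decay[OF oc O2], goal_cases)
      case (1 _) show ?case by (rule that[OF 1(2)], rule 1(3), assumption+)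
    qed
  obtain u' u'' where "C2_on01 K1at1 u' u''" using K1at1_C2 by blast
  then obtain k' k'' where k: "C2_on01 k k' k''"
    unfolding k_def by (rule P.pinv_C2) blast
  obtain Ck where Ck: "0 \<le> Ck" and rate:
    "\<And>e e' e'' et d. C2_on01 e e' e'' \<Longrightarrow> e' 0 = 0 \<Longrightarrow> continuous_on {0..1} d \<Longrightarrow>
      (\<And>x. x \<in> {0..1} \<Longrightarrow> et x = P.gen e e' e'' x + S.pinv R1 x * e' 1 - d x) \<Longrightarrow>
      (ip k et)\<^sup>2 \<le> Ck * (ip e e + (e' 1)\<^sup>2 + ip e' e' + ip d d)"
    proof (rule P.functional_rate[OF oc C2_on01D(1)[OF k] C2_on01D(4)[OF k]], goal_cases)
      case (1 x) then show ?case by blast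
    next
      case (2 _) show ?case by (rule that[OF 2(2)], rule 2(3), assumption+)
    qed
  obtain Cs where Cs: "0 \<le> Cs" and state:
    "\<And>z z' z'' wt G d. C2_on01 z z' z'' \<Longrightarrow> P.pop' z z' 0 = 0 \<Longrightarrow> M 1 * z 1 = Z1 * (z' 1 + d) \<Longrightarrow> continuous_on {0..1} G \<Longrightarrow>
      (\<And>x. x \<in> {0..1} \<Longrightarrow> wt x = P.gen (P.pop z) (P.pop' z z') (P.pop'' z z' z'') x + G x) \<Longrightarrow>
      2 * ip wt z \<le> - \<delta> * \<epsilon> * ip z z + Cs * (d\<^sup>2 + ip G G)"
    proof (rule P.state_decay[OF \<delta> P_neg T3 T4 Z1 T56], goal_cases)
      case (1 z) then show ?case by blast
    next
      case (2 _) show ?case by (rule that[OF 2(2)], rule 2(3), assumption+)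
    qed
  obtain Cb where Cb: "0 \<le> Cb" and bdry:
    "\<And>h h' h'' z' z''. C2_on01 h h' h'' \<Longrightarrow> C2_on01 (P.pinv h) z' z'' \<Longrightarrow> (z' 1)\<^sup>2 \<le> Cb * ((h 1)\<^sup>2 + (h' 1)\<^sup>2 + ip h h)"
    proof (rule P.pinv_boundary_deriv, goal_cases)
      case (1 _) show ?case by (rule that[OF 1(2)], rule 1(3), assumption+)
    qed
  obtain B where B: "0 < B" "\<And>z. continuous_on {0..1} z \<Longrightarrow> ip (P.pop z) (P.pop z) \<le> B * ip z z"
    by (rule P.pop_bound) blast
  note sc = C2_on01D[OF psi_C2]
  define K where "K = ip k k"
  define A where "A = ip (P.gen \<psi> \<psi>' \<psi>'') (P.gen \<psi> \<psi>' \<psi>'')"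
  define Y where "Y = ip \<psi> \<psi>"
  have n0: "0 \<le> K" "0 \<le> A" "0 \<le> Y" by (simp_all add: K_def A_def Y_def ip_nonneg)
  \<comment> \<open>\<open>Cd\<close> is for the boundary perturbation
    \<open>y' 1 + \<kappa> * \<phi>' 1\<close>, \<open>Cg\<close> for the source \<open>G\<close> in
    the equation of the lifted state; the numerical factors come from squaring sums.\<close>
  define Cd where "Cd = 2 * Cb * (O2\<^sup>2 + 1) + 2 * (\<phi>' 1)\<^sup>2 * K"
  define Cg where "Cg = 2 + 4 * A * K + 4 * Y * Ck"
  define C4 where "C4 = Cs * (Cd + Cg)"
  have Cd0: "0 \<le> Cd" and Cg0: "0 \<le> Cg" using Cb n0 Ck by (simp_all add: Cd_def Cg_def)
  have C40: "0 \<le> C4" using Cs Cd0 Cg0 by (simp add: C4_def)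
  \<comment> \<open>Compensates exactly the coefficient \<open>C4\<close> of
    \<open>ip e' e'\<close>.\<close>
  define \<mu>1 where "\<mu>1 = C4 / \<alpha>"
  have \<mu>1: "0 \<le> \<mu>1" "\<mu>1 * \<alpha> = C4" using C40 P.\<alpha>_pos by (simp_all add: \<mu>1_def)
  define C5 where "C5 = C4 + \<mu>1 * C3"
  have C50: "0 \<le> C5" using C40 \<mu>1 C3 by (simp add: C5_def)
  \<comment> \<open>The surplus 1 leaves \<open>- ip e e\<close>, which is needed because
    \<open>w\<close> differs from \<open>v\<close> by \<open>\<kappa> * \<psi>\<close>.\<close>
  define \<mu>2 where "\<mu>2 = (C5 + 1) / \<kappa>2"
  have \<mu>2: "0 \<le> \<mu>2" "\<mu>2 * \<kappa>2 = C5 + 1" using C50 \<kappa>2 by (simp_all add: \<mu>2_def)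
  \<comment> \<open>For the estimate of \<open>w = pop (pinv v) + \<kappa> * \<psi>\<close>, with
    \<open>\<kappa>\<^sup>2 \<le> K * ip e e\<close>.\<close>
  define Cw where "Cw = 2 * B + 2 * K * Y + 1"
  have Cw: "0 < Cw" "2 * B \<le> Cw" "2 * K * Y \<le> Cw" using B n0 by (simp_all add: Cw_def add_pos_nonneg)
  define \<sigma> where "\<sigma> = min (\<delta> * \<epsilon>) 1 / Cw"
  have \<sigma>: "0 < \<sigma>" using \<delta> P.eps Cw by (simp add: \<sigma>_def)
  show thesis
  proof (rule that[of \<mu>1 \<mu>2 \<sigma> "C5 + \<mu>2 * C2"])
    show "0 \<le> C5 + \<mu>2 * C2" using C50 \<mu>2 \<kappa>2 by simp
    fix w w' w'' e e' e'' wt et d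
    assume w: "C2_on01 w w' w''" and e: "C2_on01 e e' e''" and d: "continuous_on {0..1} d"
      and w0: "w' 0 = 0" and e0: "e' 0 = 0" and e1: "e 1 = O2 * e' 1"
      and w1: "w 1 = Z1 * D01 (P.pinv (\<lambda>x. w x + e x)) 1 + ip K1at1 (P.pinv (\<lambda>x. w x + e x))"
      and wt: "\<And>x. x \<in> {0..1} \<Longrightarrow> wt x = P.gen w w' w'' x + d x"
      and et: "\<And>x. x \<in> {0..1} \<Longrightarrow> et x = P.gen e e' e'' x + S.pinv R1 x * e' 1 - d x"
    note wc = C2_on01D[OF w] and ec = C2_on01D[OF e]
    define \<kappa> where "\<kappa> = ip k e"
    define \<kappa>' where "\<kappa>' = ip k et"
    define v where "v = (\<lambda>x. w x + (- \<kappa>) * \<psi> x)"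
    define v' where "v' = (\<lambda>x. w' x + (- \<kappa>) * \<psi>' x)"
    define v'' where "v'' = (\<lambda>x. w'' x + (- \<kappa>) * \<psi>'' x)"
    define E X D F where "E = ip e e" and "X = (e' 1)\<^sup>2" and "D = ip e' e'" and "F = ip d d"
    have nn: "0 \<le> E" "0 \<le> X" "0 \<le> D" "0 \<le> F" by (simp_all add: E_def X_def D_def F_def ip_nonneg)
    obtain y' y'' where y: "C2_on01 (P.pinv e) y' y''" by (rule P.pinv_C2[OF e]) blast
    obtain z' z'' where z: "C2_on01 (P.pinv v) z' z''" "P.pop' (P.pinv v) z' 0 = 0"
      "M 1 * P.pinv v 1 = Z1 * (z' 1 + (y' 1 + \<kappa> * \<phi>' 1))"
      "\<And>x. x \<in> {0..1} \<Longrightarrow> P.gen (P.pop (P.pinv v)) (P.pop' (P.pinv v) z') (P.pop'' (P.pinv v) z' z'') x = P.gen v v' v'' x"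
      by (rule lifted_boundary[OF w e w0 w1 y, folded \<kappa>_def, folded v_def v'_def v''_def]) blast
    define Z where "Z = ip (P.pinv v) (P.pinv v)"
    have vc: "continuous_on {0..1} v" unfolding v_def by (intro continuous_intros wc sc)
    have gc: "continuous_on {0..1} (P.gen \<psi> \<psi>' \<psi>'')" by (rule P.gen_cont[OF psi_C2])
    \<comment> \<open>The source in the equation for \<open>v\<close>: the disturbance, the
      generator applied to the lifting, and the rate of \<open>\<kappa>\<close>.\<close>
    define G where "G = (\<lambda>x. d x + (\<kappa> * P.gen \<psi> \<psi>' \<psi>'' x - \<kappa>' * \<psi> x))"
    have Gc: "continuous_on {0..1} G" unfolding G_def by (intro continuous_intros d gc sc)
    have "2 * ip (\<lambda>x. wt x - \<kappa>' * \<psi> x) (P.pinv v) \<le> - \<delta> * \<epsilon> * Z + Cs * ((y' 1 + \<kappa> * \<phi>' 1)\<^sup>2 + ip G G)"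
      unfolding Z_def
    proof (rule state[OF z(1-3) Gc])
      fix x :: real assume x: "x \<in> {0..1}"
      show "wt x - \<kappa>' * \<psi> x = P.gen (P.pop (P.pinv v)) (P.pop' (P.pinv v) z') (P.pop'' (P.pinv v) z' z'') x + G x"
        unfolding z(4)[OF x] wt[OF x]
        by (simp add: P.gen_def v_def v'_def v''_def G_def algebra_simps)
    qed
    moreover have k2: "\<kappa>\<^sup>2 \<le> K * E"
      unfolding \<kappa>_def K_def E_def by (rule ip_cauchy_schwarz[OF k_cont ec(3)])
    moreover have "(y' 1 + \<kappa> * \<phi>' 1)\<^sup>2 \<le> Cd * (E + X)"
    proof -
      have "(y' 1 + \<kappa> * \<phi>' 1)\<^sup>2 \<le> 2 * (y' 1)\<^sup>2 + 2 * (\<kappa> * \<phi>' 1)\<^sup>2"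
        using zero_le_power2[of "y' 1 - \<kappa> * \<phi>' 1"] by (simp add: power2_eq_square algebra_simps)
      also have "(y' 1)\<^sup>2 \<le> Cb * ((e 1)\<^sup>2 + (e' 1)\<^sup>2 + ip e e)" by (rule bdry[OF e y])
      also have "(e 1)\<^sup>2 = O2\<^sup>2 * X" by (simp add: e1 X_def power_mult_distrib)
      also have "(\<kappa> * \<phi>' 1)\<^sup>2 \<le> (\<phi>' 1)\<^sup>2 * (K * E)"
        using mult_left_mono[OF k2 zero_le_power2[of "\<phi>' 1"]] by (simp add: power_mult_distrib mult.commute)
      also have "2 * (Cb * (O2\<^sup>2 * X + (e' 1)\<^sup>2 + ip e e)) + 2 * ((\<phi>' 1)\<^sup>2 * (K * E))
          = (2 * Cb * (O2\<^sup>2 + 1)) * X + (2 * Cb) * E + (2 * (\<phi>' 1)\<^sup>2 * K) * E"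
        by (simp add: X_def E_def algebra_simps)
      also have "\<dots> \<le> Cd * X + (2 * Cb * (O2\<^sup>2 + 1)) * E + (2 * (\<phi>' 1)\<^sup>2 * K) * E"
        using nn Cb n0 by (intro add_mono mult_right_mono) (auto simp: Cd_def mult_left_le_one_le distrib_left)
      also have "\<dots> = Cd * (E + X)" by (simp add: Cd_def algebra_simps)
      finally show ?thesis by simp
    qed
    moreover have "ip G G \<le> Cg * (E + X + D + F)"
    proof -
      have c1: "continuous_on {0..1} (\<lambda>x. \<kappa> * P.gen \<psi> \<psi>' \<psi>'' x)" "continuous_on {0..1} (\<lambda>x. \<kappa>' * \<psi> x)"
        by (intro continuous_intros gc sc)+
      have "ip G G \<le> 2 * ip d d + 2 * ip (\<lambda>x. \<kappa> * P.gen \<psi> \<psi>' \<psi>'' x - \<kappa>' * \<psi> x) (\<lambda>x. \<kappa> * P.gen \<psi> \<psi>' \<psi>'' x - \<kappa>' * \<psi> x)"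
        unfolding G_def by (rule ip_sum_sq[OF d]) (intro continuous_intros c1)
      moreover have "ip (\<lambda>x. \<kappa> * P.gen \<psi> \<psi>' \<psi>'' x - \<kappa>' * \<psi> x) (\<lambda>x. \<kappa> * P.gen \<psi> \<psi>' \<psi>'' x - \<kappa>' * \<psi> x) \<le> 2 * (\<kappa>\<^sup>2 * A) + 2 * (\<kappa>'\<^sup>2 * Y)"
        using ip_diff_sq[OF c1] by (simp add: ip_scale_left ip_scale_right A_def Y_def power2_eq_square mult.assoc)
      moreover have "\<kappa>\<^sup>2 * A \<le> A * K * (E + X + D + F)"
      proof -
        have "\<kappa>\<^sup>2 * A \<le> (K * E) * A" using k2 n0 by (intro mult_right_mono) auto
        also have "\<dots> = A * K * E" by simp
        also have "\<dots> \<le> A * K * (E + X + D + F)" using n0 nn by (intro mult_left_mono) auto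
        finally show ?thesis .
      qed
      moreover have "\<kappa>'\<^sup>2 * Y \<le> Y * Ck * (E + X + D + F)"
      proof -
        have "\<kappa>'\<^sup>2 \<le> Ck * (E + X + D + F)"
          unfolding \<kappa>'_def E_def X_def D_def F_def by (rule rate[OF e e0 d et])
        from mult_right_mono[OF this n0(3)] show ?thesis by (simp add: mult_ac)
      qed
      moreover have "F \<le> E + X + D + F" using nn by simp
      ultimately show ?thesis by (simp add: Cg_def F_def[symmetric] distrib_right)
    qed
    moreover have "Cd * (E + X) \<le> Cd * (E + X + D + F)" using Cd0 nn by (intro mult_left_mono) auto
    ultimately have "2 * ip (\<lambda>x. wt x - \<kappa>' * \<psi> x) (P.pinv v) \<le> - \<delta> * \<epsilon> * Z + Cs * (Cd * (E + X + D + F) + Cg * (E + X + D + F))"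
      using Cs by (meson add_left_mono add_mono mult_left_mono order_trans)
    also have "\<dots> = - \<delta> * \<epsilon> * Z + C4 * (E + X + D + F)" by (simp add: C4_def algebra_simps)
    finally have 1: "2 * ip (\<lambda>x. wt x - \<kappa>' * \<psi> x) (P.pinv v) \<le> - \<delta> * \<epsilon> * Z + C4 * (E + X + D + F)" .
    have 2: "\<mu>1 * (2 * ip et e) \<le> - C4 * D + \<mu>1 * C3 * (E + X + F)"
    proof -
      have "\<mu>1 * (2 * ip et e) \<le> \<mu>1 * (- \<alpha> * D + C3 * (E + X + F))"
        unfolding E_def X_def D_def F_def by (intro mult_left_mono energy[OF e e0 e1 d et] \<mu>1)
      also have "\<dots> = - (\<mu>1 * \<alpha>) * D + \<mu>1 * C3 * (E + X + F)" by (simp add: algebra_simps)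
      finally show ?thesis by (simp add: \<mu>1)
    qed
    have 3: "\<mu>2 * (2 * ip et (S.pop e)) \<le> - (C5 + 1) * (E + X) + \<mu>2 * C2 * F"
    proof -
      have "\<mu>2 * (2 * ip et (S.pop e)) \<le> \<mu>2 * (- \<kappa>2 * E - \<kappa>2 * X + C2 * F)"
        unfolding E_def X_def D_def F_def by (intro mult_left_mono obs[OF e e0 e1 d et] \<mu>2)
      also have "\<dots> = - (\<mu>2 * \<kappa>2) * (E + X) + \<mu>2 * C2 * F" by (simp add: algebra_simps)
      finally show ?thesis by (simp only: \<mu>2)
    qed
    have "ip w w \<le> Cw * (Z + E)"
    proof -
      have pv: "P.pop (P.pinv v) x + \<kappa> * \<psi> x = w x" if "x \<in> {0..1}" for x
        unfolding P.pop_pinv[OF vc that] by (simp add: v_def)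
      have "ip w w = ip (\<lambda>x. P.pop (P.pinv v) x + \<kappa> * \<psi> x) (\<lambda>x. P.pop (P.pinv v) x + \<kappa> * \<psi> x)"
        by (intro ip_cong pv[symmetric])
      also have "\<dots> \<le> 2 * ip (P.pop (P.pinv v)) (P.pop (P.pinv v)) + 2 * ip (\<lambda>x. \<kappa> * \<psi> x) (\<lambda>x. \<kappa> * \<psi> x)"
        by (rule ip_sum_sq) (intro continuous_intros P.pop_cont C2_on01D(3)[OF z(1)] sc)+
      also have "\<dots> \<le> 2 * (B * Z) + 2 * (K * E * Y)"
      proof -
        have "\<kappa>\<^sup>2 * Y \<le> K * E * Y" using k2 n0 by (intro mult_right_mono) auto
        then show ?thesis
          using B(2)[OF C2_on01D(3)[OF z(1)]]
          by (simp add: Z_def Y_def ip_scale_left ip_scale_right power2_eq_square mult.assoc)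
      qed
      also have "\<dots> = (2 * B) * Z + (2 * K * Y) * E" by simp
      also have "\<dots> \<le> Cw * Z + Cw * E"
        using Cw nn by (intro add_mono mult_right_mono) (auto simp: Z_def ip_nonneg)
      finally show ?thesis by (simp add: distrib_left)
    qed
    then have "\<sigma> * ip w w \<le> \<sigma> * (Cw * (Z + E))" using \<sigma> by (intro mult_left_mono) auto
    also have "\<dots> = min (\<delta> * \<epsilon>) 1 * (Z + E)" using Cw by (simp add: \<sigma>_def)
    also have "\<dots> = min (\<delta> * \<epsilon>) 1 * Z + min (\<delta> * \<epsilon>) 1 * E" by (simp add: distrib_left)
    also have "\<dots> \<le> \<delta> * \<epsilon> * Z + 1 * E" using nn by (intro add_mono mult_right_mono) (auto simp: Z_def ip_nonneg)
    finally have 4: "\<sigma> * ip w w \<le> \<delta> * \<epsilon> * Z + E" by simp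
    have "2 * ip (\<lambda>x. wt x - \<kappa>' * \<psi> x) (P.pinv v) + \<mu>1 * (2 * ip et e) + \<mu>2 * (2 * ip et (S.pop e))
        \<le> - \<sigma> * ip w w + (C5 + \<mu>2 * C2) * F"
      using 1 2 3 4 nn by (simp add: C5_def algebra_simps)
    then show "2 * ip (\<lambda>x. wt x - ip k et * \<psi> x) (P.pinv (\<lambda>x. w x - ip k e * \<psi> x)) + \<mu>1 * (2 * ip et e) + \<mu>2 * (2 * ip et (S.pop e))
        \<le> - \<sigma> * ip w w + (C5 + \<mu>2 * C2) * ip d d"
      by (simp add: v_def \<kappa>_def \<kappa>'_def F_def)
  qed (use \<mu>1 \<mu>2 \<sigma> in auto)
qed

end

section \<open>The gain estimate\<close>

lemma set_lborel_integral_Icc_eq: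
  fixes h :: "real \<Rightarrow> real"
  assumes "continuous_on {s..t} h"
  shows "set_integrable lborel {s..t} h" "(LBINT x:{s..t}. h x) = integral {s..t} h"
  using borel_integrable_atLeastAtMost'[OF assms] by (auto intro: set_borel_integral_eq_integral)

text \<open>The differential equation determines \<open>f\<close> only in the open interval; the end
  points are a null set.\<close>

lemma norm_L2_01_sq:
  assumes h: "continuous_on {0..1} h" and eq: "\<And>x. x \<in> {0<..<1} \<Longrightarrow> f x = h x"
  shows "(norm_L2_01 f)\<^sup>2 = ip h h"
proof -
  have "(LBINT x:{0..1}. (f x)\<^sup>2) = (LBINT x:{0..1}. (h x)\<^sup>2)"
    unfolding set_lebesgue_integral_def
    by (rule integral_discrete_difference[of "{0, 1}"]) (auto simp: eq indicator_def)
  also have "\<dots> = ip h h"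
    by (subst set_lborel_integral_Icc_eq) (auto intro!: continuous_intros h simp: ip_def power2_eq_square)
  finally show ?thesis by (simp add: norm_L2_01_def ip_nonneg)
qed

text \<open>The inequality is integrated over compact intervals of positive times, and monotone
  convergence then yields the integrability of \<open>W\<close> together with the bound.\<close>

lemma gain_from_dissipation:
  fixes V V' W F :: "real \<Rightarrow> real"
  assumes V: "\<And>t. 0 < t \<Longrightarrow> (V has_real_derivative V' t) (at t)"
    and V': "\<And>t. 0 < t \<Longrightarrow> V' t \<le> - \<sigma> * W t + C * F t"
    and V0: "\<And>t. 0 < t \<Longrightarrow> 0 \<le> V t" "(V \<longlongrightarrow> 0) (at_right 0)"
    and W: "continuous_on {0<..} W" "\<And>t. 0 < t \<Longrightarrow> 0 \<le> W t"
    and F: "continuous_on {0<..} F" "\<And>t. 0 < t \<Longrightarrow> 0 \<le> F t" "set_integrable lborel {0<..} F"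
    and \<sigma>: "0 < \<sigma>" and C: "0 \<le> C"
  shows "set_integrable lborel {0<..} W" "(LBINT t:{0<..}. W t) \<le> C / \<sigma> * (LBINT t:{0<..}. F t)"
proof -
  define I where "I = (LBINT t:{0<..}. F t)"
  have bound: "integral {s..T} W \<le> (V s + C * I) / \<sigma>" if s: "0 < s" "s \<le> T" for s T
  proof -
    have sub: "{s..T} \<subseteq> {0<..}" using s by auto
    have Wc: "continuous_on {s..T} W" and Fc: "continuous_on {s..T} F"
      using W(1) F(1) sub by (auto intro: continuous_on_subset)
    \<comment> \<open>\<open>U\<close> has a nonpositive derivative, and the fundamental theorem
      gives \<open>U T \<le> U s\<close> from the existence of the derivative alone, without
      continuity of \<open>V'\<close>.\<close>
    define U where "U = (\<lambda>t. V t + integral {s..t} (\<lambda>r. \<sigma> * W r - C * F r))"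
    have "((\<lambda>t. V' t + (\<sigma> * W t - C * F t)) has_integral U T - U s) {s..T}"
    proof (rule fundamental_theorem_of_calculus[OF s(2)])
      fix t assume "t \<in> {s..T}"
      then have "(U has_real_derivative V' t + (\<sigma> * W t - C * F t)) (at t within {s..T})"
        unfolding U_def using s
        by (intro DERIV_add has_field_derivative_at_within[OF V] integral_has_real_derivative continuous_intros Wc Fc) auto
      then show "(U has_vector_derivative V' t + (\<sigma> * W t - C * F t)) (at t within {s..T})"
        by (simp add: has_real_derivative_iff_has_vector_derivative)
    qed
    moreover have "V' t + (\<sigma> * W t - C * F t) \<le> 0" if "t \<in> {s..T}" for t
      using V'[of t] s that by simp
    ultimately have "U T - U s \<le> 0" by (rule has_integral_le[OF _ has_integral_0])
    then have "V T + integral {s..T} (\<lambda>r. \<sigma> * W r - C * F r) \<le> V s" by (simp add: U_def)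
    also have "integral {s..T} (\<lambda>r. \<sigma> * W r - C * F r) = \<sigma> * integral {s..T} W - C * integral {s..T} F"
      by (subst integral_diff) (auto intro!: integrable_continuous_real continuous_intros Wc Fc)
    finally have le: "\<sigma> * integral {s..T} W \<le> V s + C * integral {s..T} F" using V0(1)[of T] s by simp
    have "integral {s..T} F \<le> I"
    proof -
      have "integral {s..T} F = (LBINT t:{s..T}. F t)" using set_lborel_integral_Icc_eq[OF Fc] by simp
      also have "\<dots> \<le> I"
        unfolding I_def set_lebesgue_integral_def
        by (rule integral_mono) (use set_lborel_integral_Icc_eq(1)[OF Fc] F sub in \<open>auto simp: set_integrable_def indicator_def\<close>)
      finally show ?thesis .
    qed
    from mult_left_mono[OF this C] le show ?thesis using \<sigma> by (simp add: pos_le_divide_eq mult.commute)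
  qed
  \<comment> \<open>Left end points tending to 0: the differential inequality holds for positive
    times, and \<open>V\<close> is known at 0 only as a limit.\<close>
  define s where "s = (\<lambda>n::nat. 1 / real (Suc n))"
  have s: "0 < s n" "s n \<le> 1" "s n \<le> real (Suc n)" for n
  proof -
    show 1: "0 < s n" "s n \<le> 1" by (simp_all add: s_def)
    show "s n \<le> real (Suc n)" using 1(2) by (rule order_trans) simp
  qed
  have s_mono: "s n \<le> s m" if "m \<le> n" for m n using that by (simp add: s_def frac_le)
  have s_lim: "s \<longlonglongrightarrow> 0" unfolding s_def using LIMSEQ_inverse_real_of_nat by (simp add: inverse_eq_divide)
  have Vs: "(\<lambda>n. V (s n)) \<longlonglongrightarrow> 0"
    by (rule filterlim_compose[OF V0(2)])
      (use s_lim s(1) less_imp_neq[OF s(1)] in \<open>auto simp: filterlim_at intro!: always_eventually\<close>)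
  let ?f = "\<lambda>n t. indicator {s n..real (Suc n)} t *\<^sub>R W t"
  have Wc: "continuous_on {s n..real (Suc n)} W" for n
    by (rule continuous_on_subset[OF W(1)]) (use s(1)[of n] in auto)
  have fi: "integrable lborel (?f n)" and fe: "integral\<^sup>L lborel (?f n) = integral {s n..real (Suc n)} W" for n
    using set_lborel_integral_Icc_eq[OF Wc] by (auto simp: set_integrable_def set_lebesgue_integral_def)
  have mono: "mono (\<lambda>n. ?f n t)" for t
  proof (rule monoI)
    fix m n :: nat assume mn: "m \<le> n"
    have "real (Suc m) \<le> real (Suc n)" using mn by simp
    then show "?f m t \<le> ?f n t"
      using s_mono[OF mn] s(1)[of n] s(1)[of m] W(2)[of t] by (auto simp: indicator_def)
  qed
  have ub: "integral\<^sup>L lborel (?f n) \<le> (V (s n) + C * I) / \<sigma>" for n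
    unfolding fe by (rule bound) (use s in auto)
  \<comment> \<open>This crude bound is enough for the convergence of the increasing integrals; the
    sharp constant is recovered in the limit, where \<open>V (s n)\<close> vanishes.\<close>
  obtain B where B: "\<And>n. V (s n) \<le> B"
    using convergent_imp_Bseq[OF convergentI[OF Vs]] by (auto simp: Bseq_def abs_le_iff)
  have inc: "incseq (\<lambda>n. integral\<^sup>L lborel (?f n))"
    by (intro incseq_SucI integral_mono fi monoD[OF mono]) simp
  have "\<forall>n. integral\<^sup>L lborel (?f n) \<le> (B + C * I) / \<sigma>"
    using ub B \<sigma> by (meson add_right_mono divide_right_mono less_imp_le order_trans)
  from incseq_convergent[OF inc this] obtain L where L: "(\<lambda>n. integral\<^sup>L lborel (?f n)) \<longlonglongrightarrow> L" by blast
  have lim: "(\<lambda>n. ?f n t) \<longlonglongrightarrow> indicator {0<..} t *\<^sub>R W t" for t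
  proof (cases "0 < t")
    case True
    have "\<forall>\<^sub>F n in sequentially. s n < t" by (rule order_tendstoD(2)[OF s_lim True])
    moreover have "\<forall>\<^sub>F n in sequentially. t \<le> real (Suc n)"
      using eventually_ge_at_top[of "nat \<lceil>t\<rceil>"] by eventually_elim linarith
    ultimately have "\<forall>\<^sub>F n in sequentially. ?f n t = indicator {0<..} t *\<^sub>R W t"
      by eventually_elim (use True in auto)
    then show ?thesis by (rule tendsto_eventually)
  next
    case False
    have "?f n t = 0" for n using False s(1)[of n] by (auto simp: indicator_def)
    then show ?thesis using False by (intro tendsto_eventually always_eventually allI) simp
  qed
  have meas: "(\<lambda>t. indicator {0<..} t *\<^sub>R W t) \<in> borel_measurable lborel"
    using borel_measurable_continuous_on_indicator[OF _ W(1)] by simp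
  have ae: "AE t in lborel. mono (\<lambda>n. ?f n t)" "AE t in lborel. (\<lambda>n. ?f n t) \<longlonglongrightarrow> indicator {0<..} t *\<^sub>R W t"
    by (intro AE_I2 mono lim)+
  note r = integrable_monotone_convergence[OF fi ae L meas] integral_monotone_convergence[OF fi ae L meas]
  show "set_integrable lborel {0<..} W" using r(1) by (simp add: set_integrable_def)
  have "(\<lambda>n. (V (s n) + C * I) / \<sigma>) \<longlonglongrightarrow> (0 + C * I) / \<sigma>"
    by (intro tendsto_intros Vs) (use \<sigma> in auto)
  then have "L \<le> (0 + C * I) / \<sigma>"
    by (rule LIMSEQ_le[OF L]) (use ub in auto)
  then show "(LBINT t:{0<..}. W t) \<le> C / \<sigma> * (LBINT t:{0<..}. F t)"
    using r by (simp add: set_lebesgue_integral_def I_def)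
qed

lemma L2_time_if_continuous:
  assumes w: "continuous_on ({0..1} \<times> {0<..}) (\<lambda>(x, t). w x t)"
    and i: "set_integrable lborel {0<..} (\<lambda>t. ip (\<lambda>x. w x t) (\<lambda>x. w x t))"
  shows "L2_time w"
    and "norm_L2_time w = sqrt (LBINT t:{0<..}. ip (\<lambda>x. w x t) (\<lambda>x. w x t))"
proof -
  have sl: "continuous_on {0..1} (\<lambda>x. w x t)" if "0 < t" for t
  proof -
    have "continuous_on {0..1} (\<lambda>x. (x, t))" by (intro continuous_intros)
    from continuous_on_compose2[OF w this] that show ?thesis by auto
  qed
  have n: "(norm_L2_01 (\<lambda>x. w x t))\<^sup>2 = ip (\<lambda>x. w x t) (\<lambda>x. w x t)" if "0 < t" for t
    by (rule norm_L2_01_sq[OF sl[OF that]]) simp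
  have e: "(\<lambda>t. indicator {0<..} t *\<^sub>R (norm_L2_01 (\<lambda>x. w x t))\<^sup>2) = (\<lambda>t. indicator {0<..} t *\<^sub>R ip (\<lambda>x. w x t) (\<lambda>x. w x t))"
    by (auto simp: fun_eq_iff indicator_def n)
  show "L2_time w"
    unfolding L2_time_def
  proof (intro conjI)
    show "set_borel_measurable (lborel \<Otimes>\<^sub>M lborel) ({0..1} \<times> {0<..}) (\<lambda>(x, t). w x t)"
      unfolding set_borel_measurable_def lborel_prod
      using borel_measurable_continuous_on_indicator[OF _ w] by (simp add: borel_Times)
    show "AE t in lborel. 0 < t \<longrightarrow> L2_01 (\<lambda>x. w x t)"
      using L2_01_continuous[OF sl] by simp
    show "set_integrable lborel {0<..} (\<lambda>t. (norm_L2_01 (\<lambda>x. w x t))\<^sup>2)"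
      using i unfolding set_integrable_def e .
  qed
  show "norm_L2_time w = sqrt (LBINT t:{0<..}. ip (\<lambda>x. w x t) (\<lambda>x. w x t))"
    unfolding norm_L2_time_def set_lebesgue_integral_def e ..
qed

lemma continuous_on_ip_param:
  assumes "continuous_on ({0..1} \<times> {0<..}) (\<lambda>(x, t). w x t)"
  shows "continuous_on {0<..} (\<lambda>t. ip (\<lambda>x. w x t) (\<lambda>x. w x t))"
proof -
  have "continuous_on ({0<..} \<times> {0..1}) (\<lambda>(t, x). w x t * w x t)"
  proof -
    have "continuous_on ({0<..} \<times> {0..1}) (\<lambda>p. (\<lambda>(x, t). w x t) (snd p, fst p))"
      by (rule continuous_on_compose2[OF assms]) (auto intro!: continuous_intros)
    then show ?thesis by (auto simp: split_beta intro!: continuous_intros)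
  qed
  from integral_continuous_on_param[of "{0<..}" 0 1 "\<lambda>t x. w x t * w x t"] this show ?thesis
    by (simp add: ip_def cbox_interval)
qed

text \<open>Carries the error equation, given only inside the interval, to the end points.\<close>

lemma eq_on_Icc_if_eq_on_Ioo:
  fixes u v :: "real \<Rightarrow> real"
  assumes "continuous_on {0..1} u" "continuous_on {0..1} v" "\<And>x. x \<in> {0<..<1} \<Longrightarrow> u x = v x" "x \<in> {0..1}"
  shows "u x = v x"
proof -
  have "u x - v x = 0"
    by (rule continuous_constant_on_closure[of "{0<..<1}" "\<lambda>x. u x - v x"])
      (use assms in \<open>auto intro!: continuous_intros\<close>)
  then show ?thesis by simp
qed

section \<open>The gain of the closed loop\<close>

context observer_feedback
begin

lemma closed_loop_gain:
  assumes Fb: "\<And>u. continuous_on {0..1} u \<Longrightarrow> Fb u = Z1 * D01 (P.pinv u) 1 + ip K1at1 (P.pinv u)"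
  shows "\<exists>\<gamma>>0. \<forall>f w wh. L2_time f \<longrightarrow> coupled_solution a b c Fb (S.pinv R1) O2 f w wh \<longrightarrow>
           starts_at_rest w \<longrightarrow> starts_at_rest wh \<longrightarrow>
           L2_time w \<and> norm_L2_time w \<le> \<gamma> * norm_L2_time f"
proof -
  obtain \<mu>1 \<mu>2 \<sigma> C where c: "0 \<le> \<mu>1" "0 \<le> \<mu>2" "0 < \<sigma>" "0 \<le> C" and rate:
    "\<And>w w' w'' e e' e'' wt et d. C2_on01 w w' w'' \<Longrightarrow> C2_on01 e e' e'' \<Longrightarrow> continuous_on {0..1} d \<Longrightarrow>
      w' 0 = 0 \<Longrightarrow> e' 0 = 0 \<Longrightarrow> e 1 = O2 * e' 1 \<Longrightarrow>
      w 1 = Z1 * D01 (P.pinv (\<lambda>x. w x + e x)) 1 + ip K1at1 (P.pinv (\<lambda>x. w x + e x)) \<Longrightarrow>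
      (\<And>x. x \<in> {0..1} \<Longrightarrow> wt x = P.gen w w' w'' x + d x) \<Longrightarrow>
      (\<And>x. x \<in> {0..1} \<Longrightarrow> et x = P.gen e e' e'' x + S.pinv R1 x * e' 1 - d x) \<Longrightarrow>
      2 * ip (\<lambda>x. wt x - ip k et * \<psi> x) (P.pinv (\<lambda>x. w x - ip k e * \<psi> x)) + \<mu>1 * (2 * ip et e) + \<mu>2 * (2 * ip et (S.pop e))
        \<le> - \<sigma> * ip w w + C * ip d d"
  proof (rule closed_loop_rate, goal_cases)
    case (1 _) show ?case by (rule that[OF 1(2) 1(3) 1(4) 1(5)], rule 1(6), assumption+)
  qed
  obtain B where B: "0 < B" "\<And>z. continuous_on {0..1} z \<Longrightarrow> ip (S.pop z) (S.pop z) \<le> B * ip z z"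
    by (rule S.pop_bound) blast
  note sc = C2_on01D[OF psi_C2]
  have oc: "continuous_on {0..1} (S.pinv R1)" by (rule S.pinv_cont[OF R1_cont])
  \<comment> \<open>The summand 1 keeps the gain positive even for \<open>C = 0\<close>.\<close>
  define \<gamma> where "\<gamma> = sqrt (C / \<sigma>) + 1"
  have "0 < \<gamma>" using c by (simp add: \<gamma>_def add_nonneg_pos)
  moreover have "L2_time w \<and> norm_L2_time w \<le> \<gamma> * norm_L2_time f"
    if f: "L2_time f" and sol: "coupled_solution a b c Fb (S.pinv R1) O2 f w wh"
      and rest: "starts_at_rest w" "starts_at_rest wh" for f w wh
  proof -
    have cl: "classical w" "classical wh" using sol by (simp_all add: coupled_solution_def)
    have eq: "dt w x t = a x * dx (dx w) x t + b x * dx w x t + c x * w x t + f x t"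
      "dt wh x t = a x * dx (dx wh) x t + b x * dx wh x t + c x * wh x t + S.pinv R1 x * (dx wh 1 t - dx w 1 t)"
      if "0 < t" "x \<in> {0<..<1}" for x t using sol that by (simp_all add: coupled_solution_def)
    have bc: "dx w 0 t = 0" "w 1 t = Fb (\<lambda>x. wh x t)" "dx wh 0 t = 0"
      "wh 1 t = Fb (\<lambda>x. wh x t) + O2 * (dx wh 1 t - dx w 1 t)" if "0 < t" for t
      using sol that by (simp_all add: coupled_solution_def)
    note w = classical_slices[OF cl(1)] and wh = classical_slices[OF cl(2)]
    define e where "e = (\<lambda>t x. wh x t - w x t)"
    define e' where "e' = (\<lambda>t x. dx wh x t - dx w x t)"
    define e'' where "e'' = (\<lambda>t x. dx (dx wh) x t - dx (dx w) x t)"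
    have e: "C2_on01 (e t) (e' t) (e'' t)" if "0 < t" for t
      using C2_on01_lincomb[OF wh(1)[OF that] w(1)[OF that], of "-1"]
      by (simp add: e_def e'_def e''_def)
    \<comment> \<open>The residual of the state equation is jointly continuous and agrees with
      \<open>f\<close> inside the interval, so it stands in for \<open>f\<close> wherever continuity
      is used.\<close>
    define d where "d = (\<lambda>x t. dt w x t - (a x * dx (dx w) x t + b x * dx w x t + c x * w x t))"
    have dj: "continuous_on ({0..1} \<times> {0<..}) (\<lambda>(x, t). d x t)"
    proof -
      have p: "continuous_on ({0..1} \<times> {0<..}) (\<lambda>z. q (fst z))" if "continuous_on {0..1} q" for q :: "real \<Rightarrow> real"
        by (rule continuous_on_compose2[OF that]) (auto intro!: continuous_intros)
      show ?thesis
        using classicalD(4-7)[OF cl(1)] p[OF P.abc_cont(1)] p[OF P.abc_cont(2)] p[OF P.abc_cont(3)]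
        unfolding d_def split_beta by (intro continuous_intros)
    qed
    have dc: "continuous_on {0..1} (\<lambda>x. d x t)" if "0 < t" for t
      unfolding d_def by (intro continuous_intros w(2)[OF that] C2_on01D[OF w(1)[OF that]] P.abc_cont)
    have df: "f x t = d x t" if "0 < t" "x \<in> {0<..<1}" for x t
      using eq(1)[OF that] by (simp add: d_def)
    define wt where "wt = (\<lambda>t x. dt w x t)"
    define et where "et = (\<lambda>t x. dt wh x t - dt w x t)"
    have wt: "wt t x = P.gen (\<lambda>x. w x t) (\<lambda>x. dx w x t) (\<lambda>x. dx (dx w) x t) x + d x t" for t x
      by (simp add: wt_def d_def P.gen_def)
    have et: "et t x = P.gen (e t) (e' t) (e'' t) x + S.pinv R1 x * e' t 1 - d x t" if t: "0 < t" and x: "x \<in> {0..1}" for t x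
    proof (rule eq_on_Icc_if_eq_on_Ioo[OF _ _ _ x])
      show "continuous_on {0..1} (et t)" unfolding et_def by (intro continuous_intros w(2)[OF t] wh(2)[OF t])
      show "continuous_on {0..1} (\<lambda>x. P.gen (e t) (e' t) (e'' t) x + S.pinv R1 x * e' t 1 - d x t)"
        by (intro continuous_intros P.gen_cont[OF e[OF t]] oc dc[OF t])
      show "et t x = P.gen (e t) (e' t) (e'' t) x + S.pinv R1 x * e' t 1 - d x t" if "x \<in> {0<..<1}" for x
        using eq(2)[OF t that] by (simp add: et_def d_def P.gen_def e_def e'_def e''_def algebra_simps)
    qed
    have sw: "slice_deriv (\<lambda>s x. w x s) (wt t) t" and se: "slice_deriv e (et t) t" if "0 < t" for t
      unfolding wt_def et_def e_def
      by (intro slice_deriv_diff classical_slice_deriv cl that)+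
    define v where "v = (\<lambda>t x. w x t - ip k (e t) * \<psi> x)"
    \<comment> \<open>The lifted state is measured through the inverse of the operator, and the two
      error functionals carry the weights from \<open>closed_loop_rate\<close>.\<close>
    define V where "V = (\<lambda>t. ip (v t) (P.pinv (v t)) + \<mu>1 * ip (e t) (e t) + \<mu>2 * ip (e t) (S.pop (e t)))"
    define V' where "V' = (\<lambda>t. 2 * ip (\<lambda>x. wt t x - ip k (et t) * \<psi> x) (P.pinv (v t))
      + \<mu>1 * (2 * ip (et t) (e t)) + \<mu>2 * (2 * ip (et t) (S.pop (e t))))"
    define W where "W = (\<lambda>t. ip (\<lambda>x. w x t) (\<lambda>x. w x t))"
    define F where "F = (\<lambda>t. ip (\<lambda>x. d x t) (\<lambda>x. d x t))"
    have vc: "continuous_on {0..1} (v t)" if "0 < t" for t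
      unfolding v_def by (intro continuous_intros C2_on01D[OF w(1)[OF that]] sc)
    have dV: "(V has_real_derivative V' t) (at t)" if t: "0 < t" for t
    proof -
      have "slice_deriv v (\<lambda>x. wt t x - ip k (et t) * \<psi> x) t"
        unfolding v_def by (intro slice_deriv_diff sw[OF t] slice_deriv_scale ip_slice_deriv[OF se[OF t] k_cont] sc)
      from quadratic_slice_deriv[OF this P.pinv_cont P.pinv_sym P.pinv_bound]
      have 1: "((\<lambda>s. ip (v s) (P.pinv (v s))) has_real_derivative 2 * ip (\<lambda>x. wt t x - ip k (et t) * \<psi> x) (P.pinv (v t))) (at t)"
        by blast
      have 2: "((\<lambda>s. ip (e s) (e s)) has_real_derivative 2 * ip (et t) (e t)) (at t)"
        by (rule quadratic_slice_deriv[OF se[OF t], of "\<lambda>u. u" 1]) auto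
      from quadratic_slice_deriv[OF se[OF t] S.pop_cont S.pop_sym B(2)]
      have 3: "((\<lambda>s. ip (e s) (S.pop (e s))) has_real_derivative 2 * ip (et t) (S.pop (e t))) (at t)" by blast
      show ?thesis unfolding V_def V'_def by (intro DERIV_add DERIV_cmult 1 2 3)
    qed
    have V'_le: "V' t \<le> - \<sigma> * W t + C * F t" if t: "0 < t" for t
      unfolding V'_def W_def F_def v_def
    proof (rule rate[OF w(1)[OF t] e[OF t] dc[OF t]])
      have we: "(\<lambda>x. w x t + e t x) = (\<lambda>x. wh x t)" by (simp add: e_def)
      show "w 1 t = Z1 * D01 (P.pinv (\<lambda>x. w x t + e t x)) 1 + ip K1at1 (P.pinv (\<lambda>x. w x t + e t x))"
        unfolding we bc(2)[OF t] by (rule Fb[OF C2_on01D(3)[OF wh(1)[OF t]]])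
      show "dx w 0 t = 0" by (rule bc(1)[OF t])
      show "e' t 0 = 0" by (simp add: e'_def bc t)
      show "e t 1 = O2 * e' t 1" using bc(2,4)[OF t] by (simp add: e_def e'_def)
    qed (use wt et[OF t] in auto)
    have V_ge: "0 \<le> V t" if t: "0 < t" for t
    proof -
      have "ip (v t) (P.pinv (v t)) = ip (P.pinv (v t)) (P.pop (P.pinv (v t)))"
        unfolding ip_commute[of "v t"] by (rule ip_cong) (simp_all add: P.pop_pinv[OF vc[OF t]])
      moreover have "0 \<le> \<epsilon> * ip (P.pinv (v t)) (P.pinv (v t))" "0 \<le> \<epsilon> * ip (e t) (e t)"
        using P.eps by (simp_all add: ip_nonneg)
      ultimately show ?thesis
        using P.pop_coercive[OF P.pinv_cont[OF vc[OF t]]] S.pop_coercive[OF C2_on01D(3)[OF e[OF t]]] c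
        by (simp add: V_def ip_nonneg)
    qed
    \<comment> \<open>One summand for each part of \<open>V\<close>. The upper bound serves the
      limit at 0: the norms of \<open>w\<close> and \<open>wh\<close> tend to 0 there, and
      \<open>V\<close> follows.\<close>
    define L where "L = (1 + 1 / \<epsilon>\<^sup>2) * (2 + 4 * ip k k * ip \<psi> \<psi>) + 2 * \<mu>1 + \<mu>2 * (2 * (1 + B))"
    have V_le: "V t \<le> L * (W t + ip (\<lambda>x. wh x t) (\<lambda>x. wh x t))" if t: "0 < t" for t
    proof -
      let ?E = "ip (e t) (e t)" and ?H = "ip (\<lambda>x. wh x t) (\<lambda>x. wh x t)"
      have wc: "continuous_on {0..1} (\<lambda>x. w x t)" "continuous_on {0..1} (\<lambda>x. wh x t)" "continuous_on {0..1} (e t)"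
        using C2_on01D(3) w(1)[OF t] wh(1)[OF t] e[OF t] by blast+
      have n: "0 \<le> W t" "0 \<le> ?H" "0 \<le> ip k k" "0 \<le> ip \<psi> \<psi>" "0 \<le> 1 / \<epsilon>\<^sup>2" by (simp_all add: W_def ip_nonneg)
      have E: "?E \<le> 2 * (W t + ?H)"
        using ip_diff_sq[OF wc(2,1)] by (simp add: e_def W_def)
      have "ip (v t) (v t) \<le> 2 * W t + 2 * ip (\<lambda>x. ip k (e t) * \<psi> x) (\<lambda>x. ip k (e t) * \<psi> x)"
        unfolding v_def W_def by (intro ip_diff_sq continuous_intros wc sc)
      also have "ip (\<lambda>x. ip k (e t) * \<psi> x) (\<lambda>x. ip k (e t) * \<psi> x) = (ip k (e t))\<^sup>2 * ip \<psi> \<psi>"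
        by (simp add: ip_scale_left ip_scale_right power2_eq_square)
      also have "(ip k (e t))\<^sup>2 * ip \<psi> \<psi> \<le> (ip k k * ?E) * ip \<psi> \<psi>"
        by (intro mult_right_mono ip_cauchy_schwarz k_cont wc n)
      also have "(ip k k * ?E) * ip \<psi> \<psi> = (ip k k * ip \<psi> \<psi>) * ?E" by simp
      also have "\<dots> \<le> (ip k k * ip \<psi> \<psi>) * (2 * (W t + ?H))"
        using E n by (intro mult_left_mono) auto
      finally have "ip (v t) (v t) \<le> 2 * (W t + ?H) + 4 * (ip k k * ip \<psi> \<psi>) * (W t + ?H)"
        using n(2) by (simp add: algebra_simps)
      then have v: "ip (v t) (v t) \<le> (2 + 4 * ip k k * ip \<psi> \<psi>) * (W t + ?H)" by (simp add: algebra_simps)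
      have "ip (v t) (P.pinv (v t)) \<le> 2 * \<bar>ip (v t) (P.pinv (v t))\<bar>" by simp
      also have "\<dots> \<le> ip (v t) (v t) + ip (P.pinv (v t)) (P.pinv (v t))"
        using ip_young[OF vc[OF t] P.pinv_cont[OF vc[OF t]], of 1] by simp
      also have "\<dots> \<le> (1 + 1 / \<epsilon>\<^sup>2) * ip (v t) (v t)"
        using P.pinv_bound[OF vc[OF t]] by (simp add: distrib_right)
      also have "\<dots> \<le> (1 + 1 / \<epsilon>\<^sup>2) * ((2 + 4 * ip k k * ip \<psi> \<psi>) * (W t + ?H))"
        using n by (intro mult_left_mono v) auto
      finally have 1: "ip (v t) (P.pinv (v t)) \<le> (1 + 1 / \<epsilon>\<^sup>2) * (2 + 4 * ip k k * ip \<psi> \<psi>) * (W t + ?H)"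
        by (simp only: mult.assoc)
      have 2: "\<mu>1 * ?E \<le> 2 * \<mu>1 * (W t + ?H)" using mult_left_mono[OF E c(1)] by (simp add: algebra_simps)
      have "ip (e t) (S.pop (e t)) \<le> 2 * \<bar>ip (e t) (S.pop (e t))\<bar>" by simp
      also have "\<dots> \<le> ?E + ip (S.pop (e t)) (S.pop (e t))"
        using ip_young[OF wc(3) S.pop_cont[OF wc(3)], of 1] by simp
      also have "\<dots> \<le> (1 + B) * ?E" using B(2)[OF wc(3)] by (simp add: distrib_right)
      also have "\<dots> \<le> (1 + B) * (2 * (W t + ?H))" using B(1) E by (intro mult_left_mono) auto
      finally have "\<mu>2 * ip (e t) (S.pop (e t)) \<le> \<mu>2 * ((1 + B) * (2 * (W t + ?H)))" using c by (intro mult_left_mono)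
      then have 3: "\<mu>2 * ip (e t) (S.pop (e t)) \<le> \<mu>2 * (2 * (1 + B)) * (W t + ?H)" by (simp only: mult_ac)
      show ?thesis using 1 2 3 unfolding V_def L_def distrib_right by linarith
    qed
    have V_lim: "(V \<longlongrightarrow> 0) (at_right 0)"
    proof (rule tendsto_sandwich[OF _ _ tendsto_const])
      have pos: "\<forall>\<^sub>F t in at_right 0. (0::real) < t" by (simp add: eventually_at_filter)
      show "\<forall>\<^sub>F t in at_right 0. 0 \<le> V t" using pos by eventually_elim (rule V_ge)
      let ?n = "\<lambda>t. L * ((norm_L2_01 (\<lambda>x. w x t))\<^sup>2 + (norm_L2_01 (\<lambda>x. wh x t))\<^sup>2)"
      show "\<forall>\<^sub>F t in at_right 0. V t \<le> ?n t"
        using pos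
      proof eventually_elim
        case (elim t)
        have "(norm_L2_01 (\<lambda>x. w x t))\<^sup>2 = W t" "(norm_L2_01 (\<lambda>x. wh x t))\<^sup>2 = ip (\<lambda>x. wh x t) (\<lambda>x. wh x t)"
          unfolding W_def by (rule norm_L2_01_sq[OF C2_on01D(3)[OF w(1)[OF elim]] refl]
              norm_L2_01_sq[OF C2_on01D(3)[OF wh(1)[OF elim]] refl])+
        then show ?case using V_le[OF elim] by simp
      qed
      have "(?n \<longlongrightarrow> L * (0\<^sup>2 + 0\<^sup>2)) (at_right 0)"
        using rest unfolding starts_at_rest_def by (intro tendsto_intros)
      then show "(?n \<longlongrightarrow> 0) (at_right 0)" by simp
    qed
    have nf: "(norm_L2_01 (\<lambda>x. f x t))\<^sup>2 = F t" if "0 < t" for t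
      unfolding F_def by (rule norm_L2_01_sq[OF dc[OF that] df[OF that]])
    have fF: "(\<lambda>t. indicator {0<..} t *\<^sub>R (norm_L2_01 (\<lambda>x. f x t))\<^sup>2) = (\<lambda>t. indicator {0<..} t *\<^sub>R F t)"
      by (auto simp: fun_eq_iff indicator_def nf)
    have F_int: "set_integrable lborel {0<..} F"
      using f unfolding L2_time_def set_integrable_def fF by blast
    have Fc: "continuous_on {0<..} F" and Wc: "continuous_on {0<..} W"
      unfolding F_def W_def by (intro continuous_on_ip_param dj classicalD(4)[OF cl(1)])+
    have F0: "0 \<le> F t" and W0: "0 \<le> W t" for t by (simp_all add: F_def W_def ip_nonneg)
    note gain = gain_from_dissipation[OF dV V'_le V_ge V_lim Wc W0 Fc F0 F_int c(3,4)]
    note n = L2_time_if_continuous[OF classicalD(4)[OF cl(1)] gain(1)[unfolded W_def]]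
    have "norm_L2_time w = sqrt (LBINT t:{0<..}. W t)" using n(2) by (simp add: W_def)
    also have "\<dots> \<le> sqrt (C / \<sigma> * (LBINT t:{0<..}. F t))" by (intro real_sqrt_le_mono gain)
    also have "\<dots> = sqrt (C / \<sigma>) * norm_L2_time f"
      unfolding norm_L2_time_def set_lebesgue_integral_def fF by (simp only: real_sqrt_mult)
    also have "\<dots> \<le> \<gamma> * norm_L2_time f"
      unfolding \<gamma>_def norm_L2_time_def set_lebesgue_integral_def fF
      by (intro mult_right_mono real_sqrt_ge_zero integral_nonneg_AE) (auto simp: F0)
    finally show ?thesis using n(1) by blast
  qed
  ultimately show ?thesis by blast
qed

end

section \<open>The two maps evaluated on separable kernels\<close>

lemma deriv_sum_scaled:
  assumes "\<And>k. real_polynomial_function (p k)"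
  shows "deriv (\<lambda>s. \<Sum>k<m. p k s * y k) = (\<lambda>x. \<Sum>k<m. deriv (p k) x * y k)"
  by (rule ext, rule DERIV_imp_deriv) (intro DERIV_sum DERIV_cmult_right poly_fun_deriv(2) assms)

lemma sum_scaled_poly:
  assumes "\<And>k. real_polynomial_function (p k)"
  shows "real_polynomial_function (\<lambda>s. \<Sum>k<(m::nat). p k s * y k)"
  using assms by (intro real_polynomial_function_sum real_polynomial_function.intros(4) real_polynomial_function.intros(2)) auto

context lyapunov_data
begin

text \<open>\<open>map_N\<close> is written in divergence form with the reaction term apart, whereas
  \<open>adjp\<close> is expanded and contains it.\<close>

lemma adjp_eq:
  assumes p: "real_polynomial_function p"
  shows "deriv (\<lambda>r. deriv (\<lambda>s. a s * p s) r - b r * p r) x + c x * p x = adjp p x"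
proof -
  note p' = poly_fun_deriv(2)[OF p] poly_fun_deriv(2)[OF poly_fun_deriv(1)[OF p]]
  have "deriv (\<lambda>s. a s * p s) = (\<lambda>r. deriv a r * p r + deriv p r * a r)"
    by (rule ext, rule DERIV_imp_deriv) (intro DERIV_mult abc_deriv p')
  moreover have "deriv (\<lambda>r. deriv a r * p r + deriv p r * a r - b r * p r) x
      = deriv (deriv a) x * p x + deriv p x * deriv a x + (deriv (deriv p) x * a x + deriv a x * deriv p x)
        - (deriv b x * p x + deriv p x * b x)"
    by (rule DERIV_imp_deriv) (intro DERIV_mult DERIV_add DERIV_diff abc_deriv p')
  ultimately show ?thesis by (simp add: adjp_def algebra_simps)
qed

lemma genp_sum_scaled:
  assumes p: "\<And>k. real_polynomial_function (p k)"
  shows "genp (\<lambda>s. \<Sum>k<m. p k s * y k) x = (\<Sum>k<m. genp (p k) x * y k)"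
    and "adjp (\<lambda>s. \<Sum>k<m. p k s * y k) x = (\<Sum>k<m. adjp (p k) x * y k)"
  unfolding genp_def gen_def adjp_def deriv_sum_scaled[OF p] deriv_sum_scaled[OF poly_fun_deriv(1)[OF p]]
  by (simp_all add: sum_distrib_left sum.distrib[symmetric] algebra_simps)

lemma state_kernel_eq:
  assumes K: "\<And>x \<xi>. K x \<xi> = (\<Sum>k<n. f k x * g k \<xi>)"
  shows "genp (\<lambda>s. K s \<xi>) x + genp (\<lambda>s. K x s) \<xi> = state_kernel x \<xi>"
proof -
  have "genp (\<lambda>s. K s \<xi>) x = (\<Sum>k<n. genp (f k) x * g k \<xi>)"
    unfolding K by (rule genp_sum_scaled(1)[OF f_poly])
  moreover have "(\<lambda>s. K x s) = (\<lambda>s. \<Sum>k<n. g k s * f k x)" by (simp add: K mult.commute)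
  then have "genp (\<lambda>s. K x s) \<xi> = (\<Sum>k<n. genp (g k) \<xi> * f k x)"
    by (simp only: genp_sum_scaled(1)[OF g_poly])
  ultimately show ?thesis by (simp add: state_kernel_def sum.distrib mult.commute)
qed

lemma obs_kernel_eq:
  assumes K: "\<And>x \<xi>. K x \<xi> = (\<Sum>k<n. f k x * g k \<xi>)"
  shows "adjp (\<lambda>s. K s \<xi>) x + adjp (\<lambda>s. K x s) \<xi> = obs_kernel x \<xi>"
proof -
  have "adjp (\<lambda>s. K s \<xi>) x = (\<Sum>k<n. adjp (f k) x * g k \<xi>)"
    unfolding K by (rule genp_sum_scaled(2)[OF f_poly])
  moreover have "(\<lambda>s. K x s) = (\<lambda>s. \<Sum>k<n. g k s * f k x)" by (simp add: K mult.commute)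
  then have "adjp (\<lambda>s. K x s) \<xi> = (\<Sum>k<n. adjp (g k) \<xi> * f k x)"
    by (simp only: genp_sum_scaled(2)[OF g_poly])
  ultimately show ?thesis by (simp add: obs_kernel_def sum.distrib mult.commute)
qed

text \<open>The kernel and its mirror image agree on the diagonal, so \<open>deriv a\<close> drops
  out of the second formula.\<close>

lemma kernel_jump:
  assumes K: "\<And>x \<xi>. K x \<xi> = (\<Sum>k<n. f k x * g k \<xi>)"
  shows "deriv (\<lambda>s. K s x - K x s) x = jump x"
    and "deriv (\<lambda>s. a s * (K s x - K x s)) x = a x * jump x"
proof -
  have d: "((\<lambda>s. K s x - K x s) has_real_derivative (\<Sum>k<n. deriv (f k) x * g k x) - (\<Sum>k<n. f k x * deriv (g k) x)) (at x)"
    unfolding K by (intro DERIV_diff DERIV_sum DERIV_cmult DERIV_cmult_right f_deriv g_deriv)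
  then show "deriv (\<lambda>s. K s x - K x s) x = jump x"
    by (auto simp: jump_def sum_subtractf mult.commute dest!: DERIV_imp_deriv)
  have "((\<lambda>s. a s * (K s x - K x s)) has_real_derivative
      deriv a x * (K x x - K x x) + ((\<Sum>k<n. deriv (f k) x * g k x) - (\<Sum>k<n. f k x * deriv (g k) x)) * a x) (at x)"
    by (intro DERIV_mult abc_deriv d)
  then show "deriv (\<lambda>s. a s * (K s x - K x s)) x = a x * jump x"
    by (auto simp: jump_def sum_subtractf mult.commute dest!: DERIV_imp_deriv)
qed

end

lemma Xi_semiseparable:
  assumes X: "(M, K1, K2) \<in> Xi d1 d2 \<epsilon> \<epsilon>'" and eps: "0 < \<epsilon>"
  obtains n :: nat and f g where "semiseparable M n f g \<epsilon>"
    "\<And>x \<xi>. K1 x \<xi> = (\<Sum>k<n. f k x * g k \<xi>)" "\<And>x \<xi>. K2 x \<xi> = K1 \<xi> x"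
proof -
  have p: "real_polynomial_function M" "poly_fun2 K1" and K2: "\<And>x \<xi>. K2 x \<xi> = K1 \<xi> x"
    using X by (auto simp: Xi_def)
  from p(2) obtain n :: nat and f g where
    fg: "\<And>k. real_polynomial_function (f k)" "\<And>k. real_polynomial_function (g k)"
    and K: "\<And>x y. K1 x y = (\<Sum>k<n. f k x * g k y)" by (rule poly_fun2_separable) blast
  have K1: "K1 = (\<lambda>x \<xi>. \<Sum>k<n. f k x * g k \<xi>)" using K by blast
  have "semiseparable M n f g \<epsilon>"
    using p(1) fg eps Xi_multiplier_ge[OF X] Xi_coercive[OF X]
    by unfold_locales (auto simp: K1 less_imp_le)
  then show thesis using K K2 that by blast
qed

theorem theorem2:
  fixes a b c M N :: "real \<Rightarrow> real"
    and K1 K2 P1 P2 :: "real \<Rightarrow> real \<Rightarrow> real"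
    and T0 T4 Q0 Q4 Q6 Q8 :: "real \<Rightarrow> real"
    and T1 T2 Q1 Q2 :: "real \<Rightarrow> real \<Rightarrow> real"
    and T3 T5 T6 Q3 Q5 Q7 :: real
    and \<alpha> \<epsilon>1 \<epsilon>2 \<delta> \<beta> Z1 O2 :: real
    and d1 d2 :: nat
    and F :: "(real \<Rightarrow> real) \<Rightarrow> real"
    and O1 R1 :: "real \<Rightarrow> real"
  assumes "real_polynomial_function a" and "real_polynomial_function b" and "real_polynomial_function c"
    and "0 < \<alpha>" and "\<And>x. x \<in> {0..1} \<Longrightarrow> \<alpha> \<le> a x"
    and "0 < \<epsilon>1" and "\<epsilon>1 < \<epsilon>2" and "0 < \<delta>" and "0 < \<beta>"
    and "(M, K1, K2) \<in> Xi d1 d2 \<epsilon>1 \<epsilon>2"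
    and "(N, P1, P2) \<in> Xi d1 d2 \<epsilon>1 \<epsilon>2"
    and "(T0, T1, T2, T3, T4, T5, T6) = map_M a b c \<alpha> \<epsilon>1 M K1 K2"
    and "(Q0, Q1, Q2, Q3, Q4, Q5, Q6, Q7, Q8) = map_N a b c \<alpha> \<epsilon>1 N P1 P2"
    and "(\<lambda>x. - T0 x - 2 * \<delta> * M x,
          \<lambda>x \<xi>. - T1 x \<xi> - 2 * \<delta> * K1 x \<xi>,
          \<lambda>x \<xi>. - T2 x \<xi> - 2 * \<delta> * K2 x \<xi>) \<in> Xi d1 d2 0 \<beta>"
    and "(\<lambda>x. - Q0 x - 2 * \<delta> * N x,
          \<lambda>x \<xi>. - Q1 x \<xi> - 2 * \<delta> * P1 x \<xi>,
          \<lambda>x \<xi>. - Q2 x \<xi> - 2 * \<delta> * P2 x \<xi>) \<in> Xi d1 d2 0 \<beta>"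
    and "T3 \<le> 0" and "\<And>x. T4 x = 0" and "Q3 \<le> 0" and "\<And>x. Q4 x = 0"
    and "Z1 \<le> 0" and "T5 * Z1 > - T6 * M 1"
    and "F = (\<lambda>g. Z_op Z1 K1 (semisep_inv M K1 K2 g))"
    and "O2 < 0" and "Q5 + 1 / O2 * Q7 < 0"
    and "R1 = (\<lambda>x. - 1 / 2 * (O2 * Q6 x + Q8 x))"
    and "O1 = semisep_inv N P1 P2 R1"
  shows "\<exists>\<gamma>>0. \<forall>f w wh.
           L2_time f \<longrightarrow> coupled_solution a b c F O1 O2 f w wh \<longrightarrow>
           starts_at_rest w \<longrightarrow> starts_at_rest wh \<longrightarrow>
           L2_time w \<and> norm_L2_time w \<le> \<gamma> * norm_L2_time f"
proof -
  obtain n :: nat and f g where sP: "semiseparable M n f g \<epsilon>1"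
    and K1: "\<And>x \<xi>. K1 x \<xi> = (\<Sum>k<n. f k x * g k \<xi>)" and K2: "\<And>x \<xi>. K2 x \<xi> = K1 \<xi> x"
    by (rule Xi_semiseparable[OF assms(10,6)]) blast
  obtain m :: nat and h l where sS: "semiseparable N m h l \<epsilon>1"
    and P1: "\<And>x \<xi>. P1 x \<xi> = (\<Sum>k<m. h k x * l k \<xi>)" and P2: "\<And>x \<xi>. P2 x \<xi> = P1 \<xi> x"
    by (rule Xi_semiseparable[OF assms(11,6)]) blast
  interpret P: lyapunov_data M n f g \<epsilon>1 a b c \<alpha>
    using sP assms(1-5) by (intro lyapunov_data.intro lyapunov_data_axioms.intro)
  interpret S: lyapunov_data N m h l \<epsilon>1 a b c \<alpha>
    using sS assms(1-5) by (intro lyapunov_data.intro lyapunov_data_axioms.intro)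
  have K1_fun: "K1 = (\<lambda>x \<xi>. \<Sum>k<n. f k x * g k \<xi>)" and P1_fun: "P1 = (\<lambda>x \<xi>. \<Sum>k<m. h k x * l k \<xi>)"
    using K1 P1 by blast+
  have d2: "(deriv ^^ 2) u = deriv (deriv u)" for u :: "real \<Rightarrow> real" by (simp add: numeral_2_eq_2)
  note mapM = assms(12)[unfolded map_M_def Let_def d2 prod.inject]
  note mapN = assms(13)[unfolded map_N_def Let_def prod.inject]
  have T0: "T0 = (\<lambda>x. P.state_mult x - pi\<^sup>2 / 2 * \<alpha> * \<epsilon>1)"
    using mapM P.kernel_jump(1)[OF K1] by (simp add: P.state_mult_def K2 fun_eq_iff)
  have T1: "T1 = P.state_kernel"
  proof (intro ext)
    fix x \<xi>
    show "T1 x \<xi> = P.state_kernel x \<xi>"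
      using mapM P.state_kernel_eq[OF K1, of \<xi> x] by (simp add: P.genp_def P.gen_def algebra_simps)
  qed
  have Q1: "Q1 = S.obs_kernel"
  proof (intro ext)
    fix x \<xi>
    have p: "real_polynomial_function (\<lambda>s. P1 s \<xi>)" "real_polynomial_function (\<lambda>s. P1 x s)"
      unfolding P1 using sum_scaled_poly[where p = h and y = "\<lambda>k. l k \<xi>", OF S.f_poly] sum_scaled_poly[where p = l and y = "\<lambda>k. h k x", OF S.g_poly]
      by (simp_all add: mult.commute)
    show "Q1 x \<xi> = S.obs_kernel x \<xi>"
      using mapN S.obs_kernel_eq[OF P1, of \<xi> x] S.adjp_eq[OF p(1), of x] S.adjp_eq[OF p(2), of \<xi>]
      by (simp add: algebra_simps)
  qed
  have Q0: "Q0 = (\<lambda>x. S.obs_mult x - pi\<^sup>2 / 2 * \<alpha> * \<epsilon>1)"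
  proof
    fix x
    \<comment> \<open>The divergence part is \<open>adjp\<close> without its reaction term, since
      \<open>Q0\<close> adds \<open>2 * N x * c x\<close> separately.\<close>
    have "Q0 x = (S.adjp N x - c x * N x) + 2 * (a x * S.jump x) + 2 * N x * c x - pi\<^sup>2 / 2 * \<alpha> * \<epsilon>1"
      using mapN S.kernel_jump(2)[OF P1, of x] S.adjp_eq[OF S.M_poly, of x, symmetric] by (simp add: P2)
    then show "Q0 x = S.obs_mult x - pi\<^sup>2 / 2 * \<alpha> * \<epsilon>1"
      by (simp add: S.adjp_def S.obs_mult_def algebra_simps)
  qed
  have P1_deriv: "deriv (\<lambda>s. P1 s x) = (\<lambda>s. \<Sum>k<m. deriv (h k) s * l k x)"
    "deriv (\<lambda>s. P2 s x) = (\<lambda>s. \<Sum>k<m. deriv (l k) s * h k x)" for x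
    unfolding P1 P2 using deriv_sum_scaled[where p = h and y = "\<lambda>k. l k x", OF S.f_poly] deriv_sum_scaled[where p = l and y = "\<lambda>k. h k x", OF S.g_poly]
    by (simp_all add: mult.commute)
  have K2_deriv: "deriv (\<lambda>s. K2 s x) = (\<lambda>s. \<Sum>k<n. deriv (g k) s * f k x)" for x
    unfolding K1 K2 using deriv_sum_scaled[where p = g and y = "\<lambda>k. f k x", OF P.g_poly] by (simp add: mult.commute)
  have R1_eq: "R1 x = - 1 / 2 * (O2 * (2 * (b 1 - deriv a 1) * (\<Sum>k<m. h k 1 * l k x)
        - 2 * a 1 * (\<Sum>k<m. deriv (h k) 1 * l k x)) + 2 * a 1 * (\<Sum>k<m. h k 1 * l k x))" for x
  proof -
    have "Q6 x = 2 * (b 1 - deriv a 1) * P1 1 x - 2 * a 1 * deriv (\<lambda>s. P1 s x) 1" "Q8 x = 2 * a 1 * P1 1 x"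
      using mapN by simp_all
    then show ?thesis unfolding assms(25) P1_deriv by (simp add: P1)
  qed
  have R1_cont: "continuous_on {0..1} R1"
    unfolding R1_eq[abs_def] by (intro continuous_intros S.poly_cont)
  have P_neg: "qform (\<lambda>x. P.state_mult x - pi\<^sup>2 / 2 * \<alpha> * \<epsilon>1) P.state_kernel z \<le> - 2 * \<delta> * ip z (P.pop z)"
    if z: "continuous_on {0..1} z" for z
    using Xi_dissipative[OF assms(10,14) z] P.qform_eq[OF z] unfolding T0 T1 K1_fun by simp
  have S_neg: "qform (\<lambda>x. S.obs_mult x - pi\<^sup>2 / 2 * \<alpha> * \<epsilon>1) S.obs_kernel z \<le> - 2 * \<delta> * ip z (S.pop z)"
    if z: "continuous_on {0..1} z" for z
    using Xi_dissipative[OF assms(11,15) z] S.qform_eq[OF z] unfolding Q0 Q1 P1_fun by simp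
  interpret observer_feedback M n f g \<epsilon>1 a b c \<alpha> N m h l \<delta> Z1 O2 R1
  proof unfold_locales
    show "(deriv a 0 - b 0) * M 0 + a 0 * deriv M 0 - pi\<^sup>2 / 2 * \<alpha> * \<epsilon>1 \<le> 0"
      using mapM assms(16) by simp
    show "2 * a 0 * (\<Sum>k<n. deriv (g k) 0 * f k x) + pi\<^sup>2 * \<alpha> * \<epsilon>1 = 0" for x
      using mapM assms(17)[of x] by (simp add: K2_deriv)
    show "((b 1 - deriv a 1) * M 1 + a 1 * deriv M 1) * Z1 > - (2 * a 1 * M 1) * M 1"
      using mapM assms(21) by simp
    show "(deriv a 0 - b 0) * N 0 + a 0 * deriv N 0 - pi\<^sup>2 / 2 * \<alpha> * \<epsilon>1 \<le> 0"
      using mapN assms(18) by simp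
    show "2 * (deriv a 0 - b 0) * (\<Sum>k<m. l k 0 * h k x) + 2 * a 0 * (\<Sum>k<m. deriv (l k) 0 * h k x)
        + pi\<^sup>2 * \<alpha> * \<epsilon>1 = 0" for x
    proof -
      have "2 * (deriv a 0 - b 0) * P2 0 x + 2 * a 0 * deriv (\<lambda>s. P2 s x) 0 + pi\<^sup>2 * \<alpha> * \<epsilon>1 = 0"
        using mapN assms(19)[of x] by simp
      then show ?thesis unfolding P1_deriv by (simp add: P1 P2 mult.commute)
    qed
    show "((b 1 - deriv a 1) * N 1 - a 1 * deriv N 1) + 1 / O2 * (2 * a 1 * N 1) < 0"
      using mapN assms(24) by simp
  qed (fact assms(8) R1_cont assms(23) P_neg assms(20) S_neg R1_eq)+
  have O1: "O1 = S.pinv R1"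
    unfolding assms(26) by (rule S.semisep_inv_eq_pinv[OF P1 P2 R1_cont])
  \<comment> \<open>\<open>semisep_inv\<close> and \<open>pinv\<close> are compared at continuous
    arguments, and slices of a classical \<open>wh\<close> are of this kind.\<close>
  have F: "F u = Z1 * D01 (P.pinv u) 1 + ip K1at1 (P.pinv u)" if u: "continuous_on {0..1} u" for u
  proof -
    have "(LBINT x:{0..1}. K1 1 x * P.pinv u x) = ip K1at1 (P.pinv u)"
      unfolding ip_def K1 K1at1_def
      by (rule set_lborel_integral_Icc_eq) (intro continuous_intros P.poly_cont P.pinv_cont[OF u])
    then show ?thesis
      by (simp add: assms(22) Z_op_def P.semisep_inv_eq_pinv[OF K1 K2 u])
  qed
  from closed_loop_gain[OF F] show ?thesis unfolding O1 .
qed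

end
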